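(* Let $s_*\in\{2,\dots,p/e\}$ be an integer. Assume that the $SRE(2s_*,5/3)$ condition holds, put $\kappa_*:=\kappa(2s_* )$, and assume $$\gamma\ge16+4\sqrt2\quad\text{and}\quad\frac{2s_*}{n}\log\left(\frac p{s_*}\right)\le\min\left(\frac{9\kappa_*^2}{256\gamma^2},\ \frac{\kappa_*^4}{2C_2(\gamma)^2}\left(\frac1{\sqrt2}-\frac12\right)^2\right).$$ Then there exist constants $C_0,C_5>0$ depending only on $\gamma$ and $\kappa_*$ such that, for $q\in[1,2]$, using the adaptive procedure with the family $(\hat\beta_{(s)})_{s=1,\dots,s_*}=(\hat\beta^{SQL}_{(s,\gamma)})_{s=1,\dots,s_*}$, the distance $d(\beta,\beta')=|\beta-\beta'|_q$, the weight $w(b)=b^{1/q}\sqrt{(1/n)\log(2p/b)}$ and the constant $C_0$, we have that, for every $s\in\{1,\dots,s_*\}$ and all $\beta^*\in B_0(s)$, the aggregated estimator $\tilde\beta$ satisfies $$\mathbb{P}_{\beta^*}\left(|\tilde\beta-\beta^*|_q\le C_5\,\sigma s^{1/q}\sqrt{\frac1n\log\left(\frac ps\right)}\right)\ge1-3(\log_2(s_* )+1)^2\left(\left(\frac{2s}p\right)^{2s}+u_n\right)-u_{n,p,M},$$ and $$\mathbb{P}_{\beta^*}(\tilde s\le s)\ge1-2(\log_2(s_* )+1)^2\left(\left(\frac{2s}p\right)^{2s}+u_n\right)-u_{n,p,M},$$ where $M=\lfloor\log_2(s_* )\rfloor$, $u_n=(1+e^2)e^{-n/24}$ and $u_{n,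p,M}=(2^{M+1}/p)^{2^{M+1}}+(1+e^2)e^{-n/24}$.
   Context: Model: $Y=\mathbb{X}\beta^*+\varepsilon\in\mathbb{R}^n$, where $\mathbb{X}\in\mathbb{R}^{n\times p}$ is the design matrix, $\beta^*\in\mathbb{R}^p$ is the unknown true parameter and $\varepsilon\sim\mathcal N(0,\sigma^2I_{n\times n})$; $\mathbb{P}_{\beta^*}$ is the distribution of $Y$. $|\cdot|_q$ is the $\ell_q$ norm, $|\cdot|_0$ the number of non-zero coordinates, $B_0(s):=\{\beta^*\in\mathbb{R}^p:|\beta^*|_0\le s\}$, $\|u\|_n^2=\frac1n\sum_{i=1}^nu_i^2$, and $(e_j)$ is the canonical basis of $\mathbb{R}^p$. $SRE(s,c_0)$ condition: $\max_j\|\mathbb{X}e_j\|_n\le1$ and $\kappa(s):=\min_{\delta\in C_{SRE}(s,c_0),\,\delta\ne0}\|\mathbb{X}\delta\|_n/|\delta|_2>0$, where $C_{SRE}(s,c_0):=\{\delta\in\mathbb{R}^p:|\delta|_1\le(1+c_0)\sqrt s|\delta|_2\}$. Here $\kappa(\cdot)$ is taken with $c_0=5/3$. Square-Root Lasso: $\hat\beta^{SQL}_{(s,\gamma)}\in\arg\min_{\beta\in\mathbb{R}^p}\left(\frac1{\sqrt n}|Y-\mathbb{X}\beta|_2+\lambda_{(s,\gamma)}|\beta|_1\right)$ with $\lambda_{(s,\gamma)}=\gamma\sqrt{\frac1n\log\left(\frac{2p}s\right)}$. Constant $C_2(\gamma)$: the positive constant, depending only on $\gamma\ge16+4\sqrt2$,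 in the following bound: whenever $SRE(s,5/3)$ holds and $\frac sn\log(2p/s)\le9\kappa(s)^2/(256\gamma^2)$, for every $\beta^*\in B_0(s)$ one has $\|\mathbb{X}(\hat\beta^{SQL}_{(s,\gamma)}-\beta^* )\|_n\le\frac{C_2(\gamma)}{\kappa(s)^2}\sigma\sqrt{\frac sn\log\left(\frac ps\right)}$ with $\mathbb{P}_{\beta^*}$-probability at least $1-(s/p)^s-(1+e^2)e^{-n/24}$. Adaptive procedure (inputs: distance $d$, function $w$, constant $C_0$, family $(\hat\beta_{(s)})$). With $M=\lfloor\log_2(s_* )\rfloor$, compute $\hat\beta_{(2^m)}$ for $m=1,\dots,M+1$, compute $\hat\sigma=\|Y-\mathbb{X}\hat\beta_{(2^{M+1})}\|_n$ and $$S_1=\left\{m\in\{1,\dots,M\}:\ d\left(\hat\beta_{(2^{k-1})},\hat\beta_{(2^k)}\right)\le4\hat\sigma C_0w(2^k)\ \text{for all } k\in\{m,\dots,M\}\right\}.$$ Set $\tilde m=\min S_1$ if $S_1\ne\emptyset$ and $\tilde m=M$ otherwise. Output $\tilde s=2^{\tilde m}$ and $\tilde\beta=\hat\beta_{(\tilde s)}$.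
   Formalization: For s=1 the second bound is proved for the event s̃≤2 instead of s̃≤1, because the procedure always gives s̃≥2; for s≥2 it is as printed. The bound defining C_2(γ) is assumed only for 1≤s≤2p/e, since no such constant exists for all s up to p. *)

theory Defs
  imports "HOL-Probability.Probability"
begin

text \<open>
  The constants of the statement must not depend on \<open>n\<close> and \<open>p\<close>, so these dimensions are
  quantified inside formulas and cannot be types. A vector of \<open>\<real>\<^sup>n\<close> is a function
  \<open>nat \<Rightarrow> real\<close>, extensional on \<open>{..<n}\<close>; an \<open>n \<times> p\<close> matrix is a function
  \<open>nat \<Rightarrow> nat \<Rightarrow> real\<close> of which only the entries \<open>i < n\<close>, \<open>j < p\<close> are used.
\<close>

definition Rn :: "nat \<Rightarrow> (nat \<Rightarrow> real) measure" where
  "Rn n = (\<Pi>\<^sub>M i\<in>{..<n}. borel)"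

definition vsub :: "(nat \<Rightarrow> real) \<Rightarrow> (nat \<Rightarrow> real) \<Rightarrow> nat \<Rightarrow> real" where
  "vsub u v = (\<lambda>i. u i - v i)"

definition matvec :: "nat \<Rightarrow> nat \<Rightarrow> (nat \<Rightarrow> nat \<Rightarrow> real) \<Rightarrow> (nat \<Rightarrow> real) \<Rightarrow> nat \<Rightarrow> real" where
  "matvec n p X b = (\<lambda>i\<in>{..<n}. \<Sum>j<p. X i j * b j)"

definition basis_vec :: "nat \<Rightarrow> nat \<Rightarrow> nat \<Rightarrow> real" where
  "basis_vec p j = (\<lambda>k\<in>{..<p}. if k = j then 1 else 0)"

definition lq_norm :: "nat \<Rightarrow> real \<Rightarrow> (nat \<Rightarrow> real) \<Rightarrow> real" where
  "lq_norm p q u = (\<Sum>j<p. \<bar>u j\<bar> powr q) powr (1 / q)"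

definition l0_norm :: "nat \<Rightarrow> (nat \<Rightarrow> real) \<Rightarrow> nat" where
  "l0_norm p u = card {j \<in> {..<p}. u j \<noteq> 0}"

definition emp_norm :: "nat \<Rightarrow> (nat \<Rightarrow> real) \<Rightarrow> real" where
  "emp_norm n u = sqrt (1 / real n * (\<Sum>i<n. (u i)\<^sup>2))"

definition B0 :: "nat \<Rightarrow> nat \<Rightarrow> (nat \<Rightarrow> real) set" where
  "B0 p s = {b \<in> space (Rn p). l0_norm p b \<le> s}"

definition gauss_noise :: "nat \<Rightarrow> real \<Rightarrow> (nat \<Rightarrow> real) measure" where
  "gauss_noise n \<sigma> = (\<Pi>\<^sub>M i\<in>{..<n}. density lborel (normal_density 0 \<sigma>))"

text \<open>The law of \<open>Y = X \<beta> + \<epsilon>\<close>.\<close>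

definition model_law ::
  "nat \<Rightarrow> nat \<Rightarrow> (nat \<Rightarrow> nat \<Rightarrow> real) \<Rightarrow> real \<Rightarrow> (nat \<Rightarrow> real) \<Rightarrow> (nat \<Rightarrow> real) measure" where
  "model_law n p X \<sigma> b =
     distr (gauss_noise n \<sigma>) (Rn n) (\<lambda>e. \<lambda>i\<in>{..<n}. matvec n p X b i + e i)"

definition C_SRE :: "nat \<Rightarrow> nat \<Rightarrow> real \<Rightarrow> (nat \<Rightarrow> real) set" where
  "C_SRE p s c0 = {\<delta> \<in> space (Rn p). lq_norm p 1 \<delta> \<le> (1 + c0) * sqrt (real s) * lq_norm p 2 \<delta>}"

text \<open>
  The ratio is invariant under scaling, so the infimum is a minimum over the compact unit
  sphere of the closed cone.
\<close>

definition kappa :: "nat \<Rightarrow> nat \<Rightarrow> (nat \<Rightarrow> nat \<Rightarrow> real) \<Rightarrow> nat \<Rightarrow> real \<Rightarrow> real" where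
  "kappa n p X s c0 =
     (INF \<delta> \<in> {\<delta> \<in> C_SRE p s c0. \<exists>j<p. \<delta> j \<noteq> 0}. emp_norm n (matvec n p X \<delta>) / lq_norm p 2 \<delta>)"

definition SRE :: "nat \<Rightarrow> nat \<Rightarrow> (nat \<Rightarrow> nat \<Rightarrow> real) \<Rightarrow> nat \<Rightarrow> real \<Rightarrow> bool" where
  "SRE n p X s c0 \<longleftrightarrow>
     (\<forall>j<p. emp_norm n (matvec n p X (basis_vec p j)) \<le> 1) \<and> kappa n p X s c0 > 0"

definition sql_lambda :: "nat \<Rightarrow> nat \<Rightarrow> nat \<Rightarrow> real \<Rightarrow> real" where
  "sql_lambda n p s \<gamma> = \<gamma> * sqrt (1 / real n * ln (2 * real p / real s))"

definition sql_objective ::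
  "nat \<Rightarrow> nat \<Rightarrow> (nat \<Rightarrow> nat \<Rightarrow> real) \<Rightarrow> nat \<Rightarrow> real \<Rightarrow> (nat \<Rightarrow> real) \<Rightarrow> (nat \<Rightarrow> real) \<Rightarrow> real" where
  "sql_objective n p X s \<gamma> y b =
     1 / sqrt (real n) * lq_norm n 2 (vsub y (matvec n p X b)) + sql_lambda n p s \<gamma> * lq_norm p 1 b"

text \<open>
  The minimizer need not be unique: an estimator is any measurable function of the observation
  \<open>y\<close> that selects a minimizer.
\<close>

definition sql_estimator ::
  "nat \<Rightarrow> nat \<Rightarrow> (nat \<Rightarrow> nat \<Rightarrow> real) \<Rightarrow> nat \<Rightarrow> real \<Rightarrow> ((nat \<Rightarrow> real) \<Rightarrow> nat \<Rightarrow> real) \<Rightarrow> bool" where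
  "sql_estimator n p X s \<gamma> B \<longleftrightarrow>
     B \<in> measurable (Rn n) (Rn p) \<and>
     (\<forall>y \<in> space (Rn n). \<forall>b \<in> space (Rn p).
        sql_objective n p X s \<gamma> y (B y) \<le> sql_objective n p X s \<gamma> y b)"

text \<open>
  \<open>C\<close> is admissible as the constant \<open>C\<^sub>2(\<gamma>)\<close> of the prediction bound for the Square-Root Lasso.
  The bound is required for \<open>s \<le> 2 p / e\<close>, that is, for the sparsities up to \<open>2 s\<^sub>*\<close> with
  \<open>s\<^sub>* \<le> p / e\<close>. Without this restriction no \<open>C\<close> would be admissible: as \<open>s\<close> approaches \<open>p\<close> the
  factor \<open>log (p / s)\<close> tends to \<open>0\<close>, while the estimation error does not vanish.
\<close>

definition sql_prediction_constant :: "real \<Rightarrow> real \<Rightarrow> bool" where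
  "sql_prediction_constant \<gamma> C \<longleftrightarrow> 0 < C \<and>
     (\<forall>n p s :: nat. \<forall>X \<sigma> B. \<forall>b \<in> B0 p s.
        1 \<le> n \<longrightarrow> 1 \<le> s \<longrightarrow> real s \<le> 2 * real p / exp 1 \<longrightarrow> 0 < \<sigma> \<longrightarrow>
        SRE n p X s (5/3) \<longrightarrow>
        real s / real n * ln (2 * real p / real s) \<le> 9 * (kappa n p X s (5/3))\<^sup>2 / (256 * \<gamma>\<^sup>2) \<longrightarrow>
        sql_estimator n p X s \<gamma> B \<longrightarrow>
        measure (model_law n p X \<sigma> b)
          {y \<in> space (model_law n p X \<sigma> b).
             emp_norm n (matvec n p X (vsub (B y) b))
               \<le> C / (kappa n p X s (5/3))\<^sup>2 * \<sigma> * sqrt (real s / real n * ln (real p / real s))}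
          \<ge> 1 - (real s / real p) ^ s - (1 + (exp 1)\<^sup>2) * exp (- real n / 24))"

text \<open>
  The adaptive procedure, for a distance \<open>d\<close>, a weight \<open>w\<close>, a constant \<open>C0\<close>, a family of
  estimators \<open>B s\<close> (functions of the observation) and an observation \<open>y\<close>. The members of the
  family that it uses are those with \<open>s = 2 ^ m\<close>, \<open>0 \<le> m \<le> M + 1\<close>.
\<close>

definition adapt_M :: "nat \<Rightarrow> nat" where
  "adapt_M s_max = nat \<lfloor>log 2 (real s_max)\<rfloor>"

definition adapt_sigma_hat ::
  "nat \<Rightarrow> nat \<Rightarrow> (nat \<Rightarrow> nat \<Rightarrow> real) \<Rightarrow> nat \<Rightarrow> (nat \<Rightarrow> (nat \<Rightarrow> real) \<Rightarrow> nat \<Rightarrow> real)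
    \<Rightarrow> (nat \<Rightarrow> real) \<Rightarrow> real" where
  "adapt_sigma_hat n p X s_max B y =
     emp_norm n (vsub y (matvec n p X (B (2 ^ (adapt_M s_max + 1)) y)))"

definition adapt_S1 ::
  "nat \<Rightarrow> nat \<Rightarrow> (nat \<Rightarrow> nat \<Rightarrow> real) \<Rightarrow> nat \<Rightarrow> ((nat \<Rightarrow> real) \<Rightarrow> (nat \<Rightarrow> real) \<Rightarrow> real)
    \<Rightarrow> (real \<Rightarrow> real) \<Rightarrow> real \<Rightarrow> (nat \<Rightarrow> (nat \<Rightarrow> real) \<Rightarrow> nat \<Rightarrow> real) \<Rightarrow> (nat \<Rightarrow> real) \<Rightarrow> nat set" where
  "adapt_S1 n p X s_max d w C0 B y =
     {m \<in> {1..adapt_M s_max}. \<forall>k \<in> {m..adapt_M s_max}.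
        d (B (2 ^ (k - 1)) y) (B (2 ^ k) y) \<le> 4 * adapt_sigma_hat n p X s_max B y * C0 * w (2 ^ k)}"

definition adapt_m ::
  "nat \<Rightarrow> nat \<Rightarrow> (nat \<Rightarrow> nat \<Rightarrow> real) \<Rightarrow> nat \<Rightarrow> ((nat \<Rightarrow> real) \<Rightarrow> (nat \<Rightarrow> real) \<Rightarrow> real)
    \<Rightarrow> (real \<Rightarrow> real) \<Rightarrow> real \<Rightarrow> (nat \<Rightarrow> (nat \<Rightarrow> real) \<Rightarrow> nat \<Rightarrow> real) \<Rightarrow> (nat \<Rightarrow> real) \<Rightarrow> nat" where
  "adapt_m n p X s_max d w C0 B y =
     (if adapt_S1 n p X s_max d w C0 B y \<noteq> {} then Min (adapt_S1 n p X s_max d w C0 B y)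
      else adapt_M s_max)"

definition adapt_s ::
  "nat \<Rightarrow> nat \<Rightarrow> (nat \<Rightarrow> nat \<Rightarrow> real) \<Rightarrow> nat \<Rightarrow> ((nat \<Rightarrow> real) \<Rightarrow> (nat \<Rightarrow> real) \<Rightarrow> real)
    \<Rightarrow> (real \<Rightarrow> real) \<Rightarrow> real \<Rightarrow> (nat \<Rightarrow> (nat \<Rightarrow> real) \<Rightarrow> nat \<Rightarrow> real) \<Rightarrow> (nat \<Rightarrow> real) \<Rightarrow> nat" where
  "adapt_s n p X s_max d w C0 B y = 2 ^ adapt_m n p X s_max d w C0 B y"

definition adapt_beta ::
  "nat \<Rightarrow> nat \<Rightarrow> (nat \<Rightarrow> nat \<Rightarrow> real) \<Rightarrow> nat \<Rightarrow> ((nat \<Rightarrow> real) \<Rightarrow> (nat \<Rightarrow> real) \<Rightarrow> real)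
    \<Rightarrow> (real \<Rightarrow> real) \<Rightarrow> real \<Rightarrow> (nat \<Rightarrow> (nat \<Rightarrow> real) \<Rightarrow> nat \<Rightarrow> real) \<Rightarrow> (nat \<Rightarrow> real)
    \<Rightarrow> nat \<Rightarrow> real" where
  "adapt_beta n p X s_max d w C0 B y = B (adapt_s n p X s_max d w C0 B y) y"

text \<open>
  The procedure never selects a sparsity below \<open>2\<close>. A lower bound on the probability of
  \<open>adapt_s \<le> s\<close> is therefore stated with \<open>max 2 s\<close> in place of \<open>s\<close>, which only matters
  for \<open>s = 1\<close>.
\<close>

lemma adapt_s_ge_2:
  assumes "2 \<le> s_max"
  shows "2 \<le> adapt_s n p X s_max d w C0 B y"
proof -
  have "1 \<le> log 2 (real s_max)"
    using assms by (simp add: le_log_iff)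
  then have M: "1 \<le> adapt_M s_max"
    by (simp add: adapt_M_def le_nat_iff le_floor_iff)
  have sub: "adapt_S1 n p X s_max d w C0 B y \<subseteq> {1..adapt_M s_max}"
    by (auto simp: adapt_S1_def)
  then have "finite (adapt_S1 n p X s_max d w C0 B y)"
    using finite_subset by blast
  then have "1 \<le> adapt_m n p X s_max d w C0 B y"
    unfolding adapt_m_def using M sub Min_in by (auto split: if_splits)
  then show ?thesis
    unfolding adapt_s_def
    using power_increasing[of 1 "adapt_m n p X s_max d w C0 B y" "2::nat"] by simp
qed

end

theory Submission
  imports Defs
begin

text \<open>
  The estimation error of the Square-Root Lasso is controlled at all the dyadic sparsity levels
  that matter on one event; on this event Lepski's selection rule is analysed deterministically.

  The noise is handled by a greedy decomposition. Suppose that no \<open>s\<close> columns of the design explain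
  more than \<open>16 s \<sigma>\<^sup>2 log (2 p / s)\<close> of the squared length of the noise. Selecting columns one by one,
  as long as one of them is correlated too strongly with the residual, then stops before \<open>s\<close> columns
  are used, and writes the noise as a sum of a short vector and of a vector with uniformly small
  correlation with every column (\<open>sparse_gain_bound_decomposition\<close>). The supposition fails with
  probability at most \<open>exp (- 2 s log (2 p / s))\<close>, by a chi-square bound and a union bound over
  supports (\<open>gauss_noise_sparse_gain_log\<close>). This gives directly the exponent in the
  probability \<open>(2 s / p)^(2 s)\<close>, for which bounds on each single correlation would not be enough.

  Given this control of the noise, and a noise norm of order \<open>\<sigma>\<close>, minimality of the
  Square-Root Lasso objective confines the error to the cone of the restricted eigenvalue
  condition. This bounds the \<open>\<ell>\<^sub>1\<close> and \<open>\<ell>\<^sub>2\<close> errors, and hence all \<open>\<ell>\<^sub>q\<close> errors with \<open>1 \<le> q \<le> 2\<close>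
  (\<open>sql_lq_error_bound\<close>). The bound tolerates a tuning parameter that is smaller than the true
  sparsity by a constant factor, which is essential: the event that the selected sparsity is at most
  \<open>s\<close> involves a comparison with the estimator tuned for a sparsity below \<open>s\<close>.

  The hypothesis on \<open>C2\<close> enters through the pilot estimator with sparsity \<open>2^(M + 1)\<close>: its small
  prediction error places the estimated noise level between \<open>\<sigma> / 2\<close> and \<open>3 \<sigma>\<close>
  (\<open>sigma_hat_bounds\<close>), and its failure probability is the term \<open>uM\<close>. With this estimate the test
  of the selection rule is passed at every level above the true sparsity, and the accepted
  comparisons below it add up to a geometric series (\<open>adaptive_selection_bound\<close>).
\<close>

section \<open>Exponential moments of Gaussian noise\<close>

text \<open>
  Completing the square turns the integrand into a multiple of another normal density.
\<close>

lemma nn_integral_gauss_exp_linear: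
  assumes "0 < \<sigma>"
  shows "(\<integral>\<^sup>+x. ennreal (exp (c * x)) \<partial>density lborel (normal_density 0 \<sigma>)) = ennreal (exp (c\<^sup>2 * \<sigma>\<^sup>2 / 2))"
proof -
  have eq: "normal_density 0 \<sigma> x * exp (c * x) = exp (c\<^sup>2 * \<sigma>\<^sup>2 / 2) * normal_density (c * \<sigma>\<^sup>2) \<sigma> x" for x
  proof -
    have "- (x\<^sup>2) / (2 * \<sigma>\<^sup>2) + c * x = c\<^sup>2 * \<sigma>\<^sup>2 / 2 + - ((x - c * \<sigma>\<^sup>2)\<^sup>2) / (2 * \<sigma>\<^sup>2)"
      using assms by (simp add: field_simps power2_eq_square)
    then show ?thesis
      unfolding normal_density_def by (simp flip: exp_add add: mult_ac)
  qed
  have "(\<integral>\<^sup>+x. ennreal (exp (c * x)) \<partial>density lborel (normal_density 0 \<sigma>))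
      = (\<integral>\<^sup>+x. ennreal (normal_density 0 \<sigma> x * exp (c * x)) \<partial>lborel)"
    by (subst nn_integral_density) (auto simp: ennreal_mult' intro!: nn_integral_cong)
  also have "\<dots> = (\<integral>\<^sup>+x. ennreal (exp (c\<^sup>2 * \<sigma>\<^sup>2 / 2)) * ennreal (normal_density (c * \<sigma>\<^sup>2) \<sigma> x) \<partial>lborel)"
    by (simp add: eq ennreal_mult')
  also have "\<dots> = ennreal (exp (c\<^sup>2 * \<sigma>\<^sup>2 / 2)) * (\<integral>\<^sup>+x. ennreal (normal_density (c * \<sigma>\<^sup>2) \<sigma> x) \<partial>lborel)"
    by (rule nn_integral_cmult) simp
  also have "(\<integral>\<^sup>+x. ennreal (normal_density (c * \<sigma>\<^sup>2) \<sigma> x) \<partial>lborel) = 1"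
    using assms by (subst nn_integral_eq_integral) (auto simp: normal_density_nonneg)
  finally show ?thesis by simp
qed

lemma nn_integral_gauss_exp_square:
  assumes "0 < \<sigma>" and "\<theta> < 1 / 2"
  shows "(\<integral>\<^sup>+x. ennreal (exp (\<theta> * (x\<^sup>2 / \<sigma>\<^sup>2))) \<partial>density lborel (normal_density 0 \<sigma>))
    = ennreal (1 / sqrt (1 - 2 * \<theta>))"
proof -
  define \<tau> where "\<tau> = \<sigma> / sqrt (1 - 2 * \<theta>)"
  have pos: "0 < 1 - 2 * \<theta>" using assms by simp
  have \<tau>: "0 < \<tau>" "\<tau>\<^sup>2 = \<sigma>\<^sup>2 / (1 - 2 * \<theta>)"
    using assms pos by (auto simp: \<tau>_def power_divide)
  have eq: "normal_density 0 \<sigma> x * exp (\<theta> * (x\<^sup>2 / \<sigma>\<^sup>2)) = 1 / sqrt (1 - 2 * \<theta>) * normal_density 0 \<tau> x" for x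
  proof -
    have e: "- (x\<^sup>2) / (2 * \<sigma>\<^sup>2) + \<theta> * (x\<^sup>2 / \<sigma>\<^sup>2) = - (x\<^sup>2) / (2 * \<tau>\<^sup>2)"
      using assms pos unfolding \<tau>(2) by (simp add: field_simps)
    have "sqrt (2 * pi * \<tau>\<^sup>2) * sqrt (1 - 2 * \<theta>) = sqrt (2 * pi * \<sigma>\<^sup>2)"
      unfolding \<tau>(2) real_sqrt_mult[symmetric] using pos by simp
    then have f: "1 / sqrt (1 - 2 * \<theta>) * (1 / sqrt (2 * pi * \<tau>\<^sup>2)) = 1 / sqrt (2 * pi * \<sigma>\<^sup>2)"
      by (simp add: mult.commute)
    have "normal_density 0 \<sigma> x * exp (\<theta> * (x\<^sup>2 / \<sigma>\<^sup>2))
       = 1 / sqrt (2 * pi * \<sigma>\<^sup>2) * exp (- (x\<^sup>2) / (2 * \<sigma>\<^sup>2) + \<theta> * (x\<^sup>2 / \<sigma>\<^sup>2))"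
      unfolding normal_density_def exp_add by simp
    also have "\<dots> = 1 / sqrt (1 - 2 * \<theta>) * (1 / sqrt (2 * pi * \<tau>\<^sup>2)) * exp (- (x\<^sup>2) / (2 * \<tau>\<^sup>2))"
      unfolding e f ..
    finally show ?thesis
      unfolding normal_density_def by simp
  qed
  have "(\<integral>\<^sup>+x. ennreal (exp (\<theta> * (x\<^sup>2 / \<sigma>\<^sup>2))) \<partial>density lborel (normal_density 0 \<sigma>))
      = (\<integral>\<^sup>+x. ennreal (normal_density 0 \<sigma> x * exp (\<theta> * (x\<^sup>2 / \<sigma>\<^sup>2))) \<partial>lborel)"
    by (subst nn_integral_density) (auto simp: ennreal_mult' intro!: nn_integral_cong)
  also have "\<dots> = (\<integral>\<^sup>+x. ennreal (1 / sqrt (1 - 2 * \<theta>)) * ennreal (normal_density 0 \<tau> x) \<partial>lborel)"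
    unfolding eq using pos by (subst ennreal_mult'[symmetric]) auto
  also have "\<dots> = ennreal (1 / sqrt (1 - 2 * \<theta>)) * (\<integral>\<^sup>+x. ennreal (normal_density 0 \<tau> x) \<partial>lborel)"
    by (rule nn_integral_cmult) simp
  also have "(\<integral>\<^sup>+x. ennreal (normal_density 0 \<tau> x) \<partial>lborel) = 1"
    using \<tau> by (subst nn_integral_eq_integral) (auto simp: normal_density_nonneg)
  finally show ?thesis by simp
qed

lemma prob_space_gauss_noise:
  assumes "0 < \<sigma>"
  shows "prob_space (gauss_noise n \<sigma>)"
  unfolding gauss_noise_def using assms
  by (intro prob_space_PiM) (auto intro: prob_space_normal_density)

lemma sets_gauss_noise [simp, measurable_cong]: "sets (gauss_noise n \<sigma>) = sets (Rn n)"
  unfolding gauss_noise_def Rn_def by (intro sets_PiM_cong) auto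

lemma space_gauss_noise [simp]: "space (gauss_noise n \<sigma>) = space (Rn n)"
  by (rule sets_eq_imp_space_eq) simp

lemma measurable_Rn_component [measurable (raw)]:
  assumes "i \<in> {..<n}"
  shows "(\<lambda>y. y i) \<in> borel_measurable (Rn n)"
  unfolding Rn_def using assms by (rule measurable_component_singleton)

lemma measurable_Rn_component_compose [measurable_dest]:
  assumes "f \<in> measurable N (Rn n)" and "g \<in> measurable L N" and "i \<in> {..<n}"
  shows "(\<lambda>x. (f (g x)) i) \<in> borel_measurable L"
  using measurable_compose[OF measurable_compose[OF assms(2,1)] measurable_Rn_component[OF assms(3)]] .

lemma nn_integral_gauss_noise_prod:
  assumes "0 < \<sigma>" and "\<And>i. i < n \<Longrightarrow> f i \<in> borel_measurable borel"
  shows "(\<integral>\<^sup>+x. (\<Prod>i<n. f i (x i)) \<partial>gauss_noise n \<sigma>)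
    = (\<Prod>i<n. \<integral>\<^sup>+x. f i x \<partial>density lborel (normal_density 0 \<sigma>))"
proof -
  interpret prob_space "density lborel (normal_density 0 \<sigma>)"
    using assms(1) by (rule prob_space_normal_density)
  interpret product_sigma_finite "\<lambda>i::nat. density lborel (normal_density 0 \<sigma>)" ..
  show ?thesis
    unfolding gauss_noise_def using assms(2) by (intro product_nn_integral_prod) auto
qed

lemma nn_integral_gauss_noise_exp_linear:
  assumes "0 < \<sigma>"
  shows "(\<integral>\<^sup>+x. ennreal (exp (\<Sum>i<n. c i * x i)) \<partial>gauss_noise n \<sigma>)
    = ennreal (exp (\<sigma>\<^sup>2 / 2 * (\<Sum>i<n. (c i)\<^sup>2)))"
proof -
  have "(\<integral>\<^sup>+x. ennreal (exp (\<Sum>i<n. c i * x i)) \<partial>gauss_noise n \<sigma>)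
     = (\<integral>\<^sup>+x. (\<Prod>i<n. ennreal (exp (c i * x i))) \<partial>gauss_noise n \<sigma>)"
    by (simp add: exp_sum prod_ennreal)
  also have "\<dots> = (\<Prod>i<n. ennreal (exp ((c i)\<^sup>2 * \<sigma>\<^sup>2 / 2)))"
    using assms by (subst nn_integral_gauss_noise_prod) (auto simp: nn_integral_gauss_exp_linear)
  also have "\<dots> = ennreal (exp (\<Sum>i<n. (c i)\<^sup>2 * \<sigma>\<^sup>2 / 2))"
    by (simp add: exp_sum prod_ennreal)
  finally show ?thesis
    by (simp add: sum_distrib_left mult_ac)
qed

lemma nn_integral_gauss_noise_exp_square:
  assumes "0 < \<sigma>" and "\<theta> < 1 / 2"
  shows "(\<integral>\<^sup>+x. ennreal (exp (\<theta> * (\<Sum>i<n. (x i)\<^sup>2 / \<sigma>\<^sup>2))) \<partial>gauss_noise n \<sigma>)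
    = ennreal ((1 / sqrt (1 - 2 * \<theta>)) ^ n)"
proof -
  have "(\<integral>\<^sup>+x. ennreal (exp (\<theta> * (\<Sum>i<n. (x i)\<^sup>2 / \<sigma>\<^sup>2))) \<partial>gauss_noise n \<sigma>)
     = (\<integral>\<^sup>+x. (\<Prod>i<n. ennreal (exp (\<theta> * ((x i)\<^sup>2 / \<sigma>\<^sup>2)))) \<partial>gauss_noise n \<sigma>)"
    by (simp add: exp_sum prod_ennreal sum_distrib_left)
  also have "\<dots> = (\<Prod>i<n. ennreal (1 / sqrt (1 - 2 * \<theta>)))"
    using assms by (subst nn_integral_gauss_noise_prod) (auto simp: nn_integral_gauss_exp_square[simplified])
  also have "\<dots> = ennreal ((1 / sqrt (1 - 2 * \<theta>)) ^ n)"
    using assms by (simp add: ennreal_power)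
  finally show ?thesis .
qed

text \<open>
  The coordinates of the noise along an orthonormal family are again independent Gaussians. The
  proof avoids rotating the measure: each \<open>exp (y\<^sup>2 / (4 \<sigma>\<^sup>2))\<close> is the exponential moment of
  \<open>y z / (\<surd>2 \<sigma>)\<close> for an auxiliary standard Gaussian \<open>z\<close>. After exchanging the two integrals the
  noise is integrated against a linear form whose coefficient vector has, by orthonormality, the
  length of \<open>z\<close>, and a product of one-dimensional integrals remains.
\<close>

lemma nn_integral_gauss_noise_exp_orthonormal:
  assumes "0 < \<sigma>"
    and orth: "\<And>a b. a < k \<Longrightarrow> b < k \<Longrightarrow> (\<Sum>i<n. f a i * f b i) = (if a = b then 1 else (0::real))"
  shows "(\<integral>\<^sup>+x. ennreal (exp ((1/4) * (\<Sum>a<k. (\<Sum>i<n. x i * f a i)\<^sup>2 / \<sigma>\<^sup>2))) \<partial>gauss_noise n \<sigma>)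
    = ennreal (sqrt 2 ^ k)"
proof -
  interpret E: prob_space "gauss_noise n \<sigma>" using assms(1) by (rule prob_space_gauss_noise)
  interpret Z: prob_space "gauss_noise k 1" by (rule prob_space_gauss_noise) simp
  interpret P: pair_sigma_finite "gauss_noise n \<sigma>" "gauss_noise k 1" ..
  define r where "r = 1 / (sqrt 2 * \<sigma>)"
  have r2: "r\<^sup>2 = 1 / (2 * \<sigma>\<^sup>2)" by (simp add: r_def power_divide power_mult_distrib)
  define h where "h x z = (\<Sum>a<k. \<Sum>i<n. r * (z a * (x i * f a i)))" for x z :: "nat \<Rightarrow> real"
  have fst_snd [measurable]: "fst \<in> measurable (gauss_noise n \<sigma> \<Otimes>\<^sub>M gauss_noise k 1) (Rn n)"
    "snd \<in> measurable (gauss_noise n \<sigma> \<Otimes>\<^sub>M gauss_noise k 1) (Rn k)"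
    by (auto intro: measurable_cong_sets[THEN equalityD1, THEN subsetD, OF refl sets_gauss_noise] measurable_fst measurable_snd)
  have [measurable]: "(\<lambda>(x, z). ennreal (exp (h x z))) \<in> borel_measurable (gauss_noise n \<sigma> \<Otimes>\<^sub>M gauss_noise k 1)"
    unfolding h_def by measurable
  have 1: "ennreal (exp ((1/4) * (\<Sum>a<k. (\<Sum>i<n. x i * f a i)\<^sup>2 / \<sigma>\<^sup>2)))
     = (\<integral>\<^sup>+z. ennreal (exp (h x z)) \<partial>gauss_noise k 1)" for x
  proof -
    define y where "y a = (\<Sum>i<n. x i * f a i)" for a
    have "h x z = (\<Sum>a<k. (r * (\<Sum>i<n. x i * f a i)) * z a)" for z
      unfolding h_def by (simp add: sum_distrib_left mult_ac)
    then have "(\<integral>\<^sup>+z. ennreal (exp (h x z)) \<partial>gauss_noise k 1)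
      = ennreal (exp (1 / 2 * (\<Sum>a<k. (r * (\<Sum>i<n. x i * f a i))\<^sup>2)))"
      by (simp add: nn_integral_gauss_noise_exp_linear)
    also have "1 / 2 * (\<Sum>a<k. (r * (\<Sum>i<n. x i * f a i))\<^sup>2)
        = (1/4) * (\<Sum>a<k. (\<Sum>i<n. x i * f a i)\<^sup>2 / \<sigma>\<^sup>2)"
      unfolding y_def[symmetric] power_mult_distrib r2 by (simp add: sum_distrib_left)
    finally show ?thesis by simp
  qed
  have 2: "(\<integral>\<^sup>+x. ennreal (exp (h x z)) \<partial>gauss_noise n \<sigma>) = ennreal (exp ((1/4) * (\<Sum>a<k. (z a)\<^sup>2 / 1\<^sup>2)))" for z
  proof -
    have "h x z = (\<Sum>i<n. (r * (\<Sum>a<k. z a * f a i)) * x i)" for x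
      unfolding h_def by (subst sum.swap) (simp add: sum_distrib_left sum_distrib_right mult_ac)
    then have "(\<integral>\<^sup>+x. ennreal (exp (h x z)) \<partial>gauss_noise n \<sigma>)
      = ennreal (exp (\<sigma>\<^sup>2 / 2 * (\<Sum>i<n. (r * (\<Sum>a<k. z a * f a i))\<^sup>2)))"
      using assms by (simp add: nn_integral_gauss_noise_exp_linear)
    also have "(\<Sum>i<n. (r * (\<Sum>a<k. z a * f a i))\<^sup>2) = r\<^sup>2 * (\<Sum>i<n. (\<Sum>a<k. \<Sum>b<k. (z a * f a i) * (z b * f b i)))"
      unfolding power_mult_distrib sum_distrib_left[symmetric] power2_eq_square[of "sum _ _"] sum_product ..
    also have "(\<Sum>i<n. (\<Sum>a<k. \<Sum>b<k. (z a * f a i) * (z b * f b i))) = (\<Sum>a<k. \<Sum>i<n. \<Sum>b<k. (z a * f a i) * (z b * f b i))"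
      by (rule sum.swap)
    also have "\<dots> = (\<Sum>a<k. \<Sum>b<k. \<Sum>i<n. (z a * f a i) * (z b * f b i))"
      by (intro sum.cong refl sum.swap)
    also have "\<dots> = (\<Sum>a<k. \<Sum>b<k. z a * z b * (\<Sum>i<n. f a i * f b i))"
      by (simp add: sum_distrib_left mult_ac)
    also have "\<dots> = (\<Sum>a<k. \<Sum>b<k. if a = b then z a * z b else 0)"
      by (intro sum.cong refl) (simp add: orth)
    also have "\<dots> = (\<Sum>a<k. (z a)\<^sup>2)"
      by (simp add: power2_eq_square)
    finally show ?thesis using assms by (simp add: r2)
  qed
  have "(\<integral>\<^sup>+x. ennreal (exp ((1/4) * (\<Sum>a<k. (\<Sum>i<n. x i * f a i)\<^sup>2 / \<sigma>\<^sup>2))) \<partial>gauss_noise n \<sigma>)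
      = (\<integral>\<^sup>+x. (\<integral>\<^sup>+z. ennreal (exp (h x z)) \<partial>gauss_noise k 1) \<partial>gauss_noise n \<sigma>)"
    by (simp only: 1)
  also have "\<dots> = (\<integral>\<^sup>+z. (\<integral>\<^sup>+x. ennreal (exp (h x z)) \<partial>gauss_noise n \<sigma>) \<partial>gauss_noise k 1)"
    by (rule P.Fubini'[symmetric]) measurable
  also have "\<dots> = ennreal ((1 / sqrt (1 - 2 * (1/4))) ^ k)"
    unfolding 2 by (rule nn_integral_gauss_noise_exp_square) auto
  also have "1 / sqrt (1 - 2 * (1/4)) = sqrt 2"
    by (simp add: real_sqrt_divide)
  finally show ?thesis .
qed

text \<open>
  Chernoff's bound.
\<close>

lemma (in prob_space) prob_ge_le_exp_moment:
  assumes [measurable]: "f \<in> borel_measurable M"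
    and "(\<integral>\<^sup>+x. ennreal (exp (f x)) \<partial>M) \<le> ennreal c" and "0 \<le> c"
  shows "prob {x \<in> space M. t \<le> f x} \<le> c * exp (- t)"
proof -
  have "emeasure M {x \<in> space M. 1 \<le> ennreal (exp (- t)) * ennreal (exp (f x))}
     \<le> ennreal (exp (- t)) * (\<integral>\<^sup>+x. ennreal (exp (f x)) * indicator (space M) x \<partial>M)"
    by (rule nn_integral_Markov_inequality) measurable
  also have "(\<integral>\<^sup>+x. ennreal (exp (f x)) * indicator (space M) x \<partial>M) = (\<integral>\<^sup>+x. ennreal (exp (f x)) \<partial>M)"
    by (intro nn_integral_cong) simp
  also have "ennreal (exp (- t)) * \<dots> \<le> ennreal (exp (- t)) * ennreal c"
    using assms by (intro mult_left_mono) auto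
  also have "\<dots> = ennreal (c * exp (- t))"
    using assms by (simp add: ennreal_mult' mult.commute)
  also have "(\<lambda>x. 1 \<le> ennreal (exp (- t)) * ennreal (exp (f x))) = (\<lambda>x. t \<le> f x)"
  proof
    fix x
    have "ennreal (exp (- t)) * ennreal (exp (f x)) = ennreal (exp (f x - t))"
      by (simp flip: ennreal_mult' exp_add)
    moreover have "1 \<le> ennreal (exp (f x - t)) \<longleftrightarrow> 1 \<le> exp (f x - t)"
      by (simp flip: ennreal_1)
    ultimately show "(1 \<le> ennreal (exp (- t)) * ennreal (exp (f x))) = (t \<le> f x)" by simp
  qed
  finally show ?thesis
    using assms(3) by (simp add: emeasure_eq_measure)
qed

lemma exp_half_ln_2: "exp (ln 2 / 2 :: real) = sqrt 2"
proof -
  have "exp (ln 2 / 2 :: real) = exp (ln (sqrt 2))" by (subst ln_sqrt) auto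
  also have "\<dots> = sqrt 2" by (subst exp_ln) auto
  finally show ?thesis .
qed

text \<open>
  Chernoff bound with exponent \<open>- 1 / 2\<close>. The exact rate is \<open>ln 2 / 2 - 1 / 4 > 1 / 24\<close>.
\<close>

lemma gauss_noise_norm_lower_tail:
  assumes "0 < \<sigma>"
  shows "measure (gauss_noise n \<sigma>) {e \<in> space (gauss_noise n \<sigma>). (\<Sum>i<n. (e i)\<^sup>2) \<le> real n * \<sigma>\<^sup>2 / 2}
    \<le> exp (- real n / 24)"
proof -
  interpret prob_space "gauss_noise n \<sigma>" using assms by (rule prob_space_gauss_noise)
  have [measurable]: "(\<lambda>e. \<theta> * (\<Sum>i<n. (e i)\<^sup>2 / \<sigma>\<^sup>2)) \<in> borel_measurable (gauss_noise n \<sigma>)" for \<theta>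
    by measurable
  have "(\<Sum>i<n. (e i)\<^sup>2) \<le> real n * \<sigma>\<^sup>2 / 2 \<longleftrightarrow> - (real n / 4) \<le> (- 1 / 2) * (\<Sum>i<n. (e i)\<^sup>2 / \<sigma>\<^sup>2)" for e
    using assms by (simp add: field_simps flip: sum_divide_distrib)
  then have "prob {e \<in> space (gauss_noise n \<sigma>). (\<Sum>i<n. (e i)\<^sup>2) \<le> real n * \<sigma>\<^sup>2 / 2}
     = prob {e \<in> space (gauss_noise n \<sigma>). - (real n / 4) \<le> (- 1 / 2) * (\<Sum>i<n. (e i)\<^sup>2 / \<sigma>\<^sup>2)}"
    by simp
  also have "\<dots> \<le> (1 / sqrt (1 - 2 * (- 1 / 2))) ^ n * exp (- (- (real n / 4)))"
  proof (rule prob_ge_le_exp_moment)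
    show "(\<integral>\<^sup>+e. ennreal (exp ((- 1 / 2) * (\<Sum>i<n. (e i)\<^sup>2 / \<sigma>\<^sup>2))) \<partial>gauss_noise n \<sigma>)
       \<le> ennreal ((1 / sqrt (1 - 2 * (- 1 / 2))) ^ n)"
      using nn_integral_gauss_noise_exp_square[OF assms, of "- 1 / 2" n] by simp
  qed simp_all
  also have "1 / sqrt (1 - 2 * (- 1 / 2)) = exp (- ln 2 / 2)"
    by (simp add: exp_minus inverse_eq_divide exp_half_ln_2)
  also have "exp (- ln 2 / 2 :: real) ^ n * exp (- (- (real n / 4))) = exp (real n * (1 / 4 - ln 2 / 2))"
    by (simp add: algebra_simps flip: exp_of_nat_mult exp_add)
  also have "\<dots> \<le> exp (real n * (- 1 / 24))"
    using ln2_ge_two_thirds by (intro exp_mono mult_left_mono) auto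
  finally show ?thesis by simp
qed

lemma gauss_noise_norm_upper_tail:
  assumes "0 < \<sigma>"
  shows "measure (gauss_noise n \<sigma>) {e \<in> space (gauss_noise n \<sigma>). 4 * (real n * \<sigma>\<^sup>2) \<le> (\<Sum>i<n. (e i)\<^sup>2)}
    \<le> exp (- real n / 24)"
proof -
  interpret prob_space "gauss_noise n \<sigma>" using assms by (rule prob_space_gauss_noise)
  have [measurable]: "(\<lambda>e. \<theta> * (\<Sum>i<n. (e i)\<^sup>2 / \<sigma>\<^sup>2)) \<in> borel_measurable (gauss_noise n \<sigma>)" for \<theta>
    by measurable
  have "4 * (real n * \<sigma>\<^sup>2) \<le> (\<Sum>i<n. (e i)\<^sup>2) \<longleftrightarrow> real n \<le> (1 / 4) * (\<Sum>i<n. (e i)\<^sup>2 / \<sigma>\<^sup>2)" for e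
    using assms by (simp add: field_simps flip: sum_divide_distrib)
  then have "prob {e \<in> space (gauss_noise n \<sigma>). 4 * (real n * \<sigma>\<^sup>2) \<le> (\<Sum>i<n. (e i)\<^sup>2)}
     = prob {e \<in> space (gauss_noise n \<sigma>). real n \<le> (1 / 4) * (\<Sum>i<n. (e i)\<^sup>2 / \<sigma>\<^sup>2)}"
    by simp
  also have "\<dots> \<le> (1 / sqrt (1 - 2 * (1 / 4))) ^ n * exp (- real n)"
  proof (rule prob_ge_le_exp_moment)
    show "(\<integral>\<^sup>+e. ennreal (exp ((1 / 4) * (\<Sum>i<n. (e i)\<^sup>2 / \<sigma>\<^sup>2))) \<partial>gauss_noise n \<sigma>)
       \<le> ennreal ((1 / sqrt (1 - 2 * (1 / 4))) ^ n)"
      using nn_integral_gauss_noise_exp_square[OF assms, of "1 / 4" n] by simp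
  qed simp_all
  also have "1 / sqrt (1 - 2 * (1 / 4)) = sqrt 2"
    by (simp add: real_sqrt_divide)
  also have "sqrt 2 = exp (ln 2 / 2)"
    by (simp add: exp_half_ln_2)
  also have "exp (ln 2 / 2 :: real) ^ n * exp (- real n) = exp (real n * (ln 2 / 2 - 1))"
    by (simp add: algebra_simps flip: exp_of_nat_mult exp_add)
  also have "\<dots> \<le> exp (real n * (- 1 / 24))"
    using ln2_le_25_over_36 by (intro exp_mono mult_left_mono) auto
  finally show ?thesis by simp
qed

section \<open>Decomposing a vector by greedy selection of columns\<close>

definition ip :: "nat \<Rightarrow> (nat \<Rightarrow> real) \<Rightarrow> (nat \<Rightarrow> real) \<Rightarrow> real" where
  "ip n u v = (\<Sum>i<n. u i * v i)"

definition lincomb :: "nat \<Rightarrow> (nat \<Rightarrow> nat \<Rightarrow> real) \<Rightarrow> (nat \<Rightarrow> real) \<Rightarrow> nat \<Rightarrow> real" where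
  "lincomb p X u = (\<lambda>i. \<Sum>j<p. X i j * u j)"

text \<open>
  The decrease of the squared residual \<open>|e|\<^sup>2\<close> when \<open>X u\<close> is subtracted from \<open>e\<close>.
\<close>

definition gain :: "nat \<Rightarrow> nat \<Rightarrow> (nat \<Rightarrow> nat \<Rightarrow> real) \<Rightarrow> (nat \<Rightarrow> real) \<Rightarrow> (nat \<Rightarrow> real) \<Rightarrow> real" where
  "gain n p X e u = 2 * ip n e (lincomb p X u) - ip n (lincomb p X u) (lincomb p X u)"

lemma ip_commute: "ip n u v = ip n v u"
  by (simp add: ip_def mult.commute)

lemma ip_diff_left: "ip n (\<lambda>i. u i - v i) w = ip n u w - ip n v w"
  by (simp add: ip_def algebra_simps sum_subtractf)

lemma ip_scale_right: "ip n u (\<lambda>i. c * v i) = c * ip n u v"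
  by (simp add: ip_def sum_distrib_left mult_ac)

lemma ip_self_nonneg: "0 \<le> ip n u u"
  by (simp add: ip_def sum_nonneg)

lemma ip_sum_right: "ip n u (\<lambda>i. \<Sum>a\<in>A. v a i) = (\<Sum>a\<in>A. ip n u (v a))"
proof -
  have "ip n u (\<lambda>i. \<Sum>a\<in>A. v a i) = (\<Sum>i<n. \<Sum>a\<in>A. u i * v a i)"
    by (simp add: ip_def sum_distrib_left)
  also have "\<dots> = (\<Sum>a\<in>A. \<Sum>i<n. u i * v a i)" by (rule sum.swap)
  finally show ?thesis by (simp add: ip_def)
qed

lemma Cauchy_Schwarz_ip: "ip n u v \<le> sqrt (ip n u u) * sqrt (ip n v v)"
proof -
  have "(ip n u v)\<^sup>2 \<le> ip n u u * ip n v v"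
    unfolding ip_def using Cauchy_Schwarz_ineq_sum[of u v "{..<n}"] by (simp add: power2_eq_square)
  then show ?thesis
    by (simp add: real_le_rsqrt flip: real_sqrt_mult)
qed

text \<open>
  Gram--Schmidt. Only \<open>k \<le> card T\<close> is asserted, since the vectors may be linearly dependent.
\<close>

lemma finite_span_orthonormal:
  assumes "finite T"
  shows "\<exists>k f. k \<le> card T \<and> (\<forall>a<k. \<forall>b<k. ip n (f a) (f b) = (if a = b then 1 else 0)) \<and>
    (\<forall>j\<in>T. \<exists>c. \<forall>i<n. x j i = (\<Sum>a<k. c a * f a i))"
  using assms
proof (induction T)
  case empty
  show ?case by (rule exI[of _ 0]) simp
next
  case (insert j T)
  then obtain k f where k: "k \<le> card T"
    and orth: "\<And>a b. a < k \<Longrightarrow> b < k \<Longrightarrow> ip n (f a) (f b) = (if a = b then 1 else 0)"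
    and span: "\<And>j. j \<in> T \<Longrightarrow> \<exists>c. \<forall>i<n. x j i = (\<Sum>a<k. c a * f a i)"
    by blast
  define z where "z i = x j i - (\<Sum>a<k. ip n (x j) (f a) * f a i)" for i
  have z_orth: "ip n z (f b) = 0" if "b < k" for b
  proof -
    have "ip n z (f b) = ip n (x j) (f b) - ip n (f b) (\<lambda>i. \<Sum>a<k. ip n (x j) (f a) * f a i)"
      unfolding z_def ip_diff_left by (simp add: ip_commute)
    also have "ip n (f b) (\<lambda>i. \<Sum>a<k. ip n (x j) (f a) * f a i) = (\<Sum>a<k. if b = a then ip n (x j) (f a) else 0)"
      unfolding ip_sum_right ip_scale_right using that by (intro sum.cong) (auto simp: orth)
    finally show ?thesis using that by simp
  qed
  show ?case
  proof (cases "ip n z z = 0")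
    case True
    then have "\<forall>i<n. z i = 0"
      unfolding ip_def by (subst (asm) sum_nonneg_eq_0_iff) auto
    then have "\<forall>i<n. x j i = (\<Sum>a<k. ip n (x j) (f a) * f a i)"
      by (simp add: z_def)
    then show ?thesis
      using k orth span insert.hyps by (intro exI[of _ k] exI[of _ f]) auto
  next
    case False
    define r where "r = sqrt (ip n z z)"
    have r: "r > 0" "r * r = ip n z z"
      using False ip_self_nonneg[of n z] by (auto simp: r_def)
    define g where "g = f(k := (\<lambda>i. 1 / r * z i))"
    have gf: "g a = f a" if "a < k" for a using that by (simp add: g_def)
    have gk: "g k = (\<lambda>i. 1 / r * z i)" by (simp add: g_def)
    have "ip n (g a) (g b) = (if a = b then 1 else 0)" if ab: "a < Suc k" "b < Suc k" for a b
    proof -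
      have kk: "ip n (g k) (g k) = 1"
      proof -
        have "ip n (g k) (g k) = 1 / r * (1 / r * ip n z z)"
          by (simp add: gk ip_def sum_distrib_left mult_ac)
        then show ?thesis using r(1) by (simp flip: r(2))
      qed
      have bk: "ip n (g b) (g k) = 0" "ip n (g k) (g b) = 0" if "b < k" for b
      proof -
        have "ip n (f b) (g k) = 0"
          using z_orth[OF that] unfolding gk ip_scale_right by (simp add: ip_commute)
        then show "ip n (g b) (g k) = 0" "ip n (g k) (g b) = 0"
          using gf[OF that] by (auto simp: ip_commute)
      qed
      show ?thesis
        using ab kk bk orth[of a b] by (auto simp: less_Suc_eq gf)
    qed
    moreover have "\<exists>c. \<forall>i<n. x l i = (\<Sum>a<Suc k. c a * g a i)" if "l \<in> insert j T" for l
    proof (cases "l = j")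
      case True
      have "x j i = (\<Sum>a<Suc k. (if a = k then r else ip n (x j) (f a)) * g a i)" for i
        using r by (simp add: gf gk z_def)
      then show ?thesis
        unfolding True by (intro exI[of _ "\<lambda>a. if a = k then r else ip n (x j) (f a)"]) blast
    next
      case False
      then obtain c where "\<forall>i<n. x l i = (\<Sum>a<k. c a * f a i)"
        using span \<open>l \<in> insert j T\<close> by blast
      then have "\<forall>i<n. x l i = (\<Sum>a<Suc k. (if a = k then 0 else c a) * g a i)"
        by (simp add: gf)
      then show ?thesis by (intro exI[of _ "\<lambda>a. if a = k then 0 else c a"])
    qed
    ultimately show ?thesis
      using k insert.hyps by (intro exI[of _ "Suc k"] exI[of _ g]) auto
  qed
qed

lemma lincomb_add: "lincomb p X (\<lambda>j. u j + v j) = (\<lambda>i. lincomb p X u i + lincomb p X v i)"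
  by (simp add: lincomb_def fun_eq_iff algebra_simps sum.distrib)

lemma lincomb_scale: "lincomb p X (\<lambda>j. c * u j) = (\<lambda>i. c * lincomb p X u i)"
  by (simp add: lincomb_def fun_eq_iff sum_distrib_left mult_ac)

lemma lincomb_single: "j < p \<Longrightarrow> lincomb p X (\<lambda>l. if l = j then 1 else 0) = (\<lambda>i. X i j)"
  by (simp add: lincomb_def fun_eq_iff if_distrib[of "\<lambda>x. _ * x"] cong: if_cong)

lemma gain_scale: "gain n p X e (\<lambda>j. c * u j)
   = 2 * c * ip n e (lincomb p X u) - c\<^sup>2 * ip n (lincomb p X u) (lincomb p X u)"
  unfolding gain_def lincomb_scale ip_scale_right
  by (subst (2) ip_commute) (simp add: ip_scale_right power2_eq_square)

lemma gain_add_single: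
  assumes "j < p"
  shows "gain n p X e (\<lambda>l. u l + c * (if l = j then 1 else 0))
    = gain n p X e u + 2 * c * ip n (\<lambda>i. e i - lincomb p X u i) (\<lambda>i. X i j) - c\<^sup>2 * ip n (\<lambda>i. X i j) (\<lambda>i. X i j)"
proof -
  have eq: "lincomb p X (\<lambda>l. u l + c * (if l = j then 1 else 0)) = (\<lambda>i. lincomb p X u i + c * X i j)"
    unfolding lincomb_add lincomb_scale lincomb_single[OF assms] ..
  show ?thesis
    unfolding gain_def eq
    by (simp add: ip_def algebra_simps power2_eq_square sum.distrib sum_subtractf sum_distrib_left)
qed

lemma l0_norm_scale_le: "l0_norm p (\<lambda>j. c * u j) \<le> l0_norm p u"
  unfolding l0_norm_def by (intro card_mono) auto

lemma l0_norm_add_single: "l0_norm p (\<lambda>l. u l + c * (if l = j then 1 else 0)) \<le> l0_norm p u + 1"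
proof -
  have "{l \<in> {..<p}. u l + c * (if l = j then 1 else 0) \<noteq> 0} \<subseteq> insert j {l \<in> {..<p}. u l \<noteq> 0}"
    by auto
  then have "l0_norm p (\<lambda>l. u l + c * (if l = j then 1 else 0)) \<le> card (insert j {l \<in> {..<p}. u l \<noteq> 0})"
    unfolding l0_norm_def by (intro card_mono) auto
  also have "\<dots> \<le> l0_norm p u + 1"
    unfolding l0_norm_def by (simp add: card_insert_if)
  finally show ?thesis .
qed

text \<open>
  If no \<open>s\<close>-sparse vector explains as much as \<open>s \<theta>\<close> of the squared length of \<open>e\<close>, then \<open>e\<close> is the
  sum of a short vector \<open>X u\<close> and of a residual that is almost orthogonal to every column. This
  is a greedy selection of columns: as long as some column has a correlation larger than
  \<open>sqrt (n \<theta>)\<close> with the residual, adding it to the support gains \<open>\<theta>\<close>, and the assumption stops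
  this before \<open>s\<close> columns are used. The assumption concerns sparse vectors only, so that a union
  bound over supports can ensure it with a failure probability exponentially small in \<open>s\<close>.
\<close>

lemma sparse_gain_bound_decomposition:
  assumes "0 < n" and "0 < s" and "0 < \<theta>"
    and cols: "\<And>j. j < p \<Longrightarrow> ip n (\<lambda>i. X i j) (\<lambda>i. X i j) \<le> real n"
    and bound: "\<And>u. l0_norm p u \<le> s \<Longrightarrow> gain n p X e u < real s * \<theta>"
  obtains u where "ip n (lincomb p X u) (lincomb p X u) \<le> 4 * real s * \<theta>"
    and "\<And>j. j < p \<Longrightarrow> \<bar>ip n (\<lambda>i. e i - lincomb p X u i) (\<lambda>i. X i j)\<bar> \<le> sqrt (real n * \<theta>)"
proof -
  \<comment> \<open>The greedy selection reaches \<open>k\<close> columns when some \<open>k\<close>-sparse vector gains \<open>k \<theta>\<close>; take the last such \<open>k\<close>.\<close>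
  define P where "P k \<longleftrightarrow> (\<exists>u. l0_norm p u \<le> k \<and> real k * \<theta> \<le> gain n p X e u)" for k
  have "P 0"
    unfolding P_def by (intro exI[of _ "\<lambda>_. 0"]) (simp add: l0_norm_def gain_def lincomb_def ip_def)
  moreover have "\<not> P s"
    unfolding P_def using bound by (meson not_le)
  ultimately obtain k where k: "k < s" "P k" "\<not> P (Suc k)"
    using inc_induct[of 0 s "\<lambda>k. \<not> P k"] by blast
  then obtain u where u: "l0_norm p u \<le> k" "real k * \<theta> \<le> gain n p X e u"
    by (auto simp: P_def)
  have "0 \<le> real k * \<theta>" using assms by simp
  then have gu: "0 \<le> gain n p X e u" using u(2) by linarith
  show ?thesis
  proof (rule that)
    \<comment> \<open>The vector \<open>u / 2\<close> is also sparse; comparing the gains of \<open>u\<close> and \<open>u / 2\<close> bounds the length of \<open>X u\<close>.\<close>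
    have "l0_norm p (\<lambda>j. (1 / 2) * u j) \<le> s"
      using l0_norm_scale_le[of p "1/2" u] u(1) k(1) by linarith
    then have "gain n p X e (\<lambda>j. (1 / 2) * u j) < real s * \<theta>" by (rule bound)
    then show "ip n (lincomb p X u) (lincomb p X u) \<le> 4 * real s * \<theta>"
      using gu unfolding gain_scale by (simp add: gain_def power2_eq_square)
  next
    fix j assume j: "j < p"
    define w where "w = ip n (\<lambda>i. e i - lincomb p X u i) (\<lambda>i. X i j)"
    \<comment> \<open>The best multiple of column \<open>j\<close> to add, computed as if the column had the maximal length.\<close>
    define c where "c = w / real n"
    define u' where "u' = (\<lambda>l. u l + c * (if l = j then 1 else 0))"
    have "l0_norm p u' \<le> Suc k"
      using l0_norm_add_single[of p u c j] u(1) by (simp add: u'_def)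
    then have "gain n p X e u' < real (Suc k) * \<theta>"
      using k(3) unfolding P_def by (meson not_le)
    also have "\<dots> \<le> gain n p X e u + \<theta>" using u(2) by (simp add: algebra_simps)
    finally have "2 * c * w - c\<^sup>2 * ip n (\<lambda>i. X i j) (\<lambda>i. X i j) < \<theta>"
      unfolding u'_def gain_add_single[OF j] w_def by linarith
    moreover have "c\<^sup>2 * ip n (\<lambda>i. X i j) (\<lambda>i. X i j) \<le> c\<^sup>2 * real n"
      using cols[OF j] by (intro mult_left_mono) auto
    ultimately have "2 * c * w - c\<^sup>2 * real n \<le> \<theta>" by linarith
    moreover have "2 * c * w - c\<^sup>2 * real n = w\<^sup>2 / real n"
      using \<open>0 < n\<close> by (simp add: c_def power2_eq_square field_simps)
    ultimately have "w\<^sup>2 / real n \<le> \<theta>" by simp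
    then have "w\<^sup>2 \<le> real n * \<theta>"
      using \<open>0 < n\<close> by (simp add: pos_divide_le_eq mult.commute)
    then show "\<bar>w\<bar> \<le> sqrt (real n * \<theta>)" by (simp add: real_le_rsqrt)
  qed
qed

text \<open>
  The two parts of the decomposition are paired with \<open>X d\<close> by the two natural dualities: the
  residual through the columns and \<open>\<ell>\<^sub>1\<close>, the short part by Cauchy--Schwarz.
\<close>

lemma ip_lincomb_bound:
  assumes "ip n (lincomb p X u) (lincomb p X u) \<le> 4 * real s * \<theta>" and "0 \<le> \<theta>"
    and "\<And>j. j < p \<Longrightarrow> \<bar>ip n (\<lambda>i. e i - lincomb p X u i) (\<lambda>i. X i j)\<bar> \<le> sqrt (real n * \<theta>)"
  shows "ip n e (lincomb p X d) \<le> sqrt (real n * \<theta>) * (\<Sum>j<p. \<bar>d j\<bar>)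
    + 2 * sqrt (real s * \<theta>) * sqrt (ip n (lincomb p X d) (lincomb p X d))"
proof -
  define r where "r i = e i - lincomb p X u i" for i
  have "ip n r (lincomb p X d) = ip n r (\<lambda>i. \<Sum>j<p. d j * X i j)"
    by (simp add: lincomb_def mult.commute)
  also have "\<dots> = (\<Sum>j<p. d j * ip n r (\<lambda>i. X i j))"
    by (subst ip_sum_right) (simp add: ip_scale_right)
  also have "\<dots> \<le> (\<Sum>j<p. sqrt (real n * \<theta>) * \<bar>d j\<bar>)"
  proof (rule sum_mono)
    fix j assume "j \<in> {..<p}"
    then have "\<bar>ip n r (\<lambda>i. X i j)\<bar> \<le> sqrt (real n * \<theta>)" using assms(3)[of j] by (simp add: r_def[abs_def])
    then have "\<bar>d j * ip n r (\<lambda>i. X i j)\<bar> \<le> sqrt (real n * \<theta>) * \<bar>d j\<bar>"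
      unfolding abs_mult by (subst mult.commute) (intro mult_right_mono, auto)
    then show "d j * ip n r (\<lambda>i. X i j) \<le> sqrt (real n * \<theta>) * \<bar>d j\<bar>" by linarith
  qed
  finally have 1: "ip n r (lincomb p X d) \<le> sqrt (real n * \<theta>) * (\<Sum>j<p. \<bar>d j\<bar>)"
    by (simp add: sum_distrib_left)
  have "sqrt (ip n (lincomb p X u) (lincomb p X u)) \<le> sqrt (4 * (real s * \<theta>))"
    using assms(1) by (simp add: mult.assoc)
  also have "\<dots> = 2 * sqrt (real s * \<theta>)" by (simp add: real_sqrt_mult)
  finally have "ip n (lincomb p X u) (lincomb p X d)
      \<le> 2 * sqrt (real s * \<theta>) * sqrt (ip n (lincomb p X d) (lincomb p X d))"
    by (intro order_trans[OF Cauchy_Schwarz_ip] mult_right_mono) (auto simp: ip_self_nonneg)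
  moreover have "ip n e (lincomb p X d) = ip n r (lincomb p X d) + ip n (lincomb p X u) (lincomb p X d)"
    unfolding r_def ip_diff_left by simp
  ultimately show ?thesis using 1 by linarith
qed

section \<open>The noise event\<close>

lemma two_linear_minus_square_le: "2 * (d * y) - d\<^sup>2 \<le> y\<^sup>2" for d y :: real
  using zero_le_power2[of "y - d"] by (simp add: power2_diff mult_ac)

text \<open>
  For a fixed support \<open>T\<close> of size \<open>s\<close> the largest gain is at most the squared length of the
  projection of the noise onto the span of the columns in \<open>T\<close>, a chi-square variable with at most
  \<open>s\<close> degrees of freedom; the binomial factor is the union bound over supports. The event is
  built from the finitely many projections, so that its measurability is evident.
\<close>

lemma gauss_noise_sparse_gain:
  assumes "0 < \<sigma>" and "s \<le> p"
  obtains A where "A \<in> sets (gauss_noise n \<sigma>)"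
    and "measure (gauss_noise n \<sigma>) A \<ge> 1 - real (p choose s) * (sqrt 2 ^ s * exp (- (real s * \<theta> / (4 * \<sigma>\<^sup>2))))"
    and "\<And>e u. e \<in> A \<Longrightarrow> l0_norm p u \<le> s \<Longrightarrow> gain n p X e u < real s * \<theta>"
proof -
  interpret prob_space "gauss_noise n \<sigma>" using assms(1) by (rule prob_space_gauss_noise)
  define TT where "TT = {T. T \<subseteq> {..<p} \<and> card T = s}"
  have TT: "finite TT" "card TT = p choose s"
    unfolding TT_def using n_subsets[of "{..<p}" s] by auto
  define R where "R T k f \<longleftrightarrow> k \<le> card T \<and> (\<forall>a<k. \<forall>b<k. ip n (f a) (f b) = (if a = b then 1 else 0)) \<and>
    (\<forall>j\<in>T. \<exists>c. \<forall>i<n. X i j = (\<Sum>a<k. c a * f a i))" for T k and f :: "nat \<Rightarrow> nat \<Rightarrow> real"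
  have "\<exists>k f. R T k f" if "T \<in> TT" for T
  proof -
    have "finite T" using that by (auto simp: TT_def intro: finite_subset)
    from finite_span_orthonormal[OF this, of n "\<lambda>j i. X i j"] show ?thesis
      unfolding R_def .
  qed
  then obtain k f where R: "\<And>T. T \<in> TT \<Longrightarrow> R T (k T) (f T)"
    by metis
  have kf: "k T \<le> s" "\<And>a b. a < k T \<Longrightarrow> b < k T \<Longrightarrow> ip n (f T a) (f T b) = (if a = b then 1 else 0)"
    "\<forall>j\<in>T. \<exists>c. \<forall>i<n. X i j = (\<Sum>a<k T. c a * f T a i)" if "T \<in> TT" for T
    using R[OF that] that by (auto simp: R_def TT_def)
  define Q where "Q T e = (1/4) * (\<Sum>a<k T. (\<Sum>i<n. e i * f T a i)\<^sup>2 / \<sigma>\<^sup>2)" for T e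
  define t where "t = real s * \<theta> / (4 * \<sigma>\<^sup>2)"
  have Qm [measurable]: "Q T \<in> borel_measurable (gauss_noise n \<sigma>)" for T
    unfolding Q_def by measurable
  define bad where "bad T = {e \<in> space (gauss_noise n \<sigma>). t \<le> Q T e}" for T
  have bad_sets [measurable]: "bad T \<in> events" for T
    unfolding bad_def by measurable
  have bad_prob: "prob (bad T) \<le> sqrt 2 ^ s * exp (- t)" if T: "T \<in> TT" for T
  proof -
    have "prob (bad T) \<le> sqrt 2 ^ k T * exp (- t)"
      unfolding bad_def
    proof (rule prob_ge_le_exp_moment)
      show "(\<integral>\<^sup>+ x. ennreal (exp (Q T x)) \<partial>gauss_noise n \<sigma>) \<le> ennreal (sqrt 2 ^ k T)"
        unfolding Q_def using kf(2)[OF T]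
        by (subst nn_integral_gauss_noise_exp_orthonormal[OF assms(1)]) (auto simp: ip_def)
    qed auto
    also have "\<dots> \<le> sqrt 2 ^ s * exp (- t)"
      using kf(1)[OF T] by (intro mult_right_mono power_increasing) auto
    finally show ?thesis .
  qed
  define A where "A = space (gauss_noise n \<sigma>) - (\<Union>T\<in>TT. bad T)"
  show ?thesis
  proof (rule that[of A])
    show "A \<in> events" unfolding A_def using TT(1) bad_sets by (intro sets.Diff sets.finite_UN) blast+
    have "prob (\<Union>T\<in>TT. bad T) \<le> (\<Sum>T\<in>TT. prob (bad T))"
      using TT(1) bad_sets by (intro finite_measure_subadditive_finite) blast+
    also have "\<dots> \<le> (\<Sum>T\<in>TT. sqrt 2 ^ s * exp (- t))"
      by (rule sum_mono) (rule bad_prob)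
    also have "\<dots> = real (p choose s) * (sqrt 2 ^ s * exp (- t))" using TT(2) by simp
    finally have "prob (\<Union>T\<in>TT. bad T) \<le> real (p choose s) * (sqrt 2 ^ s * exp (- t))" .
    moreover have "prob A = 1 - prob (\<Union>T\<in>TT. bad T)"
      unfolding A_def using TT(1) bad_sets by (intro prob_compl sets.finite_UN) blast+
    ultimately show "1 - real (p choose s) * (sqrt 2 ^ s * exp (- (real s * \<theta> / (4 * \<sigma>\<^sup>2)))) \<le> prob A"
      by (simp add: t_def)
  next
    fix e u assume e: "e \<in> A" and u: "l0_norm p u \<le> s"
    \<comment> \<open>A vector with smaller support is supported on some \<open>T\<close> of size exactly \<open>s\<close>.\<close>
    define S where "S = {j \<in> {..<p}. u j \<noteq> 0}"
    have "S \<subseteq> {..<p}" "card S \<le> s" using u by (auto simp: S_def l0_norm_def)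
    then obtain T where T: "S \<subseteq> T" "T \<subseteq> {..<p}" "card T = s"
      using exists_subset_between[of S s "{..<p}"] assms(2) by auto
    then have TT': "T \<in> TT" by (simp add: TT_def)
    from bchoice[OF kf(3)[OF this]] obtain c where c: "\<And>j i. j \<in> T \<Longrightarrow> i < n \<Longrightarrow> X i j = (\<Sum>a<k T. c j a * f T a i)"
      by blast
    define d where "d a = (\<Sum>j\<in>T. c j a * u j)" for a
    define v where "v i = (\<Sum>a<k T. d a * f T a i)" for i
    have lc: "lincomb p X u i = v i" if "i < n" for i
    proof -
      have "lincomb p X u i = (\<Sum>j\<in>T. X i j * u j)"
        unfolding lincomb_def using T by (intro sum.mono_neutral_right) (auto simp: S_def)
      also have "\<dots> = (\<Sum>j\<in>T. \<Sum>a<k T. c j a * f T a i * u j)"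
        using that by (simp add: c sum_distrib_right)
      also have "\<dots> = (\<Sum>a<k T. \<Sum>j\<in>T. c j a * f T a i * u j)" by (rule sum.swap)
      finally show ?thesis unfolding v_def d_def sum_distrib_right by (simp add: mult_ac)
    qed
    have "ip n e v = (\<Sum>a<k T. d a * ip n e (f T a))"
      unfolding v_def ip_sum_right ip_scale_right ..
    moreover have "ip n v v = (\<Sum>a<k T. (d a)\<^sup>2)"
    proof -
      have "ip n v (f T b) = d b" if "b < k T" for b
      proof -
        have "ip n (f T b) v = (\<Sum>a<k T. if b = a then d a else 0)"
          unfolding v_def ip_sum_right ip_scale_right using that kf(2)[OF TT']
          by (intro sum.cong) auto
        then show ?thesis using that by (simp add: ip_commute)
      qed
      then have "(\<Sum>a<k T. d a * ip n v (f T a)) = (\<Sum>a<k T. (d a)\<^sup>2)"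
        by (simp add: power2_eq_square)
      moreover have "ip n v v = (\<Sum>a<k T. d a * ip n v (f T a))"
      proof -
        have "v = (\<lambda>i. \<Sum>a<k T. d a * f T a i)" by (rule ext) (rule v_def)
        then have "ip n v v = ip n v (\<lambda>i. \<Sum>a<k T. d a * f T a i)" by simp
        then show ?thesis by (simp only: ip_sum_right ip_scale_right)
      qed
      ultimately show ?thesis by simp
    qed
    moreover have "gain n p X e u = 2 * ip n e v - ip n v v"
      unfolding gain_def using lc by (simp add: ip_def)
    ultimately have "gain n p X e u = (\<Sum>a<k T. 2 * (d a * ip n e (f T a)) - (d a)\<^sup>2)"
      by (simp add: sum_subtractf sum_distrib_left)
    also have "\<dots> \<le> (\<Sum>a<k T. (ip n e (f T a))\<^sup>2)"
      by (intro sum_mono two_linear_minus_square_le)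
    also have "\<dots> = 4 * \<sigma>\<^sup>2 * Q T e"
      using assms(1) by (simp add: Q_def ip_def flip: sum_divide_distrib)
    also have "\<dots> < 4 * \<sigma>\<^sup>2 * t"
      using e TT' assms(1) by (intro mult_strict_left_mono) (auto simp: A_def bad_def)
    also have "\<dots> = real s * \<theta>" using assms(1) by (simp add: t_def)
    finally show "gain n p X e u < real s * \<theta>" .
  qed
qed

text \<open>
  One term of the binomial expansion of \<open>(1 + s / p)\<^sup>p \<le> exp s\<close>.
\<close>

lemma binomial_le_exp_power:
  assumes "0 < s" "s \<le> p"
  shows "real (p choose s) \<le> (exp 1 * real p / real s) ^ s"
proof -
  have "real (p choose s) * (real s / real p) ^ s \<le> (\<Sum>k\<le>p. real (p choose k) * (real s / real p) ^ k)"
    by (rule member_le_sum) (use assms in auto)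
  also have "\<dots> = (real s / real p + 1) ^ p"
    by (subst binomial_ring) simp
  also have "\<dots> \<le> exp (real s / real p) ^ p"
    by (intro power_mono) (auto simp: add.commute)
  also have "\<dots> = exp 1 ^ s"
    using assms by (simp flip: exp_of_nat_mult)
  finally have "real (p choose s) * (real s / real p) ^ s \<le> exp 1 ^ s" .
  then show ?thesis
    using assms by (simp add: power_divide power_mult_distrib field_simps)
qed

text \<open>
  With \<open>\<theta> = 16 \<sigma>\<^sup>2 log (2 p / s)\<close> the chi-square tail \<open>2 powr (s / 2) exp (- 4 s log (2 p / s))\<close> absorbs the number
  of supports, at most \<open>exp (s log (2 p / s) + s)\<close>, and leaves an exponent of at least
  \<open>2 s log (2 p / s)\<close>.
\<close>

lemma gauss_noise_sparse_gain_log: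
  assumes "0 < \<sigma>" and "0 < s" and "real s \<le> 2 * real p / exp 1" and "s \<le> p"
  obtains A where "A \<in> sets (gauss_noise n \<sigma>)"
    and "measure (gauss_noise n \<sigma>) A \<ge> 1 - exp (- (2 * (real s * ln (2 * real p / real s))))"
    and "\<And>e u. e \<in> A \<Longrightarrow> l0_norm p u \<le> s \<Longrightarrow>
      gain n p X e u < real s * (16 * \<sigma>\<^sup>2 * ln (2 * real p / real s))"
proof -
  define l where "l = ln (2 * real p / real s)"
  have p: "0 < real p" "0 < real s" using assms by auto
  have "exp 1 \<le> 2 * real p / real s"
    using assms p by (simp add: field_simps)
  then have l1: "1 \<le> l" unfolding l_def using p by (subst ln_ge_iff) auto
  have el: "exp l = 2 * real p / real s" using p by (simp add: l_def)
  have s2: "exp (ln 2 / 2) = sqrt 2" by (rule exp_half_ln_2)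
  have "exp (1 - ln 2 + l) = exp 1 * real p / real s"
    unfolding exp_add exp_diff el using p by simp
  then have "real (p choose s) \<le> exp (1 - ln 2 + l) ^ s"
    using binomial_le_exp_power[OF assms(2,4)] by simp
  then have "real (p choose s) * (sqrt 2 ^ s * exp (- (real s * (16 * \<sigma>\<^sup>2 * l) / (4 * \<sigma>\<^sup>2))))
     \<le> exp (1 - ln 2 + l) ^ s * (exp (ln 2 / 2) ^ s * exp (- (real s * (16 * \<sigma>\<^sup>2 * l) / (4 * \<sigma>\<^sup>2))))"
    unfolding s2 by (intro mult_right_mono) auto
  also have "\<dots> = exp (real s * (1 - ln 2 / 2 - 3 * l))"
    using assms(1) by (simp add: algebra_simps flip: exp_of_nat_mult exp_add)
  also have "\<dots> \<le> exp (real s * (- 2 * l))"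
    using l1 ln2_ge_two_thirds by (intro exp_mono mult_left_mono) auto
  finally have le: "real (p choose s) * (sqrt 2 ^ s * exp (- (real s * (16 * \<sigma>\<^sup>2 * l) / (4 * \<sigma>\<^sup>2))))
     \<le> exp (- (2 * (real s * l)))" by (simp add: mult_ac)
  obtain A where A: "A \<in> sets (gauss_noise n \<sigma>)"
    "measure (gauss_noise n \<sigma>) A \<ge> 1 - real (p choose s) * (sqrt 2 ^ s * exp (- (real s * (16 * \<sigma>\<^sup>2 * l) / (4 * \<sigma>\<^sup>2))))"
    "\<And>e u. e \<in> A \<Longrightarrow> l0_norm p u \<le> s \<Longrightarrow> gain n p X e u < real s * (16 * \<sigma>\<^sup>2 * l)"
    using gauss_noise_sparse_gain[OF assms(1,4), where n = n and X = X and \<theta> = "16 * \<sigma>\<^sup>2 * l"] by blast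
  show ?thesis
    by (rule that[of A]) (use A le in \<open>auto simp: l_def\<close>)
qed

text \<open>
  The function \<open>x log (c / x)\<close> increases up to \<open>x = c / e\<close>.
\<close>

lemma mult_ln_mono:
  fixes x y c :: real
  assumes "0 < x" "x \<le> y" "y * exp 1 \<le> c"
  shows "x * ln (c / x) \<le> y * ln (c / y)"
proof -
  have y: "0 < y" using assms by simp
  have c: "0 < c" using y assms(3) by (meson less_le_trans mult_pos_pos exp_gt_zero)
  have "ln (c / x) = ln (c / y) + ln (y / x)"
    using assms y c by (simp add: ln_div)
  also have "ln (y / x) \<le> y / x - 1"
    using assms y by (intro ln_le_minus_one) simp
  finally have "x * ln (c / x) \<le> x * (ln (c / y) + (y / x - 1))"
    using assms by (intro mult_left_mono) auto
  also have "\<dots> = x * ln (c / y) + (y - x) * 1"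
    using assms by (simp add: field_simps)
  also have "\<dots> \<le> x * ln (c / y) + (y - x) * ln (c / y)"
  proof -
    have "1 \<le> ln (c / y)"
      using y c assms(3) by (subst ln_ge_iff) (auto simp: field_simps)
    then show ?thesis using assms by (intro add_left_mono mult_left_mono) auto
  qed
  finally show ?thesis by (simp add: algebra_simps)
qed

text \<open>
  By monotonicity of \<open>x log (2 p / x)\<close> the failure probability at every sparsity \<open>s0 \<ge> s\<close> is at most
  the one allowed at \<open>s\<close>.
\<close>

lemma exp_neg_mult_ln_le:
  assumes "0 < s" "s \<le> s0" "real s0 * exp 1 \<le> 2 * real p"
  shows "exp (- (2 * (real s0 * ln (2 * real p / real s0)))) \<le> (2 * real s / real p) ^ (2 * s)"
proof -
  have pos: "0 < real s" "0 < real s0" using assms by auto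
  have p: "0 < real p" using assms pos by (cases p) (auto simp: mult_le_0_iff)
  have "real s * ln (2 * real p / real s) \<le> real s0 * ln (2 * real p / real s0)"
    using assms pos by (intro mult_ln_mono) auto
  then have "exp (- (2 * (real s0 * ln (2 * real p / real s0)))) \<le> exp (real (2 * s) * (- ln (2 * real p / real s)))"
    by simp
  also have "\<dots> = exp (- ln (2 * real p / real s)) ^ (2 * s)" by (rule exp_of_nat_mult)
  also have "exp (- ln (2 * real p / real s)) = real s / (2 * real p)"
    using pos p by (simp add: exp_minus)
  also have "(real s / (2 * real p)) ^ (2 * s) \<le> (2 * real s / real p) ^ (2 * s)"
    using pos p by (intro power_mono) (auto simp: field_simps)
  finally show ?thesis .
qed

lemma (in prob_space) prob_Int_ge:
  assumes "A \<in> events" "B \<in> events" "1 - a \<le> prob A" "1 - b \<le> prob B"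
  shows "1 - (a + b) \<le> prob (A \<inter> B)"
proof -
  have "prob (A \<union> B) + prob (A \<inter> B) = prob A + prob B"
    using measure_Un3[of A M B] assms by (simp add: fmeasurable_eq_sets)
  moreover have "prob (A \<union> B) \<le> 1" by simp
  ultimately show ?thesis using assms by linarith
qed

lemma (in prob_space) prob_INT_ge:
  assumes "finite I" "\<And>i. i \<in> I \<Longrightarrow> A i \<in> events" "\<And>i. i \<in> I \<Longrightarrow> 1 - a \<le> prob (A i)"
  shows "1 - real (card I) * a \<le> prob (space M \<inter> (\<Inter>i\<in>I. A i))"
proof -
  have "prob (\<Union>i\<in>I. space M - A i) \<le> (\<Sum>i\<in>I. prob (space M - A i))"
    using assms by (intro finite_measure_subadditive_finite) auto
  also have "\<dots> \<le> (\<Sum>i\<in>I. a)"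
  proof (rule sum_mono)
    fix i assume "i \<in> I"
    then show "prob (space M - A i) \<le> a" using assms(2,3)[of i] by (simp add: prob_compl)
  qed
  finally have "prob (\<Union>i\<in>I. space M - A i) \<le> real (card I) * a" by simp
  moreover have "space M \<inter> (\<Inter>i\<in>I. A i) = space M - (\<Union>i\<in>I. space M - A i)" by auto
  moreover have "prob (space M - (\<Union>i\<in>I. space M - A i)) = 1 - prob (\<Union>i\<in>I. space M - A i)"
    by (intro prob_compl sets.finite_UN assms(1) sets.compl_sets assms(2))
  ultimately show ?thesis by simp
qed

text \<open>
  The only probabilistic input about the noise: its empirical norm lies between \<open>\<sigma> / \<surd>2\<close> and
  \<open>2 \<sigma>\<close>, and its correlation with \<open>X d\<close> is controlled simultaneously for all \<open>d\<close>, at each of the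
  sparsity levels in \<open>I\<close>.
\<close>

lemma gauss_noise_good_event:
  assumes n: "0 < n" and \<sigma>: "0 < \<sigma>" and s: "0 < s" and I: "finite I" "\<And>t. t \<in> I \<Longrightarrow> s \<le> t"
    "\<And>t. t \<in> I \<Longrightarrow> real t * exp 1 \<le> real p"
    and cols: "\<And>j. j < p \<Longrightarrow> ip n (\<lambda>i. X i j) (\<lambda>i. X i j) \<le> real n"
  obtains A where "A \<in> sets (gauss_noise n \<sigma>)"
    and "1 - (real (card I) * (2 * real s / real p) ^ (2 * s) + 2 * exp (- real n / 24)) \<le> measure (gauss_noise n \<sigma>) A"
    and "\<And>e. e \<in> A \<Longrightarrow> real n * \<sigma>\<^sup>2 / 2 \<le> (\<Sum>i<n. (e i)\<^sup>2) \<and> (\<Sum>i<n. (e i)\<^sup>2) \<le> 4 * (real n * \<sigma>\<^sup>2)"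
    and "\<And>e t d. e \<in> A \<Longrightarrow> t \<in> I \<Longrightarrow> ip n e (lincomb p X d)
      \<le> sqrt (real n * (16 * \<sigma>\<^sup>2 * ln (2 * real p / real t))) * (\<Sum>j<p. \<bar>d j\<bar>)
      + 2 * sqrt (real t * (16 * \<sigma>\<^sup>2 * ln (2 * real p / real t))) * sqrt (ip n (lincomb p X d) (lincomb p X d))"
proof -
  interpret prob_space "gauss_noise n \<sigma>" using \<sigma> by (rule prob_space_gauss_noise)
  have tp: "0 < t \<and> t \<le> p \<and> 1 \<le> ln (2 * real p / real t) \<and> real t * exp 1 \<le> 2 * real p" if "t \<in> I" for t
  proof -
    have t: "0 < real t" using I(2)[OF that] s by simp
    have "real t * 1 \<le> real t * exp 1" using t by (intro mult_left_mono) auto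
    then have "real t \<le> real p" using I(3)[OF that] by linarith
    moreover have "1 \<le> ln (2 * real p / real t)"
      using I(3)[OF that] t \<open>real t \<le> real p\<close> by (subst ln_ge_iff) (auto simp: field_simps)
    ultimately show ?thesis using I(3)[OF that] t by simp
  qed
  define F where "F = (2 * real s / real p) ^ (2 * s)"
  have "\<exists>A. A \<in> events \<and> 1 - F \<le> prob A \<and>
    (\<forall>e u. e \<in> A \<longrightarrow> l0_norm p u \<le> t \<longrightarrow> gain n p X e u < real t * (16 * \<sigma>\<^sup>2 * ln (2 * real p / real t)))"
    if t: "t \<in> I" for t
  proof -
    obtain A where A: "A \<in> events" "1 - exp (- (2 * (real t * ln (2 * real p / real t)))) \<le> prob A"
      "\<And>e u. e \<in> A \<Longrightarrow> l0_norm p u \<le> t \<Longrightarrow> gain n p X e u < real t * (16 * \<sigma>\<^sup>2 * ln (2 * real p / real t))"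
      using gauss_noise_sparse_gain_log[OF \<sigma>, where s = t and p = p and n = n and X = X] tp[OF t] by (auto simp: pos_le_divide_eq)
    moreover have "exp (- (2 * (real t * ln (2 * real p / real t)))) \<le> F"
      unfolding F_def using I(2)[OF t] s tp[OF t] by (intro exp_neg_mult_ln_le) auto
    ultimately show ?thesis by (intro exI[of _ A]) (auto intro: order_trans[rotated])
  qed
  then obtain AA where AA: "\<And>t. t \<in> I \<Longrightarrow> AA t \<in> events" "\<And>t. t \<in> I \<Longrightarrow> 1 - F \<le> prob (AA t)"
    "\<And>t e u. t \<in> I \<Longrightarrow> e \<in> AA t \<Longrightarrow> l0_norm p u \<le> t \<Longrightarrow> gain n p X e u < real t * (16 * \<sigma>\<^sup>2 * ln (2 * real p / real t))"
    by metis
  define A1 where "A1 = space (gauss_noise n \<sigma>) \<inter> (\<Inter>t\<in>I. AA t)"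
  define L where "L = {e \<in> space (gauss_noise n \<sigma>). (\<Sum>i<n. (e i)\<^sup>2) \<le> real n * \<sigma>\<^sup>2 / 2}"
  define U where "U = {e \<in> space (gauss_noise n \<sigma>). 4 * (real n * \<sigma>\<^sup>2) \<le> (\<Sum>i<n. (e i)\<^sup>2)}"
  have sq [measurable]: "(\<lambda>e. \<Sum>i<n. (e i)\<^sup>2) \<in> borel_measurable (gauss_noise n \<sigma>)" by measurable
  have L: "L \<in> events" and U: "U \<in> events" unfolding L_def U_def by measurable
  have "A1 = space (gauss_noise n \<sigma>) - (\<Union>t\<in>I. space (gauss_noise n \<sigma>) - AA t)"
    by (auto simp: A1_def)
  also have "\<dots> \<in> events" using I(1) AA(1) by (intro sets.Diff sets.finite_UN sets.top) blast+
  finally have A1: "A1 \<in> events" .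
  have A1p: "1 - real (card I) * F \<le> prob A1"
    unfolding A1_def using I(1) AA by (intro prob_INT_ge) blast+
  have Lp: "1 - exp (- real n / 24) \<le> prob (space (gauss_noise n \<sigma>) - L)"
    using prob_compl[OF L] gauss_noise_norm_lower_tail[OF \<sigma>, of n] by (simp add: L_def)
  have Up: "1 - exp (- real n / 24) \<le> prob (space (gauss_noise n \<sigma>) - U)"
    using prob_compl[OF U] gauss_noise_norm_upper_tail[OF \<sigma>, of n] by (simp add: U_def)
  define A where "A = A1 \<inter> ((space (gauss_noise n \<sigma>) - L) \<inter> (space (gauss_noise n \<sigma>) - U))"
  show ?thesis
  proof (rule that[of A])
    show "A \<in> events" unfolding A_def using A1 L U by (intro sets.Int sets.Diff sets.top)
    have "1 - (real (card I) * F + (exp (- real n / 24) + exp (- real n / 24))) \<le> prob A"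
      unfolding A_def using L U
      by (intro prob_Int_ge A1 A1p Lp Up sets.Int sets.Diff sets.top)
    then show "1 - (real (card I) * (2 * real s / real p) ^ (2 * s) + 2 * exp (- real n / 24)) \<le> prob A"
      by (simp add: F_def)
  next
    fix e assume "e \<in> A"
    then show "real n * \<sigma>\<^sup>2 / 2 \<le> (\<Sum>i<n. (e i)\<^sup>2) \<and> (\<Sum>i<n. (e i)\<^sup>2) \<le> 4 * (real n * \<sigma>\<^sup>2)"
      by (auto simp: A_def L_def U_def)
  next
    fix e t d assume e: "e \<in> A" and t: "t \<in> I"
    define \<theta> where "\<theta> = 16 * \<sigma>\<^sup>2 * ln (2 * real p / real t)"
    have \<theta>: "0 < \<theta>" using \<sigma> tp[OF t] by (simp add: \<theta>_def)
    have "gain n p X e u < real t * \<theta>" if "l0_norm p u \<le> t" for u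
      using AA(3)[OF t _ that] e t by (simp add: A_def A1_def \<theta>_def)
    then obtain u where "ip n (lincomb p X u) (lincomb p X u) \<le> 4 * real t * \<theta>"
      "\<And>j. j < p \<Longrightarrow> \<bar>ip n (\<lambda>i. e i - lincomb p X u i) (\<lambda>i. X i j)\<bar> \<le> sqrt (real n * \<theta>)"
      using sparse_gain_bound_decomposition[where n = n and s = t and p = p and X = X and e = e, OF n _ \<theta> cols] tp[OF t] by metis
    then have "ip n e (lincomb p X d) \<le> sqrt (real n * \<theta>) * (\<Sum>j<p. \<bar>d j\<bar>)
      + 2 * sqrt (real t * \<theta>) * sqrt (ip n (lincomb p X d) (lincomb p X d))"
      using \<theta> by (intro ip_lincomb_bound) auto
    then show "ip n e (lincomb p X d)
      \<le> sqrt (real n * (16 * \<sigma>\<^sup>2 * ln (2 * real p / real t))) * (\<Sum>j<p. \<bar>d j\<bar>)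
      + 2 * sqrt (real t * (16 * \<sigma>\<^sup>2 * ln (2 * real p / real t))) * sqrt (ip n (lincomb p X d) (lincomb p X d))"
      by (simp add: \<theta>_def)
  qed
qed

section \<open>Estimation error of the Square-Root Lasso\<close>

lemma lq_norm_1: "lq_norm p 1 u = (\<Sum>j<p. \<bar>u j\<bar>)"
  by (simp add: lq_norm_def sum_nonneg)

lemma lq_norm_2: "lq_norm p 2 u = sqrt (\<Sum>j<p. (u j)\<^sup>2)"
  by (simp add: lq_norm_def powr_half_sqrt sum_nonneg)

lemma emp_norm_ip: "emp_norm n u = sqrt (ip n u u / real n)"
  by (simp add: emp_norm_def ip_def power2_eq_square)

lemma matvec_lincomb: "i < n \<Longrightarrow> matvec n p X b i = lincomb p X b i"
  by (simp add: matvec_def lincomb_def)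

lemma emp_norm_matvec: "emp_norm n (matvec n p X u) = sqrt (ip n (lincomb p X u) (lincomb p X u) / real n)"
  unfolding emp_norm_ip by (simp add: ip_def matvec_lincomb)

lemma emp_norm_nonneg: "0 \<le> emp_norm n u"
  by (simp add: emp_norm_def sum_nonneg)

lemma emp_norm_triangle: "emp_norm n (\<lambda>i. u i + v i) \<le> emp_norm n u + emp_norm n v"
proof -
  have "emp_norm n w = sqrt (1 / real n) * L2_set w {..<n}" for w
    by (simp add: emp_norm_def L2_set_def real_sqrt_mult real_sqrt_divide)
  then show ?thesis
    using L2_set_triangle_ineq[of u v "{..<n}"] by (simp add: mult_left_mono flip: distrib_left)
qed

lemma kappa_le:
  assumes "\<delta> \<in> C_SRE p s c0" and "j < p" and "\<delta> j \<noteq> 0"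
  shows "kappa n p X s c0 \<le> emp_norm n (matvec n p X \<delta>) / lq_norm p 2 \<delta>"
  unfolding kappa_def
proof (rule cINF_lower)
  show "bdd_below ((\<lambda>\<delta>. emp_norm n (matvec n p X \<delta>) / lq_norm p 2 \<delta>) ` {\<delta> \<in> C_SRE p s c0. \<exists>j<p. \<delta> j \<noteq> 0})"
    by (rule bdd_belowI[of _ 0]) (auto simp: emp_norm_nonneg lq_norm_2 sum_nonneg)
qed (use assms in auto)

lemma basis_vec_norms:
  assumes "j < p"
  shows "(\<Sum>l<p. \<bar>basis_vec p j l\<bar>) = 1" "(\<Sum>l<p. (basis_vec p j l)\<^sup>2) = 1"
proof -
  have "(\<Sum>l<p. \<bar>basis_vec p j l\<bar>) = (\<Sum>l<p. if l = j then 1 else 0)"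
    by (intro sum.cong) (auto simp: basis_vec_def)
  then show "(\<Sum>l<p. \<bar>basis_vec p j l\<bar>) = 1" using assms by simp
  have "(\<Sum>l<p. (basis_vec p j l)\<^sup>2) = (\<Sum>l<p. if l = j then 1 else 0)"
    by (intro sum.cong) (auto simp: basis_vec_def)
  then show "(\<Sum>l<p. (basis_vec p j l)\<^sup>2) = 1" using assms by simp
qed

lemma basis_vec_in_C_SRE:
  assumes "j < p" "1 \<le> s" "0 \<le> c0"
  shows "basis_vec p j \<in> C_SRE p s c0"
proof -
  have "1 * 1 \<le> (1 + c0) * sqrt (real s)" using assms by (intro mult_mono) auto
  then show ?thesis
    using assms basis_vec_norms[OF assms(1)]
    by (simp add: C_SRE_def lq_norm_1 lq_norm_2 Rn_def space_PiM basis_vec_def)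
qed

text \<open>
  Basis vectors lie in the cone and columns have empirical norm at most 1.
\<close>

lemma kappa_le_1:
  assumes "SRE n p X s c0" and "0 < p" "1 \<le> s" "0 \<le> c0"
  shows "kappa n p X s c0 \<le> 1"
proof -
  have "kappa n p X s c0 \<le> emp_norm n (matvec n p X (basis_vec p 0)) / lq_norm p 2 (basis_vec p 0)"
    using assms by (intro kappa_le[where j = 0] basis_vec_in_C_SRE) (auto simp: basis_vec_def)
  also have "\<dots> \<le> 1"
    using assms basis_vec_norms[of 0 p] by (simp add: lq_norm_2 SRE_def)
  finally show ?thesis .
qed

lemma kappa_antimono:
  assumes "s \<le> t" "1 \<le> s" "0 < p" "0 \<le> c0"
  shows "kappa n p X t c0 \<le> kappa n p X s c0"
  unfolding kappa_def
proof (rule cINF_superset_mono)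
  show "{\<delta> \<in> C_SRE p s c0. \<exists>j<p. \<delta> j \<noteq> 0} \<noteq> {}"
    using basis_vec_in_C_SRE[of 0 p s c0] assms by (auto simp: basis_vec_def intro!: exI[of _ "basis_vec p 0"] exI[of _ 0])
  show "bdd_below ((\<lambda>\<delta>. emp_norm n (matvec n p X \<delta>) / lq_norm p 2 \<delta>) ` {\<delta> \<in> C_SRE p t c0. \<exists>j<p. \<delta> j \<noteq> 0})"
    by (rule bdd_belowI[of _ 0]) (auto simp: emp_norm_nonneg lq_norm_2 sum_nonneg)
  have "C_SRE p s c0 \<subseteq> C_SRE p t c0"
  proof
    fix \<delta> assume d: "\<delta> \<in> C_SRE p s c0"
    have "(1 + c0) * sqrt (real s) * lq_norm p 2 \<delta> \<le> (1 + c0) * sqrt (real t) * lq_norm p 2 \<delta>"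
      using assms by (intro mult_right_mono mult_left_mono) (auto simp: lq_norm_2 sum_nonneg)
    then show "\<delta> \<in> C_SRE p t c0" using d by (auto simp: C_SRE_def)
  qed
  then show "{\<delta> \<in> C_SRE p s c0. \<exists>j<p. \<delta> j \<noteq> 0} \<subseteq> {\<delta> \<in> C_SRE p t c0. \<exists>j<p. \<delta> j \<noteq> 0}" by auto
qed auto

text \<open>
  The definition of \<open>kappa\<close> concerns extensional vectors only; the values outside \<open>{..<p}\<close> are
  immaterial to both sides.
\<close>

lemma kappa_lower_bound:
  assumes "0 < p" and "(\<Sum>j<p. \<bar>d j\<bar>) \<le> (1 + c0) * sqrt (real s) * sqrt (\<Sum>j<p. (d j)\<^sup>2)"
  shows "kappa n p X s c0 * sqrt (\<Sum>j<p. (d j)\<^sup>2) \<le> sqrt (ip n (lincomb p X d) (lincomb p X d) / real n)"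
proof (cases "\<exists>j<p. d j \<noteq> 0")
  case False
  then show ?thesis by (simp add: ip_self_nonneg)
next
  case True
  then obtain j where j: "j < p" "d j \<noteq> 0" by blast
  define \<delta> where "\<delta> = restrict d {..<p}"
  have n2: "lq_norm p 2 \<delta> = sqrt (\<Sum>j<p. (d j)\<^sup>2)" by (simp add: lq_norm_2 \<delta>_def)
  have "0 < (d j)\<^sup>2" "(d j)\<^sup>2 \<le> (\<Sum>j<p. (d j)\<^sup>2)"
    using j by (auto intro!: member_le_sum[of j])
  then have "0 < (\<Sum>j<p. (d j)\<^sup>2)" by (rule less_le_trans)
  then have pos: "0 < sqrt (\<Sum>j<p. (d j)\<^sup>2)" by simp
  have "\<delta> \<in> C_SRE p s c0"
    using assms(2) unfolding C_SRE_def mem_Collect_eq n2 by (simp add: lq_norm_1 \<delta>_def Rn_def space_PiM)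
  from kappa_le[OF this j(1), of n X] j
  have "kappa n p X s c0 \<le> emp_norm n (matvec n p X \<delta>) / sqrt (\<Sum>j<p. (d j)\<^sup>2)"
    unfolding n2 by (simp add: \<delta>_def)
  moreover have "lincomb p X \<delta> = lincomb p X d" by (simp add: lincomb_def \<delta>_def)
  ultimately show ?thesis using pos by (simp add: emp_norm_matvec pos_le_divide_eq)
qed

text \<open>
  The real-number core of the analysis of the Square-Root Lasso. Here \<open>N\<close> and \<open>R\<close> are the
  empirical norms of the noise and of the residual, \<open>V\<close>, \<open>D1\<close> and \<open>D2\<close> are the prediction,
  \<open>\<ell>\<^sub>1\<close> and \<open>\<ell>\<^sub>2\<close> errors, \<open>a\<close> and \<open>c\<close> the parts of \<open>D1\<close> on and off the support of the truth, and
  \<open>W\<close> the normalised correlation of the noise with the prediction error. Minimality bounds \<open>R - N\<close>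
  from above, convexity of the norm bounds it from below by the correlation; together they confine the error
  to a cone, and the expansion of the squared residual then yields a self-bounding
  inequality for \<open>V\<close>. The factor \<open>3 / 10\<close>, obtained from \<open>\<gamma> \<ge> 16 + 4 \<surd>2\<close>, makes the cone narrow
  enough for the restricted eigenvalue condition with constant \<open>5 / 3\<close> at twice the sparsity.
\<close>

lemma sqrt_lasso_error_arithmetic:
  fixes N R W V D1 D2 a c l rs r0 \<kappa> :: real
  assumes pos: "0 < N" "0 \<le> V" "0 \<le> D2" "0 < l" "0 \<le> rs" "rs \<le> r0" "0 < \<kappa>" "\<kappa> \<le> 1" "0 \<le> R"
    and min: "R - N \<le> l * (a - c)"
    and conv: "N * (N - R) \<le> W"
    and exp: "V\<^sup>2 = R\<^sup>2 - N\<^sup>2 + 2 * W"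
    and noise: "W \<le> 3 / 10 * N * l * (D1 + 2 * r0 * V)"
    and D1: "D1 = a + c" and a: "a \<le> rs * D2" and c: "0 \<le> c"
    and cone: "D1 \<le> 26 / 7 * r0 * D2 \<Longrightarrow> \<kappa> * D2 \<le> V"
    and small: "l\<^sup>2 * rs\<^sup>2 \<le> \<kappa>\<^sup>2 / 2"
  shows "D2 \<le> 11 * N * l * r0 / \<kappa>\<^sup>2" and "D1 \<le> 41 * N * l * r0\<^sup>2 / \<kappa>\<^sup>2"
proof -
  have r0: "0 \<le> r0" using pos by linarith
  have "N * (N - R) \<le> N * (3 / 10 * l * (D1 + 2 * r0 * V))"
    using order_trans[OF conv noise] by (simp add: mult_ac)
  then have "N - R \<le> 3 / 10 * l * (D1 + 2 * r0 * V)"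
    using pos(1) by (simp only: mult_le_cancel_left_pos)
  then have "l * (c - a) \<le> l * (3 / 10 * (D1 + 2 * r0 * V))"
    using min by (simp add: algebra_simps)
  then have "c - a \<le> 3 / 10 * (D1 + 2 * r0 * V)"
    using pos(4) by (simp only: mult_le_cancel_left_pos)
  then have D1a: "D1 \<le> 20 / 7 * a + 6 / 7 * (r0 * V)"
    unfolding D1 by (simp add: field_simps)
  have rsD: "rs * D2 \<le> r0 * D2" using pos by (intro mult_right_mono) auto
  have D1b: "D1 \<le> 20 / 7 * (r0 * D2) + 6 / 7 * (r0 * V)"
    using D1a a rsD by linarith
  \<comment> \<open>Either the prediction error is at most \<open>D2\<close> and the error is in the cone, or \<open>\<kappa> \<le> 1\<close> suffices.\<close>
  have kD2: "\<kappa> * D2 \<le> V"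
  proof (cases "V \<le> D2")
    case True
    then have "r0 * V \<le> r0 * D2" using r0 by (intro mult_left_mono) auto
    then show ?thesis using D1b by (intro cone) linarith
  next
    case False
    moreover have "\<kappa> * D2 \<le> 1 * D2" using pos by (intro mult_right_mono) auto
    ultimately show ?thesis by linarith
  qed
  define Z where "Z = V / \<kappa>"
  have Z: "D2 \<le> Z" "V \<le> Z" "0 \<le> Z" "V = \<kappa> * Z"
  proof -
    show "D2 \<le> Z" "0 \<le> Z" "V = \<kappa> * Z" using kD2 pos by (auto simp: Z_def field_simps)
    have "V * \<kappa> \<le> V * 1" using pos by (intro mult_left_mono) auto
    then show "V \<le> Z" using pos by (simp add: Z_def pos_le_divide_eq)
  qed
  have r0Z: "r0 * D2 \<le> r0 * Z" "r0 * V \<le> r0 * Z" using r0 Z by (auto intro: mult_left_mono)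
  have D1Z: "D1 \<le> 26 / 7 * (r0 * Z)" using D1b r0Z by linarith
  have W: "W \<le> 12 / 7 * (N * l * (r0 * Z))"
  proof -
    have "D1 + 2 * (r0 * V) \<le> 40 / 7 * (r0 * Z)" using D1Z r0Z by linarith
    then have "3 / 10 * N * l * (D1 + 2 * (r0 * V)) \<le> 3 / 10 * N * l * (40 / 7 * (r0 * Z))"
      using pos by (intro mult_left_mono) auto
    moreover have "W \<le> 3 / 10 * N * l * (D1 + 2 * (r0 * V))" using noise by (simp add: mult.assoc)
    ultimately have "W \<le> 3 / 10 * N * l * (40 / 7 * (r0 * Z))" by linarith
    then show ?thesis by (simp add: mult_ac)
  qed
  have g: "R \<le> N + l * (rs * D2)"
  proof -
    have "l * (a - c) \<le> l * (rs * D2)" using a c pos by (intro mult_left_mono) auto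
    then show ?thesis using min by linarith
  qed
  then have "R\<^sup>2 \<le> (N + l * (rs * D2))\<^sup>2" using pos by (intro power_mono) auto
  also have "\<dots> = N\<^sup>2 + 2 * (N * l * (rs * D2)) + l\<^sup>2 * rs\<^sup>2 * D2\<^sup>2"
    by (simp add: power2_eq_square algebra_simps)
  finally have R2: "R\<^sup>2 - N\<^sup>2 \<le> 2 * (N * l * (rs * D2)) + l\<^sup>2 * rs\<^sup>2 * D2\<^sup>2" by linarith
  have "0 \<le> N * l * (r0 * Z)" using pos r0 Z by simp
  have "N * l * (rs * D2) \<le> N * l * (r0 * Z)"
    using pos rsD r0Z by (intro mult_left_mono) auto
  moreover have "l\<^sup>2 * rs\<^sup>2 * D2\<^sup>2 \<le> V\<^sup>2 / 2"
  proof -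
    have "l\<^sup>2 * rs\<^sup>2 * D2\<^sup>2 \<le> \<kappa>\<^sup>2 / 2 * D2\<^sup>2" using small by (intro mult_right_mono) auto
    also have "\<dots> = (\<kappa> * D2)\<^sup>2 / 2" by (simp add: power_mult_distrib)
    also have "\<dots> \<le> V\<^sup>2 / 2" using kD2 pos by (intro divide_right_mono power_mono) auto
    finally show ?thesis .
  qed
  ultimately have "V\<^sup>2 \<le> 11 * (N * l * (r0 * Z))"
    using exp R2 W \<open>0 \<le> N * l * (r0 * Z)\<close> by linarith
  then have "V * (\<kappa> * Z) \<le> (11 * N * l * r0) * Z"
    using Z(4) by (simp add: power2_eq_square mult_ac)
  then have "\<kappa> * V \<le> 11 * N * l * r0"
  proof (cases "Z = 0")
    case True
    then show ?thesis using Z(4) pos r0 by simp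
  next
    case False
    then have "0 < Z" using Z by simp
    moreover have "(\<kappa> * V) * Z \<le> (11 * N * l * r0) * Z"
      using \<open>V * (\<kappa> * Z) \<le> (11 * N * l * r0) * Z\<close> by (simp add: mult_ac)
    ultimately show ?thesis by (simp only: mult_le_cancel_right_pos)
  qed
  then have ZB: "Z \<le> 11 * N * l * r0 / \<kappa>\<^sup>2"
    using pos by (simp add: Z_def field_simps power2_eq_square)
  then show "D2 \<le> 11 * N * l * r0 / \<kappa>\<^sup>2" using Z(1) by linarith
  have "r0 * Z \<le> r0 * (11 * N * l * r0 / \<kappa>\<^sup>2)"
    using ZB r0 by (rule mult_left_mono)
  then have "26 / 7 * (r0 * Z) \<le> 26 / 7 * (r0 * (11 * N * l * r0 / \<kappa>\<^sup>2))"
    by (rule mult_left_mono) simp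
  with D1Z have "D1 \<le> 26 / 7 * (r0 * (11 * N * l * r0 / \<kappa>\<^sup>2))" by (rule order_trans)
  also have "\<dots> = (286 / 7) * (N * l * r0\<^sup>2 / \<kappa>\<^sup>2)" by (simp add: power2_eq_square)
  also have "\<dots> \<le> 41 * (N * l * r0\<^sup>2 / \<kappa>\<^sup>2)" using pos by (intro mult_right_mono) auto
  finally show "D1 \<le> 41 * N * l * r0\<^sup>2 / \<kappa>\<^sup>2" by simp
qed

text \<open>
  Interpolation between the endpoints through the pointwise inequality \<open>z\<^sup>q \<le> z + z\<^sup>2\<close> at
  \<open>z = |u\<^sub>j| / h\<close>, which costs a factor 2 compared with the sharp inequality of Hoelder type.
\<close>

lemma lq_norm_le_of_l1_l2:
  assumes "0 < h" "0 < s" "1 \<le> q" "q \<le> 2"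
    and l1: "(\<Sum>j<p. \<bar>u j\<bar>) \<le> s * h" and l2: "(\<Sum>j<p. (u j)\<^sup>2) \<le> s * h\<^sup>2"
  shows "lq_norm p q u \<le> 2 * h * s powr (1 / q)"
proof -
  have pt: "\<bar>x\<bar> powr q \<le> h powr q * (\<bar>x\<bar> / h + x\<^sup>2 / h\<^sup>2)" for x :: real
  proof -
    define z where "z = \<bar>x\<bar> / h"
    have z: "0 \<le> z" using assms(1) by (simp add: z_def)
    have "z powr q \<le> z + z\<^sup>2"
    proof (cases "z \<le> 1")
      case True
      have "z powr q \<le> z powr 1" if "z \<noteq> 0"
        using True z assms(3) that by (intro powr_mono') auto
      then show ?thesis using z by (cases "z = 0") (auto intro: add_increasing2)
    next
      case False
      then have "z powr q \<le> z powr 2" using assms(4) by (intro powr_mono) auto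
      then show ?thesis using z False by simp
    qed
    moreover have "\<bar>x\<bar> powr q = h powr q * z powr q"
      using assms(1) by (simp add: z_def flip: powr_mult)
    ultimately show ?thesis
      using mult_left_mono[of "z powr q" "z + z\<^sup>2" "h powr q"] by (simp add: z_def power_divide)
  qed
  have "(\<Sum>j<p. \<bar>u j\<bar> powr q) \<le> (\<Sum>j<p. h powr q * (\<bar>u j\<bar> / h + (u j)\<^sup>2 / h\<^sup>2))"
    by (intro sum_mono pt)
  also have "\<dots> = h powr q * ((\<Sum>j<p. \<bar>u j\<bar>) / h + (\<Sum>j<p. (u j)\<^sup>2) / h\<^sup>2)"
    unfolding sum_distrib_left[symmetric] sum.distrib sum_divide_distrib ..
  also have "\<dots> \<le> h powr q * (s + s)"
    using l1 l2 assms by (intro mult_left_mono add_mono) (auto simp: pos_divide_le_eq)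
  finally have "lq_norm p q u \<le> (h powr q * (2 * s)) powr (1 / q)"
    unfolding lq_norm_def using assms by (intro powr_mono2) (auto intro: sum_nonneg)
  also have "\<dots> = h * (2 powr (1 / q) * s powr (1 / q))"
    using assms by (simp add: powr_mult powr_powr)
  also have "\<dots> \<le> h * (2 powr 1 * s powr (1 / q))"
    using assms by (intro mult_left_mono mult_right_mono powr_mono) auto
  finally show ?thesis by simp
qed

text \<open>
  Minimality compared with the truth \<open>b\<close>: off the support \<open>S\<close> of \<open>b\<close> the estimator coincides with
  its error, so that the error there is paid for in the penalty.
\<close>

lemma sql_basic_inequality:
  assumes min: "sql_objective n p X s' \<gamma> y bh \<le> sql_objective n p X s' \<gamma> y b"
    and S: "S = {j \<in> {..<p}. b j \<noteq> 0}" and lam: "0 \<le> sql_lambda n p s' \<gamma>"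
  shows "emp_norm n (vsub y (matvec n p X bh)) - emp_norm n (vsub y (matvec n p X b))
    \<le> sql_lambda n p s' \<gamma> * ((\<Sum>j\<in>S. \<bar>bh j - b j\<bar>) - (\<Sum>j\<in>{..<p} - S. \<bar>bh j - b j\<bar>))"
proof -
  have obj: "sql_objective n p X s' \<gamma> y \<beta>
      = emp_norm n (vsub y (matvec n p X \<beta>)) + sql_lambda n p s' \<gamma> * (\<Sum>j<p. \<bar>\<beta> j\<bar>)" for \<beta>
    unfolding sql_objective_def lq_norm_1 lq_norm_2 emp_norm_def
    by (simp add: real_sqrt_mult real_sqrt_divide)
  have split: "(\<Sum>j<p. f j) = (\<Sum>j\<in>S. f j) + (\<Sum>j\<in>{..<p} - S. f j)" for f :: "nat \<Rightarrow> real"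
    using sum.subset_diff[of S "{..<p}" f] S by (auto simp: add.commute)
  have "(\<Sum>j\<in>S. \<bar>b j\<bar>) - (\<Sum>j\<in>S. \<bar>bh j\<bar>) \<le> (\<Sum>j\<in>S. \<bar>bh j - b j\<bar>)"
    unfolding sum_subtractf[symmetric] by (intro sum_mono) auto
  moreover have "(\<Sum>j\<in>{..<p} - S. \<bar>b j\<bar>) = 0"
    using S by (intro sum.neutral) auto
  moreover have "(\<Sum>j\<in>{..<p} - S. \<bar>bh j\<bar>) = (\<Sum>j\<in>{..<p} - S. \<bar>bh j - b j\<bar>)"
    using S by (intro sum.cong) auto
  ultimately have "(\<Sum>j<p. \<bar>b j\<bar>) - (\<Sum>j<p. \<bar>bh j\<bar>)
      \<le> (\<Sum>j\<in>S. \<bar>bh j - b j\<bar>) - (\<Sum>j\<in>{..<p} - S. \<bar>bh j - b j\<bar>)"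
    unfolding split[of "\<lambda>j. \<bar>b j\<bar>"] split[of "\<lambda>j. \<bar>bh j\<bar>"] by linarith
  then have "sql_lambda n p s' \<gamma> * ((\<Sum>j<p. \<bar>b j\<bar>) - (\<Sum>j<p. \<bar>bh j\<bar>))
      \<le> sql_lambda n p s' \<gamma> * ((\<Sum>j\<in>S. \<bar>bh j - b j\<bar>) - (\<Sum>j\<in>{..<p} - S. \<bar>bh j - b j\<bar>))"
    using lam by (rule mult_left_mono)
  then show ?thesis
    using min unfolding obj by (simp add: right_diff_distrib)
qed

text \<open>
  The first inequality is the convexity (subgradient) bound for the norm of the residual, obtained
  from Cauchy--Schwarz for \<open>e\<close> and \<open>e - v\<close>.
\<close>

lemma residual_expansion:
  fixes e v :: "nat \<Rightarrow> real"
  assumes "0 < n"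
  defines "W \<equiv> ip n e v / real n"
  shows "emp_norm n e * (emp_norm n e - emp_norm n (\<lambda>i. e i - v i)) \<le> W"
    and "(emp_norm n v)\<^sup>2 = (emp_norm n (\<lambda>i. e i - v i))\<^sup>2 - (emp_norm n e)\<^sup>2 + 2 * W"
proof -
  have sq: "(emp_norm n u)\<^sup>2 = ip n u u / real n" for u
    unfolding emp_norm_ip by (simp add: ip_self_nonneg)
  show "(emp_norm n v)\<^sup>2 = (emp_norm n (\<lambda>i. e i - v i))\<^sup>2 - (emp_norm n e)\<^sup>2 + 2 * W"
    unfolding sq W_def using assms(1)
    by (simp add: field_simps) (simp add: ip_def algebra_simps sum.distrib sum_subtractf sum_distrib_left)
  have "ip n e (\<lambda>i. e i - v i) \<le> sqrt (ip n e e) * sqrt (ip n (\<lambda>i. e i - v i) (\<lambda>i. e i - v i))"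
    by (rule Cauchy_Schwarz_ip)
  then have "ip n e (\<lambda>i. e i - v i) / real n
      \<le> sqrt (ip n e e) * sqrt (ip n (\<lambda>i. e i - v i) (\<lambda>i. e i - v i)) / real n"
    by (rule divide_right_mono) simp
  also have "\<dots> = emp_norm n e * emp_norm n (\<lambda>i. e i - v i)"
    unfolding emp_norm_ip real_sqrt_divide by simp
  also have "ip n e (\<lambda>i. e i - v i) = ip n e e - ip n e v"
    by (subst ip_commute, subst ip_diff_left) (simp add: ip_commute)
  finally have "(emp_norm n e)\<^sup>2 - W \<le> emp_norm n e * emp_norm n (\<lambda>i. e i - v i)"
    unfolding sq W_def by (simp add: diff_divide_distrib)
  then show "emp_norm n e * (emp_norm n e - emp_norm n (\<lambda>i. e i - v i)) \<le> W"
    by (simp add: power2_eq_square right_diff_distrib)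
qed

lemma sum_abs_le_sqrt_card:
  fixes p :: nat
  assumes "S \<subseteq> {..<p}" "card S \<le> s"
  shows "(\<Sum>j\<in>S. \<bar>d j\<bar>) \<le> sqrt (real s) * sqrt (\<Sum>j<p. (d j)\<^sup>2 :: real)"
proof -
  have "(\<Sum>j\<in>S. 1 * \<bar>d j\<bar>)\<^sup>2 \<le> (\<Sum>j\<in>S. 1\<^sup>2) * (\<Sum>j\<in>S. \<bar>d j\<bar>\<^sup>2)"
    by (rule Cauchy_Schwarz_ineq_sum)
  also have "\<dots> \<le> real s * (\<Sum>j<p. (d j)\<^sup>2)"
    using assms by (intro mult_mono) (auto intro!: sum_mono2 sum_nonneg)
  finally show ?thesis
    by (simp add: real_le_rsqrt flip: real_sqrt_mult)
qed

text \<open>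
  Deterministic estimation bound for the Square-Root Lasso tuned for sparsity \<open>s'\<close> when the truth is
  \<open>s\<close>-sparse. The tuning may be smaller or larger than the truth: the noise bound is
  taken at a level \<open>s0\<close> above both, while the penalty for \<open>s' \<le> s0\<close> is at least the one for \<open>s0\<close>
  and therefore still dominates that noise.
\<close>

lemma sql_lq_error_bound:
  fixes \<kappa> \<gamma> \<sigma> q :: real
  assumes n: "0 < n" and p: "0 < p" and \<sigma>: "0 < \<sigma>" and \<gamma>: "16 + 4 * sqrt 2 \<le> \<gamma>"
    and q: "1 \<le> q" "q \<le> 2"
    and \<kappa>: "\<kappa> = kappa n p X (2 * t) (5/3)" "0 < \<kappa>" "\<kappa> \<le> 1"
    and s: "1 \<le> s'" "s' \<le> s0" "s \<le> s0" "s0 \<le> t" "t < 2 * p"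
    and small: "(sql_lambda n p s' \<gamma>)\<^sup>2 * real s \<le> \<kappa>\<^sup>2 / 2"
    and b: "l0_norm p b \<le> s"
    and noise: "\<And>d. ip n e (lincomb p X d) \<le> sqrt (real n * (16 * \<sigma>\<^sup>2 * ln (2 * real p / real s0))) * (\<Sum>j<p. \<bar>d j\<bar>)
      + 2 * sqrt (real s0 * (16 * \<sigma>\<^sup>2 * ln (2 * real p / real s0))) * sqrt (ip n (lincomb p X d) (lincomb p X d))"
    and e: "e = vsub y (matvec n p X b)"
    and N: "real n * \<sigma>\<^sup>2 / 2 \<le> (\<Sum>i<n. (e i)\<^sup>2)" "(\<Sum>i<n. (e i)\<^sup>2) \<le> 4 * (real n * \<sigma>\<^sup>2)"
    and min: "sql_objective n p X s' \<gamma> y bh \<le> sql_objective n p X s' \<gamma> y b"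
  shows "lq_norm p q (vsub bh b) \<le> 164 * \<sigma> * sql_lambda n p s' \<gamma> / \<kappa>\<^sup>2 * real s0 powr (1 / q)"
proof -
  define l where "l = ln (2 * real p / real s0)"
  define l' where "l' = ln (2 * real p / real s')"
  define lam where "lam = sql_lambda n p s' \<gamma>"
  define S where "S = {j \<in> {..<p}. b j \<noteq> 0}"
  define d where "d = vsub bh b"
  define v where "v = lincomb p X d"
  define V where "V = emp_norm n v"
  define NN where "NN = emp_norm n e"
  define R where "R = emp_norm n (\<lambda>i. e i - v i)"
  define a where "a = (\<Sum>j\<in>S. \<bar>d j\<bar>)"
  define c where "c = (\<Sum>j\<in>{..<p} - S. \<bar>d j\<bar>)"
  define D1 where "D1 = (\<Sum>j<p. \<bar>d j\<bar>)"
  define D2 where "D2 = sqrt (\<Sum>j<p. (d j)\<^sup>2)"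
  have s0: "0 < real s0" "0 < real s'" using s by auto
  have \<gamma>0: "0 < \<gamma>" using \<gamma> by (rule less_le_trans[rotated]) (simp add: add_pos_pos)
  have l: "0 < l" unfolding l_def using s p by (subst ln_gt_zero_iff) (auto simp: field_simps)
  have l': "l \<le> l'" unfolding l_def l'_def using s p s0 by (subst ln_le_cancel_iff) (auto simp: field_simps)
  have lam: "lam = \<gamma> * sqrt (l' / real n)"
    by (simp add: lam_def sql_lambda_def l'_def)
  have lam0: "0 < lam" unfolding lam using \<gamma>0 l l' n by simp
  have R: "emp_norm n (vsub y (matvec n p X bh)) = R"
    unfolding R_def emp_norm_def e v_def d_def
    by (intro arg_cong[where f = sqrt] arg_cong2[where f = "(*)"] refl sum.cong)
      (auto simp: vsub_def matvec_lincomb lincomb_def algebra_simps sum_subtractf)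
  have NN2: "NN\<^sup>2 = (\<Sum>i<n. (e i)\<^sup>2) / real n"
    unfolding NN_def emp_norm_def by (simp add: sum_nonneg)
  have NN0: "0 \<le> NN" by (simp add: NN_def emp_norm_nonneg)
  have "\<sigma>\<^sup>2 / 2 \<le> NN\<^sup>2" "NN\<^sup>2 \<le> 4 * \<sigma>\<^sup>2"
    unfolding NN2 using N n by (auto simp: field_simps)
  then have "\<sigma>\<^sup>2 \<le> (sqrt 2 * NN)\<^sup>2" "NN\<^sup>2 \<le> (2 * \<sigma>)\<^sup>2" by (auto simp: power_mult_distrib)
  then have Nlow: "\<sigma> \<le> sqrt 2 * NN" and Nup: "NN \<le> 2 * \<sigma>"
    using NN0 \<sigma> by (auto intro: power2_le_imp_le)
  have Npos: "0 < NN" using Nlow \<sigma> by (metis NN0 less_le_trans mult_zero_right order_less_le)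
  have "sqrt 2 \<le> sqrt ((3/2)\<^sup>2)" by (subst real_sqrt_le_iff) (simp add: power2_eq_square)
  then have r2: "sqrt 2 \<le> 3/2" by simp
  have "4 * \<sigma> \<le> 4 * sqrt 2 * NN" using Nlow by simp
  also have "\<dots> \<le> (3 / 10 * \<gamma>) * NN" using \<gamma> r2 NN0 by (intro mult_right_mono) linarith+
  finally have s4: "4 * \<sigma> \<le> 3 / 10 * NN * \<gamma>" by (simp add: mult_ac)
  have sl: "4 * \<sigma> * sqrt (l / real n) \<le> 3 / 10 * NN * lam"
  proof -
    have "4 * \<sigma> * sqrt (l / real n) \<le> (3 / 10 * NN * \<gamma>) * sqrt (l' / real n)"
      by (rule mult_mono[OF s4]) (use l l' Npos \<gamma>0 in \<open>auto intro: divide_right_mono\<close>)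
    then show ?thesis by (simp add: lam mult_ac)
  qed
  have "S \<subseteq> {..<p}" by (auto simp: S_def)
  then have D1: "D1 = a + c"
    unfolding D1_def a_def c_def using sum.subset_diff[of S "{..<p}" "\<lambda>j. \<bar>d j\<bar>"] by simp
  have a: "a \<le> sqrt (real s) * D2"
    unfolding a_def D2_def using b by (intro sum_abs_le_sqrt_card) (auto simp: S_def l0_norm_def)
  have c: "0 \<le> c" unfolding c_def by (simp add: sum_nonneg)
  have V: "V = sqrt (ip n v v / real n)" by (simp add: V_def emp_norm_ip)
  have noiseW: "ip n e v / real n \<le> 3 / 10 * NN * lam * (D1 + 2 * sqrt (real s0) * V)"
  proof -
    have m1: "sqrt (real n * (16 * \<sigma>\<^sup>2 * l)) / real n = 4 * \<sigma> * sqrt (l / real n)"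
      using \<sigma> n by (simp add: real_sqrt_mult real_sqrt_divide field_simps)
    have m2: "2 * sqrt (real s0 * (16 * \<sigma>\<^sup>2 * l)) * sqrt (ip n v v) / real n
        = 4 * \<sigma> * sqrt (l / real n) * (2 * sqrt (real s0) * V)"
      using \<sigma> n by (simp add: V real_sqrt_mult real_sqrt_divide field_simps)
    have "ip n e v / real n \<le> (sqrt (real n * (16 * \<sigma>\<^sup>2 * l)) * D1
      + 2 * sqrt (real s0 * (16 * \<sigma>\<^sup>2 * l)) * sqrt (ip n v v)) / real n"
      using noise[of d] unfolding v_def D1_def l_def by (rule divide_right_mono) simp
    also have "\<dots> = sqrt (real n * (16 * \<sigma>\<^sup>2 * l)) / real n * D1
      + 2 * sqrt (real s0 * (16 * \<sigma>\<^sup>2 * l)) * sqrt (ip n v v) / real n"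
      by (simp add: add_divide_distrib)
    also have "\<dots> = 4 * \<sigma> * sqrt (l / real n) * (D1 + 2 * sqrt (real s0) * V)"
      unfolding m1 m2 by (simp add: distrib_left)
    also have "\<dots> \<le> 3 / 10 * NN * lam * (D1 + 2 * sqrt (real s0) * V)"
      using sl by (rule mult_right_mono) (simp add: D1_def V_def sum_nonneg emp_norm_nonneg)
    finally show ?thesis .
  qed
  \<comment> \<open>The sparsity \<open>2 t\<close> of the cone exceeds \<open>s0\<close> by a factor \<open>2\<close>, and \<open>26 / 7 \<le> (8 / 3) \<surd>2\<close>.\<close>
  have cone: "\<kappa> * D2 \<le> V" if "D1 \<le> 26 / 7 * sqrt (real s0) * D2"
  proof -
    have "sqrt ((7/5)\<^sup>2) \<le> sqrt 2" by (subst real_sqrt_le_iff) (simp add: power2_eq_square)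
    then have r2': "7/5 \<le> sqrt 2" by simp
    have "26 / 7 * sqrt (real s0) \<le> 8 / 3 * (sqrt 2 * sqrt (real t))"
    proof -
      have "sqrt (real s0) \<le> sqrt (real t)" using s by simp
      moreover have "7 / 5 * sqrt (real t) \<le> sqrt 2 * sqrt (real t)" using r2' by (intro mult_right_mono) auto
      ultimately show ?thesis using real_sqrt_ge_zero[of "real t"] by linarith
    qed
    then have "26 / 7 * sqrt (real s0) * D2 \<le> 8 / 3 * (sqrt 2 * sqrt (real t)) * D2"
      by (rule mult_right_mono) (simp add: D2_def sum_nonneg)
    with that have "D1 \<le> 8 / 3 * (sqrt 2 * sqrt (real t)) * D2" by (rule order_trans)
    then have "D1 \<le> (1 + 5 / 3) * sqrt (real (2 * t)) * D2" by (simp add: real_sqrt_mult)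
    then show ?thesis
      unfolding \<kappa>(1) V v_def D1_def D2_def by (intro kappa_lower_bound p)
  qed
  have ss: "sqrt (real s) \<le> sqrt (real s0)" using s by simp
  have basic: "R - NN \<le> lam * (a - c)"
    using sql_basic_inequality[OF min S_def less_imp_le[OF lam0[unfolded lam_def]], unfolded R]
    unfolding NN_def e lam_def a_def c_def d_def by (simp add: vsub_def)
  have sml: "lam\<^sup>2 * (sqrt (real s))\<^sup>2 \<le> \<kappa>\<^sup>2 / 2" using small by (simp add: lam_def)
  note core = sqrt_lasso_error_arithmetic[where N = NN and R = R and W = "ip n e v / real n" and V = V
      and ?D1.0 = D1 and ?D2.0 = D2 and a = a and c = c and l = lam and rs = "sqrt (real s)" and ?r0.0 = "sqrt (real s0)"
      and \<kappa> = \<kappa>, OF Npos _ _ lam0 _ ss \<kappa>(2,3) _ basic _ _ noiseW D1 a c cone sml]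
  have res: "NN * (NN - R) \<le> ip n e v / real n" "V\<^sup>2 = R\<^sup>2 - NN\<^sup>2 + 2 * (ip n e v / real n)"
    unfolding NN_def R_def V_def using residual_expansion[OF n] by auto
  have nn: "0 \<le> V" "0 \<le> D2" "0 \<le> R"
    by (auto simp: V_def R_def D2_def emp_norm_nonneg sum_nonneg)
  have D2b: "D2 \<le> 11 * NN * lam * sqrt (real s0) / \<kappa>\<^sup>2" and D1b: "D1 \<le> 41 * NN * lam * (sqrt (real s0))\<^sup>2 / \<kappa>\<^sup>2"
    using core res nn by auto
  define h where "h = 41 * (2 * \<sigma>) * lam / \<kappa>\<^sup>2"
  have h: "0 < h" using \<sigma> lam0 \<kappa> by (simp add: h_def)
  have Nh: "NN * lam / \<kappa>\<^sup>2 * 41 \<le> h"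
  proof -
    have "41 * (NN * (lam / \<kappa>\<^sup>2)) \<le> 41 * ((2 * \<sigma>) * (lam / \<kappa>\<^sup>2))"
      using Nup lam0 by (intro mult_left_mono mult_right_mono) auto
    moreover have "NN * lam / \<kappa>\<^sup>2 * 41 = 41 * (NN * (lam / \<kappa>\<^sup>2))" by simp
    moreover have "h = 41 * ((2 * \<sigma>) * (lam / \<kappa>\<^sup>2))" by (simp add: h_def)
    ultimately show ?thesis by metis
  qed
  have "D1 \<le> NN * lam / \<kappa>\<^sup>2 * 41 * real s0" using D1b by (simp add: mult_ac)
  also have "\<dots> \<le> h * real s0" using Nh by (intro mult_right_mono) auto
  finally have 1: "D1 \<le> real s0 * h" by (simp add: mult.commute)
  have "0 \<le> NN * lam / \<kappa>\<^sup>2" using NN0 lam0 by simp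
  then have "11 * (NN * lam / \<kappa>\<^sup>2 * sqrt (real s0)) \<le> 41 * (NN * lam / \<kappa>\<^sup>2 * sqrt (real s0))"
    by (intro mult_right_mono mult_nonneg_nonneg[of "NN * lam / \<kappa>\<^sup>2"]) auto
  moreover have "11 * NN * lam * sqrt (real s0) / \<kappa>\<^sup>2 = 11 * (NN * lam / \<kappa>\<^sup>2 * sqrt (real s0))"
    by simp
  ultimately have "D2 \<le> 41 * (NN * lam / \<kappa>\<^sup>2 * sqrt (real s0))"
    using D2b by linarith
  also have "\<dots> = NN * lam / \<kappa>\<^sup>2 * 41 * sqrt (real s0)" by simp
  also have "\<dots> \<le> h * sqrt (real s0)" using Nh by (intro mult_right_mono) auto
  finally have "D2\<^sup>2 \<le> (h * sqrt (real s0))\<^sup>2"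
    using nn by (intro power_mono) auto
  then have 2: "(\<Sum>j<p. (d j)\<^sup>2) \<le> real s0 * h\<^sup>2"
    by (simp add: D2_def sum_nonneg power_mult_distrib mult.commute)
  have "lq_norm p q d \<le> 2 * h * real s0 powr (1 / q)"
    using h s0 q 1 2 unfolding D1_def by (intro lq_norm_le_of_l1_l2) auto
  then show ?thesis by (simp add: d_def h_def lam_def)
qed

section \<open>Adaptive selection of the sparsity\<close>

lemma adapt_M_bounds:
  assumes "1 \<le> x"
  shows "2 ^ adapt_M x \<le> x" "x < 2 ^ (adapt_M x + 1)" "real (adapt_M x) \<le> log 2 (real x)"
proof -
  have nn: "0 \<le> log 2 (real x)" using assms by simp
  then show M: "real (adapt_M x) \<le> log 2 (real x)"
    by (simp add: adapt_M_def)
  have "2 powr real (adapt_M x) \<le> 2 powr log 2 (real x)" using M by (intro powr_mono) auto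
  then have "(2::real) ^ adapt_M x \<le> real x" using assms by (simp add: powr_realpow)
  then show "2 ^ adapt_M x \<le> x" by (metis of_nat_le_iff of_nat_numeral of_nat_power)
  have "log 2 (real x) < real (adapt_M x + 1)"
    using nn by (simp add: adapt_M_def) linarith
  then have "2 powr log 2 (real x) < 2 powr real (adapt_M x + 1)" by (intro powr_less_mono) auto
  then have "real x < 2 ^ (adapt_M x + 1)" using assms by (subst (asm) powr_realpow) auto
  then show "x < 2 ^ (adapt_M x + 1)" by (metis of_nat_less_iff of_nat_numeral of_nat_power)
qed

lemma adapt_M_mono: "1 \<le> x \<Longrightarrow> x \<le> y \<Longrightarrow> adapt_M x \<le> adapt_M y"
  unfolding adapt_M_def by (intro nat_mono floor_mono) simp

definition weight :: "nat \<Rightarrow> nat \<Rightarrow> real \<Rightarrow> real \<Rightarrow> real" where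
  "weight n p q x = x powr (1 / q) * sqrt (1 / real n * ln (2 * real p / x))"

text \<open>
  Halving the sparsity gains a factor of at least \<open>2 powr (1 / 2)\<close>, of which the growth of the
  logarithm takes back less than \<open>sqrt (61 / 36)\<close>. Sums of weights along powers of two are
  therefore dominated by a geometric series.
\<close>

lemma weight_half_le:
  assumes "0 < x" "2 * x * exp 1 \<le> 2 * real p" "0 < q" "q \<le> 2"
  shows "weight n p q x \<le> 19 / 20 * weight n p q (2 * x)"
proof -
  have p: "0 < real p"
    using assms by (cases p) (auto simp: mult_le_0_iff)
  define l where "l = ln (2 * real p / (2 * x))"
  have l: "1 \<le> l" unfolding l_def using assms p by (subst ln_ge_iff) (auto simp: field_simps)
  have "ln (2 * real p / x) = ln 2 + l" unfolding l_def using assms p by (simp add: ln_div ln_mult)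
  then have "ln (2 * real p / x) \<le> 61 / 36 * l" using l ln2_le_25_over_36 by linarith
  then have "1 / real n * ln (2 * real p / x) \<le> 1 / real n * (61 / 36 * l)"
    by (rule mult_left_mono) simp
  then have "sqrt (1 / real n * ln (2 * real p / x)) \<le> sqrt (61 / 36 * (1 / real n * l))"
    by (simp add: mult_ac)
  also have "\<dots> = sqrt (61 / 36) * sqrt (1 / real n * l)" by (rule real_sqrt_mult)
  finally have 1: "sqrt (1 / real n * ln (2 * real p / x)) \<le> sqrt (61 / 36) * sqrt (1 / real n * l)" .
  have "x powr (1 / q) = (2 powr (- (1 / q))) * (2 * x) powr (1 / q)"
    using assms by (simp add: powr_mult powr_minus field_simps)
  also have "\<dots> \<le> 2 powr (- (1 / 2)) * (2 * x) powr (1 / q)"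
    using assms by (intro mult_right_mono powr_mono) (auto simp: field_simps)
  also have "(2::real) powr (- (1 / 2)) = sqrt (1 / 2)"
    by (simp add: powr_minus powr_half_sqrt real_sqrt_divide inverse_eq_divide)
  finally have 2: "x powr (1 / q) \<le> sqrt (1 / 2) * (2 * x) powr (1 / q)" .
  have "sqrt (1 / 2) * sqrt (61 / 36) \<le> sqrt ((19 / 20)\<^sup>2)"
    unfolding real_sqrt_mult[symmetric] by (subst real_sqrt_le_iff) (simp add: power2_eq_square)
  then have 3: "sqrt (1 / 2) * sqrt (61 / 36) \<le> 19 / 20" by simp
  have l0: "0 \<le> 1 / real n * ln (2 * real p / x)"
    using \<open>ln (2 * real p / x) = ln 2 + l\<close> l by (simp add: ln_ge_zero)
  have "weight n p q x \<le> (sqrt (1 / 2) * (2 * x) powr (1 / q)) * (sqrt (61 / 36) * sqrt (1 / real n * l))"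
    unfolding weight_def using l0 by (intro mult_mono 1 2) auto
  also have "\<dots> = (sqrt (1 / 2) * sqrt (61 / 36)) * weight n p q (2 * x)"
    by (simp add: weight_def l_def)
  also have "\<dots> \<le> 19 / 20 * weight n p q (2 * x)"
    using l by (intro mult_right_mono 3) (auto simp: weight_def l_def)
  finally show ?thesis .
qed

text \<open>
  Convexity of \<open>x powr q\<close> including the end point \<open>x = 0\<close>.
\<close>

lemma convex_combination_powr_le:
  fixes x y t q :: real
  assumes "0 \<le> x" "0 \<le> y" "0 \<le> t" "t \<le> 1" "1 \<le> q"
  shows "(t * x + (1 - t) * y) powr q \<le> t * x powr q + (1 - t) * y powr q"
proof -
  have shrink: "(r * z) powr q \<le> r * z powr q" if "0 \<le> r" "r \<le> 1" "0 \<le> z" for r z :: real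
  proof (cases "r = 0")
    case False
    have "(r * z) powr q = r powr q * z powr q" using that by (simp add: powr_mult)
    also have "\<dots> \<le> r powr 1 * z powr q"
      using that assms False by (intro mult_right_mono powr_mono') auto
    finally show ?thesis using that by simp
  qed simp
  consider "x = 0" | "y = 0" | "0 < x" "0 < y" using assms by linarith
  then show ?thesis
  proof cases
    case 3
    have "(t *\<^sub>R x + (1 - t) *\<^sub>R y) powr q \<le> t * x powr q + (1 - t) * y powr q"
      using convex_onD[OF powr_convex[OF assms(5)], of "1 - t" x y] 3 assms by (simp add: algebra_simps)
    then show ?thesis by simp
  qed (use shrink[of "1 - t" y] shrink[of t x] assms in auto)
qed

text \<open>
  Minkowski's inequality, from convexity at the normalised vectors \<open>|u| / A\<close> and \<open>|v| / B\<close>.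
\<close>

lemma lq_norm_triangle:
  assumes "1 \<le> q"
  shows "lq_norm p q (\<lambda>j. u j + v j) \<le> lq_norm p q u + lq_norm p q v"
proof -
  \<comment> \<open>A vector of norm zero vanishes and must be excluded before normalising.\<close>
  have zero: "lq_norm p q (\<lambda>j. u j + v j) \<le> lq_norm p q u + lq_norm p q v"
    if z: "(\<Sum>j<p. \<bar>u j\<bar> powr q) = 0" for u v :: "nat \<Rightarrow> real"
  proof -
    have "\<forall>j<p. u j = 0" using z by (subst (asm) sum_nonneg_eq_0_iff) auto
    then have "lq_norm p q (\<lambda>j. u j + v j) = lq_norm p q v" by (simp add: lq_norm_def)
    then show ?thesis by (simp add: lq_norm_def)
  qed
  show ?thesis
  proof (cases "(\<Sum>j<p. \<bar>u j\<bar> powr q) = 0 \<or> (\<Sum>j<p. \<bar>v j\<bar> powr q) = 0")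
    case True
    then show ?thesis using zero[of u v] zero[of v u] by (auto simp: add.commute)
  next
    case False
    define A where "A = lq_norm p q u"
    define B where "B = lq_norm p q v"
    have A: "0 < A" "(\<Sum>j<p. \<bar>u j\<bar> powr q) = A powr q"
      and B: "0 < B" "(\<Sum>j<p. \<bar>v j\<bar> powr q) = B powr q"
      using False assms by (auto simp: A_def B_def lq_norm_def powr_powr sum_nonneg)
    define t where "t = A / (A + B)"
    have t: "0 \<le> t" "t \<le> 1" "1 - t = B / (A + B)" using A B by (auto simp: t_def field_simps)
    have pt: "\<bar>u j + v j\<bar> powr q
        \<le> (A + B) powr q * (t * (\<bar>u j\<bar> powr q / A powr q) + (1 - t) * (\<bar>v j\<bar> powr q / B powr q))" for j
    proof -
      have "(A + B) * (t * (\<bar>u j\<bar> / A) + (1 - t) * (\<bar>v j\<bar> / B))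
          = ((A + B) * t) * (\<bar>u j\<bar> / A) + ((A + B) * (1 - t)) * (\<bar>v j\<bar> / B)"
        by (simp add: distrib_left)
      also have "\<dots> = A * (\<bar>u j\<bar> / A) + B * (\<bar>v j\<bar> / B)"
        unfolding t(3) using A B by (simp add: t_def)
      also have "\<dots> = \<bar>u j\<bar> + \<bar>v j\<bar>" using A B by simp
      finally have "\<bar>u j + v j\<bar> \<le> (A + B) * (t * (\<bar>u j\<bar> / A) + (1 - t) * (\<bar>v j\<bar> / B))"
        by (simp add: abs_triangle_ineq)
      then have "\<bar>u j + v j\<bar> powr q \<le> ((A + B) * (t * (\<bar>u j\<bar> / A) + (1 - t) * (\<bar>v j\<bar> / B))) powr q"
        using assms by (intro powr_mono2) auto
      also have "\<dots> = (A + B) powr q * (t * (\<bar>u j\<bar> / A) + (1 - t) * (\<bar>v j\<bar> / B)) powr q"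
        by (rule powr_mult)
      also have "\<dots> \<le> (A + B) powr q * (t * (\<bar>u j\<bar> / A) powr q + (1 - t) * (\<bar>v j\<bar> / B) powr q)"
        using A B t assms by (intro mult_left_mono convex_combination_powr_le) auto
      finally show ?thesis using A B by (simp add: powr_divide)
    qed
    have "(\<Sum>j<p. \<bar>u j + v j\<bar> powr q)
        \<le> (\<Sum>j<p. (A + B) powr q * (t * (\<bar>u j\<bar> powr q / A powr q) + (1 - t) * (\<bar>v j\<bar> powr q / B powr q)))"
      by (intro sum_mono pt)
    also have "\<dots> = (A + B) powr q * (t * ((\<Sum>j<p. \<bar>u j\<bar> powr q) / A powr q)
        + (1 - t) * ((\<Sum>j<p. \<bar>v j\<bar> powr q) / B powr q))"
      unfolding sum_divide_distrib sum_distrib_left sum.distrib[symmetric] ..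
    also have "\<dots> = (A + B) powr q" unfolding A(2) B(2) using A B by simp
    finally have "lq_norm p q (\<lambda>j. u j + v j) \<le> ((A + B) powr q) powr (1 / q)"
      unfolding lq_norm_def using assms by (intro powr_mono2) (auto intro: sum_nonneg)
    also have "\<dots> = A + B" using A B assms by (simp add: powr_powr)
    finally show ?thesis by (simp add: A_def B_def)
  qed
qed

lemma lq_norm_vsub_triangle:
  assumes "1 \<le> q"
  shows "lq_norm p q (vsub u w) \<le> lq_norm p q (vsub u v) + lq_norm p q (vsub v w)"
  using lq_norm_triangle[OF assms, of p "vsub u v" "vsub v w"] by (simp add: vsub_def)

lemma lq_norm_vsub_commute: "lq_norm p q (vsub u v) = lq_norm p q (vsub v u)"
  by (simp add: lq_norm_def vsub_def abs_minus_commute)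

lemma lq_norm_vsub_self: "lq_norm p q (vsub u u) = 0"
  by (simp add: lq_norm_def vsub_def)

text \<open>
  Lepski's argument. If all members of the family from level \<open>m - 1\<close> on are within
  \<open>K \<sigma> w\<close> of the truth, then consecutive ones are close enough to pass the test, so that
  the procedure stops at a level at most \<open>m\<close>. The comparisons that it passed between its own
  level and \<open>m\<close> sum to a geometric series dominated by its last term. With ratio \<open>19 / 20\<close> the
  series is at most \<open>20\<close> times that term, and each comparison costs \<open>4 (3 \<sigma>) K w\<close>: hence \<open>240\<close>,
  plus \<open>1\<close> for the error of the estimator at level \<open>m\<close>.
\<close>

lemma adaptive_selection_bound:
  fixes d :: "(nat \<Rightarrow> real) \<Rightarrow> (nat \<Rightarrow> real) \<Rightarrow> real"
  assumes d_tri: "\<And>u v w. d u w \<le> d u v + d v w" and d_comm: "\<And>u v. d u v = d v u"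
    and d_self: "\<And>u. d u u = 0"
    and m: "1 \<le> m" "m \<le> adapt_M t" and K: "0 \<le> K" "0 < \<sigma>"
    and err: "\<And>k. m - 1 \<le> k \<Longrightarrow> k \<le> adapt_M t \<Longrightarrow> d (B (2 ^ k) y) b \<le> K * \<sigma> * w (2 ^ k)"
    and w: "\<And>k. 1 \<le> k \<Longrightarrow> k \<le> adapt_M t \<Longrightarrow> w (2 ^ (k - 1)) \<le> 19 / 20 * w (2 ^ k)"
    and w_nonneg: "\<And>k. k \<le> adapt_M t \<Longrightarrow> 0 \<le> w (2 ^ k)"
    and sig: "\<sigma> / 2 \<le> adapt_sigma_hat n p X t B y" "adapt_sigma_hat n p X t B y \<le> 3 * \<sigma>"
  shows "adapt_s n p X t d w K B y \<le> 2 ^ m"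
    and "d (adapt_beta n p X t d w K B y) b \<le> 241 * (K * \<sigma> * w (2 ^ m))"
proof -
  let ?S = "adapt_S1 n p X t d w K B y"
  let ?sh = "adapt_sigma_hat n p X t B y"
  define mt where "mt = adapt_m n p X t d w K B y"
  have "m \<in> ?S"
    unfolding adapt_S1_def
  proof (safe, goal_cases)
    case 1 show ?case using m by simp
  next
    case (2 k)
    then have k: "1 \<le> k" "k \<le> adapt_M t" "m \<le> k" using m by auto
    have "d (B (2 ^ (k - 1)) y) (B (2 ^ k) y) \<le> d (B (2 ^ (k - 1)) y) b + d (B (2 ^ k) y) b"
      using d_tri[of "B (2 ^ (k - 1)) y" "B (2 ^ k) y" b] d_comm[of b] by simp
    also have "\<dots> \<le> K * \<sigma> * w (2 ^ (k - 1)) + K * \<sigma> * w (2 ^ k)"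
      using k by (intro add_mono err) auto
    also have "\<dots> \<le> K * \<sigma> * w (2 ^ k) + K * \<sigma> * w (2 ^ k)"
      using w[of k] w_nonneg[of k] k K by (intro add_right_mono mult_left_mono) auto
    also have "\<dots> = 4 * (\<sigma> / 2) * (K * w (2 ^ k))" by simp
    also have "\<dots> \<le> 4 * ?sh * (K * w (2 ^ k))"
      using sig(1) K w_nonneg[of k] k by (intro mult_right_mono mult_left_mono) auto
    finally show ?case by (simp add: mult.assoc)
  qed
  have fin: "finite ?S" by (rule finite_subset[of _ "{1..adapt_M t}"]) (auto simp: adapt_S1_def)
  have mt: "mt = Min ?S" using \<open>m \<in> ?S\<close> by (auto simp: mt_def adapt_m_def)
  have "mt \<le> m" unfolding mt using fin \<open>m \<in> ?S\<close> by (rule Min_le)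
  then show "adapt_s n p X t d w K B y \<le> 2 ^ m"
    by (simp add: adapt_s_def flip: mt_def)
  have "mt \<in> ?S" unfolding mt using fin \<open>m \<in> ?S\<close> by (intro Min_in) auto
  then have jump: "d (B (2 ^ (k - 1)) y) (B (2 ^ k) y) \<le> 4 * ?sh * K * w (2 ^ k)"
    if "mt \<le> k" "k \<le> adapt_M t" for k
    using that unfolding adapt_S1_def by auto
  have "d (B (2 ^ mt) y) (B (2 ^ j) y) \<le> 240 * (K * \<sigma> * w (2 ^ j))" if "mt \<le> j" "j \<le> m" for j
    using that
  proof (induction j rule: dec_induct)
    case base
    then show ?case using d_self K w_nonneg[of mt] \<open>mt \<le> m\<close> m by simp
  next
    case (step j)
    have j: "Suc j \<le> adapt_M t" using step m by simp
    have "d (B (2 ^ mt) y) (B (2 ^ Suc j) y) \<le> d (B (2 ^ mt) y) (B (2 ^ j) y) + d (B (2 ^ j) y) (B (2 ^ Suc j) y)"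
      by (rule d_tri)
    also have "\<dots> \<le> 240 * (K * \<sigma> * w (2 ^ j)) + 4 * ?sh * K * w (2 ^ Suc j)"
      using step jump[of "Suc j"] j by (intro add_mono) auto
    also have "4 * ?sh * K * w (2 ^ Suc j) \<le> 4 * (3 * \<sigma>) * K * w (2 ^ Suc j)"
      using sig(2) K w_nonneg[OF j] by (intro mult_right_mono mult_left_mono) auto
    also have "K * \<sigma> * w (2 ^ j) \<le> K * \<sigma> * (19 / 20 * w (2 ^ Suc j))"
      using w[of "Suc j"] j K by (intro mult_left_mono) auto
    finally show ?case by simp
  qed
  from this[OF \<open>mt \<le> m\<close> order_refl]
  have "d (B (2 ^ mt) y) (B (2 ^ m) y) \<le> 240 * (K * \<sigma> * w (2 ^ m))" .
  moreover have "d (B (2 ^ m) y) b \<le> K * \<sigma> * w (2 ^ m)" using m by (intro err) auto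
  ultimately show "d (adapt_beta n p X t d w K B y) b \<le> 241 * (K * \<sigma> * w (2 ^ m))"
    using d_tri[of "B (2 ^ mt) y" b "B (2 ^ m) y"] by (simp add: adapt_beta_def adapt_s_def flip: mt_def)
qed

text \<open>
  Monotonicity of \<open>x log (8 p / x)\<close> transfers the smallness assumption from \<open>t\<close> to the true
  sparsity \<open>s\<close> and a tuning \<open>s' \<ge> s / 4\<close>; the constant comes from \<open>log (8 p / t) \<le> 4 log (p / t)\<close>,
  a consequence of \<open>t \<le> p / e\<close>.
\<close>

lemma sql_lambda_small:
  fixes \<kappa> \<gamma> :: real
  assumes \<gamma>: "0 < \<gamma>" and s: "1 \<le> s" "s \<le> t" "real s \<le> 4 * real s'" and t: "real t * exp 1 \<le> real p"
    and hyp: "2 * real t / real n * ln (real p / real t) \<le> 9 * \<kappa>\<^sup>2 / (256 * \<gamma>\<^sup>2)"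
    and l: "0 \<le> ln (2 * real p / real s')"
  shows "(sql_lambda n p s' \<gamma>)\<^sup>2 * real s \<le> \<kappa>\<^sup>2 / 2"
proof -
  have pos: "0 < real s" "0 < real t" "0 < real s'" using s by auto
  have p: "0 < real p" using pos t by (cases p) (auto simp: mult_le_0_iff)
  have lt: "1 \<le> ln (real p / real t)" using pos p t by (subst ln_ge_iff) (auto simp: field_simps)
  have "ln (8 * real p / real t) = 3 * ln 2 + ln (real p / real t)"
    using p pos ln_realpow[of 2 3] by (simp add: ln_div ln_mult)
  then have l8: "ln (8 * real p / real t) \<le> 4 * ln (real p / real t)"
    using lt ln2_le_25_over_36 by linarith
  have "ln (2 * real p / real s') \<le> ln (8 * real p / real s)"
    using pos p s by (subst ln_le_cancel_iff) (auto simp: field_simps)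
  then have "real s * ln (2 * real p / real s') \<le> real s * ln (8 * real p / real s)"
    using pos by (intro mult_left_mono) auto
  also have "\<dots> \<le> real t * ln (8 * real p / real t)"
    using pos s t p by (intro mult_ln_mono) auto
  also have "\<dots> \<le> real t * (4 * ln (real p / real t))" using l8 pos by (intro mult_left_mono) auto
  finally have "real s * ln (2 * real p / real s') / real n \<le> real t * (4 * ln (real p / real t)) / real n"
    by (rule divide_right_mono) simp
  also have "\<dots> = 2 * (2 * real t / real n * ln (real p / real t))" by simp
  also have "\<dots> \<le> 2 * (9 * \<kappa>\<^sup>2 / (256 * \<gamma>\<^sup>2))" using hyp by simp
  finally have "\<gamma>\<^sup>2 * (real s * ln (2 * real p / real s') / real n) \<le> \<gamma>\<^sup>2 * (2 * (9 * \<kappa>\<^sup>2 / (256 * \<gamma>\<^sup>2)))"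
    by (rule mult_left_mono) simp
  also have "\<dots> = 18 / 256 * \<kappa>\<^sup>2" using \<gamma> by (simp add: field_simps)
  also have "\<dots> \<le> \<kappa>\<^sup>2 / 2" using zero_le_power2[of \<kappa>] by linarith
  finally show ?thesis
    using l by (simp add: sql_lambda_def power_mult_distrib mult_ac)
qed

text \<open>
  The critical level \<open>m\<close> is the largest one with \<open>2 ^ m \<le> max 2 s\<close>. The selection rule also
  inspects level \<open>m - 1\<close>, whose tuning can be smaller than the true sparsity, but by a factor of
  at most 4; this is the factor lost in \<open>656 = 4 * 164\<close>. The noise level used for \<open>2 ^ k\<close> is
  \<open>max s (2 ^ k)\<close>.
\<close>

lemma adaptive_estimator_on_good_event:
  fixes n p t s :: nat and \<kappa> \<gamma> \<sigma> q :: real and B :: "nat \<Rightarrow> (nat \<Rightarrow> real) \<Rightarrow> nat \<Rightarrow> real"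
  defines "K \<equiv> 656 * \<gamma> / \<kappa>\<^sup>2 + 1"
  defines "d \<equiv> \<lambda>u v. lq_norm p q (vsub u v)"
  assumes n: "0 < n" and \<sigma>: "0 < \<sigma>" and \<gamma>: "16 + 4 * sqrt 2 \<le> \<gamma>" and q: "1 \<le> q" "q \<le> 2"
    and t: "2 \<le> t" "real t * exp 1 \<le> real p"
    and \<kappa>: "\<kappa> = kappa n p X (2 * t) (5/3)" "0 < \<kappa>" "\<kappa> \<le> 1"
    and hyp: "2 * real t / real n * ln (real p / real t) \<le> 9 * \<kappa>\<^sup>2 / (256 * \<gamma>\<^sup>2)"
    and s: "1 \<le> s" "s \<le> t" and b: "l0_norm p b \<le> s"
    and e: "e = vsub y (matvec n p X b)"
    and N: "real n * \<sigma>\<^sup>2 / 2 \<le> (\<Sum>i<n. (e i)\<^sup>2)" "(\<Sum>i<n. (e i)\<^sup>2) \<le> 4 * (real n * \<sigma>\<^sup>2)"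
    and noise: "\<And>k d. k \<le> adapt_M t \<Longrightarrow>
      ip n e (lincomb p X d) \<le> sqrt (real n * (16 * \<sigma>\<^sup>2 * ln (2 * real p / real (max s (2 ^ k))))) * (\<Sum>j<p. \<bar>d j\<bar>)
      + 2 * sqrt (real (max s (2 ^ k)) * (16 * \<sigma>\<^sup>2 * ln (2 * real p / real (max s (2 ^ k))))) * sqrt (ip n (lincomb p X d) (lincomb p X d))"
    and min: "\<And>k. k \<le> adapt_M t \<Longrightarrow> sql_objective n p X (2 ^ k) \<gamma> y (B (2 ^ k) y) \<le> sql_objective n p X (2 ^ k) \<gamma> y b"
    and sig: "\<sigma> / 2 \<le> adapt_sigma_hat n p X t B y" "adapt_sigma_hat n p X t B y \<le> 3 * \<sigma>"
  shows "adapt_s n p X t d (weight n p q) K B y \<le> max 2 s"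
    and "lq_norm p q (vsub (adapt_beta n p X t d (weight n p q) K B y) b)
      \<le> 1000 * K * \<sigma> * real s powr (1 / q) * sqrt (1 / real n * ln (real p / real s))"
proof -
  define m where "m = adapt_M (max 2 s)"
  have \<gamma>0: "0 < \<gamma>" using \<gamma> by (rule less_le_trans[rotated]) (simp add: add_pos_pos)
  have K: "0 \<le> K" using \<gamma>0 by (simp add: K_def)
  have pos: "0 < real s" "0 < real t" using s t by auto
  have "real t * 1 \<le> real t * exp 1" using pos by (intro mult_left_mono) auto
  then have tp: "t \<le> p" using t by linarith
  have p: "0 < real p" using tp t by simp
  have m: "2 ^ m \<le> max 2 s" "max 2 s < 2 ^ (m + 1)"
    unfolding m_def using adapt_M_bounds[of "max 2 s"] by auto
  have m1: "1 \<le> m" using m(2) by (cases m) auto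
  have mM: "m \<le> adapt_M t" unfolding m_def using s t by (intro adapt_M_mono) auto
  have Mt: "2 ^ adapt_M t \<le> t" using adapt_M_bounds[of t] t by simp
  have kt: "2 ^ k \<le> t" if "k \<le> adapt_M t" for k
    by (rule order_trans[OF power_increasing[OF that] Mt]) simp
  have kt': "(2::real) ^ k \<le> real t" if "k \<le> adapt_M t" for k
    using of_nat_mono[OF kt[OF that], where 'a = real] by simp
  have ln1: "1 \<le> ln (2 * real p / x)" if "0 < x" "x \<le> real t" for x :: real
  proof -
    have "x * exp 1 \<le> real t * exp 1" using that by (intro mult_right_mono) auto
    then have "x * exp 1 \<le> 2 * real p" using t(2) p by linarith
    then show ?thesis using that p by (subst ln_ge_iff) (auto simp: pos_le_divide_eq mult.commute)
  qed
  have wnn: "0 \<le> weight n p q (2 ^ k)" if "k \<le> adapt_M t" for k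
    using ln1[of "2 ^ k"] kt'[OF that] by (simp add: weight_def)
  have err: "d (B (2 ^ k) y) b \<le> K * \<sigma> * weight n p q (2 ^ k)" if k: "m - 1 \<le> k" "k \<le> adapt_M t" for k
  proof -
    have "max 2 s < 2 ^ (m + 1)" by (rule m)
    also have "(2::nat) ^ (m + 1) \<le> 2 ^ (k + 2)" using k by (intro power_increasing) auto
    finally have s4: "max s (2 ^ k) \<le> 4 * 2 ^ k" by simp
    then have s4r: "real (max s (2 ^ k)) \<le> 4 * 2 ^ k"
      using of_nat_mono[OF s4, where 'a = real] by simp
    have l: "0 \<le> ln (2 * real p / real (2 ^ k))" using ln1[of "2 ^ k"] kt'[OF k(2)] by simp
    have small: "(sql_lambda n p (2 ^ k) \<gamma>)\<^sup>2 * real s \<le> \<kappa>\<^sup>2 / 2"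
      using s4r by (intro sql_lambda_small[OF \<gamma>0 s _ t(2) hyp l]) simp
    have lam0: "0 \<le> sql_lambda n p (2 ^ k) \<gamma>" using l \<gamma>0 by (simp add: sql_lambda_def)
    have "d (B (2 ^ k) y) b \<le> 164 * \<sigma> * sql_lambda n p (2 ^ k) \<gamma> / \<kappa>\<^sup>2 * real (max s (2 ^ k)) powr (1 / q)"
      unfolding d_def
    proof (rule sql_lq_error_bound[OF n _ \<sigma> \<gamma> q \<kappa> _ _ _ _ _ small b noise[OF k(2)] e N min[OF k(2)]])
      show "0 < p" using p by simp
      show "max s (2 ^ k) \<le> t" using s kt[OF k(2)] by simp
      show "t < 2 * p" using tp p by simp
    qed auto
    also have "\<dots> \<le> 164 * \<sigma> * sql_lambda n p (2 ^ k) \<gamma> / \<kappa>\<^sup>2 * (4 * (2 ^ k) powr (1 / q))"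
    proof (rule mult_left_mono)
      have "real (max s (2 ^ k)) powr (1 / q) \<le> (4 * 2 ^ k) powr (1 / q)"
        using s4r q by (intro powr_mono2) auto
      also have "\<dots> = 4 powr (1 / q) * (2 ^ k) powr (1 / q)" by (rule powr_mult)
      also have "\<dots> \<le> 4 powr 1 * (2 ^ k) powr (1 / q)"
        using q by (intro mult_right_mono powr_mono) auto
      finally show "real (max s (2 ^ k)) powr (1 / q) \<le> 4 * (2 ^ k) powr (1 / q)" by simp
    qed (use lam0 \<sigma> in auto)
    also have "\<dots> = 656 * \<gamma> / \<kappa>\<^sup>2 * (\<sigma> * weight n p q (2 ^ k))"
      by (simp add: sql_lambda_def weight_def)
    also have "\<dots> \<le> K * (\<sigma> * weight n p q (2 ^ k))"
      using wnn[OF k(2)] \<sigma> by (intro mult_right_mono) (auto simp: K_def)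
    finally show ?thesis by simp
  qed
  have w: "weight n p q (2 ^ (k - 1)) \<le> 19 / 20 * weight n p q (2 ^ k)" if k: "1 \<le> k" "k \<le> adapt_M t" for k
  proof -
    have two: "2 * 2 ^ (k - 1) = (2::real) ^ k" using k by (cases k) auto
    have "(2::real) ^ k * exp 1 \<le> real t * exp 1" using kt'[OF k(2)] by (intro mult_right_mono) auto
    then have "2 * 2 ^ (k - 1) * exp 1 \<le> 2 * real p" unfolding two using t(2) p by linarith
    from weight_half_le[OF _ this, of q n] q show ?thesis unfolding two by simp
  qed
  have d_tri: "d u w \<le> d u v + d v w" for u v w
    unfolding d_def by (rule lq_norm_vsub_triangle[OF q(1)])
  have d_comm: "d u v = d v u" for u v
    unfolding d_def by (rule lq_norm_vsub_commute)
  have d_self: "d u u = 0" for u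
    unfolding d_def by (rule lq_norm_vsub_self)
  note sel = adaptive_selection_bound[where d = d and B = B and y = y and b = b and m = m and t = t and K = K
      and \<sigma> = \<sigma> and w = "weight n p q" and n = n and p = p and X = X,
      OF d_tri d_comm d_self m1 mM K \<sigma> err w wnn sig]
  have "adapt_s n p X t d (weight n p q) K B y \<le> 2 ^ m"
    by (rule sel(1))
  also note m(1)
  finally show "adapt_s n p X t d (weight n p q) K B y \<le> max 2 s" .
  have "d (adapt_beta n p X t d (weight n p q) K B y) b \<le> 241 * (K * \<sigma> * weight n p q (2 ^ m))"
    by (rule sel(2))
  also have "\<dots> \<le> 241 * (K * \<sigma> * (4 * (real s powr (1 / q) * sqrt (1 / real n * ln (real p / real s)))))"
  proof -
    have "2 ^ m \<le> 2 * s" using m(1) s by simp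
    from of_nat_mono[OF this, where 'a = real] have m2: "(2::real) ^ m \<le> 2 * real s" by simp
    have "s \<le> 2 * 2 ^ m" using m(2) by simp
    from of_nat_mono[OF this, where 'a = real] have m3: "real s \<le> 2 * 2 ^ m" by simp
    have "real s * exp 1 \<le> real t * exp 1" using s by (intro mult_right_mono) auto
    then have "real s * exp 1 \<le> real p" using t(2) by linarith
    then have l1: "1 \<le> ln (real p / real s)"
      using pos p by (subst ln_ge_iff) (auto simp: pos_le_divide_eq mult.commute)
    have "ln (2 * real p / 2 ^ m) \<le> ln (4 * real p / real s)"
      using m3 pos p by (subst ln_le_cancel_iff) (auto simp: field_simps)
    also have "\<dots> = 2 * ln 2 + ln (real p / real s)"
      using p pos ln_realpow[of 2 2] by (simp add: ln_div ln_mult)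
    also have "\<dots> \<le> 4 * ln (real p / real s)" using l1 ln2_le_25_over_36 by linarith
    finally have "1 / real n * ln (2 * real p / 2 ^ m) \<le> 1 / real n * (4 * ln (real p / real s))"
      by (rule mult_left_mono) simp
    then have "sqrt (1 / real n * ln (2 * real p / 2 ^ m)) \<le> sqrt (2\<^sup>2 * (1 / real n * ln (real p / real s)))"
      by (simp add: mult_ac)
    also have "\<dots> = 2 * sqrt (1 / real n * ln (real p / real s))"
      unfolding real_sqrt_mult by simp
    finally have 1: "sqrt (1 / real n * ln (2 * real p / 2 ^ m)) \<le> 2 * sqrt (1 / real n * ln (real p / real s))" .
    have "(2 ^ m) powr (1 / q) \<le> (2 * real s) powr (1 / q)" using m2 q by (intro powr_mono2) auto
    also have "\<dots> = 2 powr (1 / q) * real s powr (1 / q)" by (rule powr_mult)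
    also have "\<dots> \<le> 2 powr 1 * real s powr (1 / q)" using q by (intro mult_right_mono powr_mono) auto
    finally have 2: "(2 ^ m) powr (1 / q) \<le> 2 * real s powr (1 / q)" by simp
    have "weight n p q (2 ^ m) \<le> (2 * real s powr (1 / q)) * (2 * sqrt (1 / real n * ln (real p / real s)))"
      unfolding weight_def using ln1[of "2 ^ m"] kt'[OF mM] by (intro mult_mono 1 2) auto
    also have "\<dots> = 4 * (real s powr (1 / q) * sqrt (1 / real n * ln (real p / real s)))" by simp
    finally show ?thesis using K \<sigma> by (intro mult_left_mono) auto
  qed
  also have "\<dots> \<le> 1000 * (K * \<sigma> * (real s powr (1 / q) * sqrt (1 / real n * ln (real p / real s))))"
  proof -
    have "real s * 1 \<le> real s * exp 1" "real s * exp 1 \<le> real t * exp 1"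
      using s by (auto intro!: mult_left_mono mult_right_mono)
    then have "real s \<le> real p" using t(2) by linarith
    then have "0 \<le> ln (real p / real s)" using pos by (intro ln_ge_zero) (simp add: pos_le_divide_eq)
    then have "0 \<le> K * \<sigma> * (real s powr (1 / q) * sqrt (1 / real n * ln (real p / real s)))"
      using K \<sigma> by simp
    then show ?thesis by simp
  qed
  finally show "lq_norm p q (vsub (adapt_beta n p X t d (weight n p q) K B y) b)
      \<le> 1000 * K * \<sigma> * real s powr (1 / q) * sqrt (1 / real n * ln (real p / real s))"
    by (simp add: d_def mult_ac)
qed

text \<open>
  The residual norm of an estimator with small prediction error is comparable to \<open>\<sigma>\<close>: the lower
  bound \<open>\<sigma> / \<surd>2\<close> on the noise exceeds \<open>\<sigma> / 2\<close> by exactly the allowed prediction error.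
\<close>

lemma sigma_hat_bounds:
  fixes \<sigma> :: real
  assumes N: "0 < n" "0 < \<sigma>" and e: "e = vsub y (matvec n p X b)"
    and lo: "real n * \<sigma>\<^sup>2 / 2 \<le> (\<Sum>i<n. (e i)\<^sup>2)" and up: "(\<Sum>i<n. (e i)\<^sup>2) \<le> 4 * (real n * \<sigma>\<^sup>2)"
    and pred: "emp_norm n (matvec n p X (vsub bh b)) \<le> \<sigma> * (1 / sqrt 2 - 1 / 2)"
  shows "\<sigma> / 2 \<le> emp_norm n (vsub y (matvec n p X bh))" "emp_norm n (vsub y (matvec n p X bh)) \<le> 3 * \<sigma>"
proof -
  define r where "r = vsub y (matvec n p X bh)"
  define v where "v = matvec n p X (vsub bh b)"
  have ri: "e i = r i + v i" if "i < n" for i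
    using that by (simp add: e r_def v_def vsub_def matvec_def algebra_simps sum_subtractf)
  have cong: "emp_norm n u = emp_norm n u'" if "\<And>i. i < n \<Longrightarrow> u i = u' i" for u u'
    using that by (simp add: emp_norm_def)
  have "emp_norm n e = emp_norm n (\<lambda>i. r i + v i)" using ri by (intro cong) auto
  also have "\<dots> \<le> emp_norm n r + emp_norm n v" by (rule emp_norm_triangle)
  finally have 1: "emp_norm n e \<le> emp_norm n r + emp_norm n v" .
  have "emp_norm n r = emp_norm n (\<lambda>i. e i + - v i)" using ri by (intro cong) auto
  also have "\<dots> \<le> emp_norm n e + emp_norm n (\<lambda>i. - v i)" by (rule emp_norm_triangle)
  also have "emp_norm n (\<lambda>i. - v i) = emp_norm n v" by (simp add: emp_norm_def)
  finally have 2: "emp_norm n r \<le> emp_norm n e + emp_norm n v" .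
  have sq: "(emp_norm n e)\<^sup>2 = (\<Sum>i<n. (e i)\<^sup>2) / real n"
    unfolding emp_norm_def by (simp add: sum_nonneg)
  have "(\<sigma> / sqrt 2)\<^sup>2 \<le> (emp_norm n e)\<^sup>2" "(emp_norm n e)\<^sup>2 \<le> (2 * \<sigma>)\<^sup>2"
    unfolding sq using lo up N by (auto simp: power_divide power_mult_distrib field_simps)
  then have 3: "\<sigma> / sqrt 2 \<le> emp_norm n e" "emp_norm n e \<le> 2 * \<sigma>"
    using N by (auto intro: power2_le_imp_le simp: emp_norm_nonneg)
  have 4: "emp_norm n v \<le> \<sigma> / sqrt 2 - \<sigma> / 2"
    using pred by (simp add: v_def right_diff_distrib)
  show "\<sigma> / 2 \<le> emp_norm n (vsub y (matvec n p X bh))"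
    using 1 3(1) 4 by (simp flip: r_def)
  have "1 \<le> sqrt 2" by simp
  then have "\<sigma> / sqrt 2 \<le> \<sigma> / 1" using N by (intro divide_left_mono) auto
  then show "emp_norm n (vsub y (matvec n p X bh)) \<le> 3 * \<sigma>"
    using 2 3(2) 4 N by (simp flip: r_def)
qed

text \<open>
  The second part of the smallness assumption is what makes the prediction bound of the pilot
  estimator, from which the noise level is estimated, smaller than the gap in the preceding lemma.
\<close>

lemma pilot_prediction_radius:
  fixes C \<kappa> \<kappa>' \<sigma> :: real
  assumes "0 < n" "0 < C" "0 < \<kappa>" "\<kappa> \<le> \<kappa>'" "0 < \<sigma>"
    and S: "0 < S" "S \<le> 2 * t" "real t * exp 1 \<le> real p"
    and hyp: "2 * real t / real n * ln (real p / real t) \<le> \<kappa> ^ 4 / (2 * C\<^sup>2) * (1 / sqrt 2 - 1 / 2)\<^sup>2"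
  shows "C / \<kappa>'\<^sup>2 * \<sigma> * sqrt (real S / real n * ln (real p / real S)) \<le> \<sigma> * (1 / sqrt 2 - 1 / 2)"
proof -
  define c :: real where "c = 1 / sqrt 2 - 1 / 2"
  have "sqrt 2 \<le> sqrt (2\<^sup>2)" by (subst real_sqrt_le_iff) simp
  then have c: "0 \<le> c" by (simp add: c_def field_simps)
  have pos: "0 < real S" "0 < real t" using S by auto
  have p: "0 < real p" using pos S(3) by (cases p) (auto simp: mult_le_0_iff)
  have "real S * ln (real p / real S) \<le> real S * ln (2 * real p / real S)"
    using pos p by (intro mult_left_mono) (auto simp: divide_le_cancel)
  also have "\<dots> \<le> real (2 * t) * ln (2 * real p / real (2 * t))"
    using pos S by (intro mult_ln_mono) auto
  also have "\<dots> = 2 * real t * ln (real p / real t)" by simp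
  finally have "real S * ln (real p / real S) / real n \<le> 2 * real t * ln (real p / real t) / real n"
    by (rule divide_right_mono) simp
  then have "real S / real n * ln (real p / real S) \<le> (\<kappa>\<^sup>2 / (sqrt 2 * C) * c)\<^sup>2"
    using hyp by (simp add: power_mult_distrib power_divide c_def)
  then have "sqrt (real S / real n * ln (real p / real S)) \<le> \<kappa>\<^sup>2 / (sqrt 2 * C) * c"
    using c assms by (intro real_le_lsqrt) auto
  moreover have "C / \<kappa>'\<^sup>2 \<le> C / \<kappa>\<^sup>2"
    using assms by (intro divide_left_mono power_mono) auto
  moreover have "0 \<le> sqrt (real S / real n * ln (real p / real S))"
  proof -
    have "real S \<le> real t * 2" using S(2) by linarith
    also have "\<dots> \<le> real t * exp 1" using exp_ge_add_one_self[of 1] by (intro mult_left_mono) auto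
    also note S(3)
    finally show ?thesis using pos by (simp add: pos_le_divide_eq)
  qed
  ultimately have "C / \<kappa>'\<^sup>2 * \<sigma> * sqrt (real S / real n * ln (real p / real S))
     \<le> C / \<kappa>\<^sup>2 * \<sigma> * (\<kappa>\<^sup>2 / (sqrt 2 * C) * c)"
    using assms c pos by (intro mult_mono) auto
  also have "\<dots> = \<sigma> * c / sqrt 2" using assms by simp
  also have "\<dots> \<le> \<sigma> * c / 1" using assms c by (intro divide_left_mono) auto
  finally show ?thesis by (simp add: c_def)
qed

section \<open>Measurability of the adaptive procedure\<close>

lemma measurable_lq_norm_vsub:
  assumes [measurable]: "f \<in> measurable M (Rn p)" "g \<in> measurable M (Rn p)"
  shows "(\<lambda>y. lq_norm p q (vsub (f y) (g y))) \<in> borel_measurable M"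
  unfolding lq_norm_def vsub_def by measurable

lemma measurable_residual_norm:
  assumes [measurable]: "f \<in> measurable (Rn n) (Rn p)"
  shows "(\<lambda>y. emp_norm n (vsub y (matvec n p X (f y)))) \<in> borel_measurable (Rn n)"
  unfolding emp_norm_def vsub_def matvec_def restrict_def by measurable

lemma measurable_prediction_error:
  assumes [measurable]: "f \<in> measurable (Rn n) (Rn p)"
  shows "(\<lambda>y. emp_norm n (matvec n p X (vsub (f y) b))) \<in> borel_measurable (Rn n)"
  unfolding emp_norm_def vsub_def matvec_def restrict_def by measurable

text \<open>
  The minimum in the definition of the selected level is rewritten as a least natural number,
  which is measurable as soon as membership of each single level is.
\<close>

lemma measurable_adapt_m:
  fixes B :: "nat \<Rightarrow> (nat \<Rightarrow> real) \<Rightarrow> nat \<Rightarrow> real"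
  assumes B: "\<And>k. k \<le> adapt_M t + 1 \<Longrightarrow> B (2 ^ k) \<in> measurable (Rn n) (Rn p)"
  shows "adapt_m n p X t (\<lambda>u v. lq_norm p q (vsub u v)) w C0 B \<in> measurable (Rn n) (count_space UNIV)"
proof -
  let ?M = "adapt_M t"
  let ?S = "adapt_S1 n p X t (\<lambda>u v. lq_norm p q (vsub u v)) w C0 B"
  have sig: "adapt_sigma_hat n p X t B \<in> borel_measurable (Rn n)"
    unfolding adapt_sigma_hat_def[abs_def] using B[of "?M + 1"] by (intro measurable_residual_norm) simp
  have S [measurable]: "Measurable.pred (Rn n) (\<lambda>y. m \<in> ?S y)" for m
  proof (cases "m \<in> {1..?M}")
    case True
    have "Measurable.pred (Rn n) (\<lambda>y. \<forall>k\<in>{m..?M}.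
        lq_norm p q (vsub (B (2 ^ (k - 1)) y) (B (2 ^ k) y)) \<le> 4 * adapt_sigma_hat n p X t B y * C0 * w (2 ^ k))"
    proof (rule pred_intros_finite)
      fix k assume "k \<in> {m..?M}"
      then have dist: "(\<lambda>y. lq_norm p q (vsub (B (2 ^ (k - 1)) y) (B (2 ^ k) y))) \<in> borel_measurable (Rn n)"
        by (intro measurable_lq_norm_vsub B) auto
      show "Measurable.pred (Rn n) (\<lambda>y. lq_norm p q (vsub (B (2 ^ (k - 1)) y) (B (2 ^ k) y))
          \<le> 4 * adapt_sigma_hat n p X t B y * C0 * w (2 ^ k))"
        unfolding pred_def by (intro borel_measurable_le borel_measurable_times dist sig borel_measurable_const)
    qed simp
    then show ?thesis using True by (simp add: adapt_S1_def)
  next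
    case False
    then have "(\<lambda>y. m \<in> ?S y) = (\<lambda>y. False)" by (auto simp: adapt_S1_def)
    then show ?thesis by simp
  qed
  have eq: "adapt_m n p X t (\<lambda>u v. lq_norm p q (vsub u v)) w C0 B
     = (\<lambda>y. if \<exists>m. m \<in> ?S y then LEAST m. m \<in> ?S y else ?M)"
  proof
    fix y
    have "finite (?S y)" by (rule finite_subset[of _ "{1..?M}"]) (auto simp: adapt_S1_def)
    then show "adapt_m n p X t (\<lambda>u v. lq_norm p q (vsub u v)) w C0 B y
       = (if \<exists>m. m \<in> ?S y then LEAST m. m \<in> ?S y else ?M)"
      using Least_Min[of "\<lambda>m. m \<in> ?S y"] unfolding adapt_m_def by auto
  qed
  show ?thesis unfolding eq by measurable
qed

lemma adapt_m_range:
  assumes "1 \<le> adapt_M t"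
  shows "adapt_m n p X t d w C0 B y \<in> {1..adapt_M t}"
proof -
  have sub: "adapt_S1 n p X t d w C0 B y \<subseteq> {1..adapt_M t}" by (auto simp: adapt_S1_def)
  have "finite (adapt_S1 n p X t d w C0 B y)" by (rule finite_subset[OF sub]) simp
  then have "Min (adapt_S1 n p X t d w C0 B y) \<in> {1..adapt_M t}" if "adapt_S1 n p X t d w C0 B y \<noteq> {}"
    using Min_in that sub by blast
  then show ?thesis
    unfolding adapt_m_def using assms by simp
qed

text \<open>
  The selected level has finitely many values, so the event splits into finitely many events about
  fixed members of the family.
\<close>

lemma adapt_events_measurable:
  fixes B :: "nat \<Rightarrow> (nat \<Rightarrow> real) \<Rightarrow> nat \<Rightarrow> real" and q :: real
  assumes B: "\<And>k. k \<le> adapt_M t + 1 \<Longrightarrow> B (2 ^ k) \<in> measurable (Rn n) (Rn p)"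
    and M: "1 \<le> adapt_M t" and b: "b \<in> space (Rn p)"
  defines "d \<equiv> \<lambda>u v. lq_norm p q (vsub u v)"
  shows "{y \<in> space (Rn n). lq_norm p q (vsub (adapt_beta n p X t d w C0 B y) b) \<le> r} \<in> sets (Rn n)"
    and "{y \<in> space (Rn n). adapt_s n p X t d w C0 B y \<le> c} \<in> sets (Rn n)"
proof -
  let ?m = "adapt_m n p X t d w C0 B"
  have m [measurable]: "?m \<in> measurable (Rn n) (count_space UNIV)"
    unfolding d_def by (rule measurable_adapt_m) (rule B)
  show "{y \<in> space (Rn n). adapt_s n p X t d w C0 B y \<le> c} \<in> sets (Rn n)"
    unfolding adapt_s_def by measurable
  have "{y \<in> space (Rn n). lq_norm p q (vsub (adapt_beta n p X t d w C0 B y) b) \<le> r}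
     = {y \<in> space (Rn n). \<exists>k\<in>{1..adapt_M t}. ?m y = k \<and> lq_norm p q (vsub (B (2 ^ k) y) b) \<le> r}"
    using adapt_m_range[OF M] by (auto simp: adapt_beta_def adapt_s_def)
  also have "\<dots> \<in> sets (Rn n)"
  proof -
    have "Measurable.pred (Rn n) (\<lambda>y. \<exists>k\<in>{1..adapt_M t}. ?m y = k \<and> lq_norm p q (vsub (B (2 ^ k) y) b) \<le> r)"
    proof (rule pred_intros_finite)
      fix k assume "k \<in> {1..adapt_M t}"
      then have [measurable]: "(\<lambda>y. lq_norm p q (vsub (B (2 ^ k) y) b)) \<in> borel_measurable (Rn n)"
        using b by (intro measurable_lq_norm_vsub B measurable_const) auto
      show "Measurable.pred (Rn n) (\<lambda>y. ?m y = k \<and> lq_norm p q (vsub (B (2 ^ k) y) b) \<le> r)"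
        by measurable
    qed simp
    then show ?thesis by (simp add: pred_def)
  qed
  finally show "{y \<in> space (Rn n). lq_norm p q (vsub (adapt_beta n p X t d w C0 B y) b) \<le> r} \<in> sets (Rn n)" .
qed

section \<open>Probability bounds for the adaptive estimator\<close>

lemma sql_prediction_constantD:
  assumes "sql_prediction_constant \<gamma> C" and "b \<in> B0 p s" and "1 \<le> n" "1 \<le> s" "real s \<le> 2 * real p / exp 1" "0 < \<sigma>"
    and "SRE n p X s (5/3)"
    and "real s / real n * ln (2 * real p / real s) \<le> 9 * (kappa n p X s (5/3))\<^sup>2 / (256 * \<gamma>\<^sup>2)"
    and "sql_estimator n p X s \<gamma> B"
  shows "1 - (real s / real p) ^ s - (1 + (exp 1)\<^sup>2) * exp (- real n / 24)
    \<le> measure (model_law n p X \<sigma> b) {y \<in> space (model_law n p X \<sigma> b).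
         emp_norm n (matvec n p X (vsub (B y) b))
           \<le> C / (kappa n p X s (5/3))\<^sup>2 * \<sigma> * sqrt (real s / real n * ln (real p / real s))}"
  using assms unfolding sql_prediction_constant_def by blast

lemma space_model_law [simp]: "space (model_law n p X \<sigma> b) = space (Rn n)"
  by (simp add: model_law_def)

lemma measurable_observation: "(\<lambda>e. \<lambda>i\<in>{..<n}. matvec n p X b i + e i) \<in> measurable (gauss_noise n \<sigma>) (Rn n)"
  unfolding Rn_def[of n]
proof (rule measurable_restrict)
  fix i assume "i \<in> {..<n}"
  then have [measurable]: "(\<lambda>e. e i) \<in> borel_measurable (gauss_noise n \<sigma>)"
    by (subst measurable_cong_sets[OF sets_gauss_noise refl]) (rule measurable_Rn_component)
  show "(\<lambda>e. matvec n p X b i + e i) \<in> borel_measurable (gauss_noise n \<sigma>)" by measurable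
qed

text \<open>
  Transfer from the noise to the observation: \<open>A\<close> is an event about the noise, \<open>D\<close> and \<open>G\<close> are
  events about the observation.
\<close>

lemma model_law_prob_ge:
  assumes \<sigma>: "0 < \<sigma>" and A: "A \<in> sets (gauss_noise n \<sigma>)" "1 - \<alpha> \<le> measure (gauss_noise n \<sigma>) A"
    and D: "D \<in> sets (Rn n)" "1 - \<beta> \<le> measure (model_law n p X \<sigma> b) D"
    and G: "G \<in> sets (Rn n)"
    and impl: "\<And>y. y \<in> D \<Longrightarrow> (\<lambda>i\<in>{..<n}. vsub y (matvec n p X b) i) \<in> A \<Longrightarrow> y \<in> G"
  shows "1 - (\<alpha> + \<beta>) \<le> measure (model_law n p X \<sigma> b) G"
proof -
  interpret prob_space "gauss_noise n \<sigma>" using \<sigma> by (rule prob_space_gauss_noise)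
  define T where "T = (\<lambda>e. \<lambda>i\<in>{..<n}. matvec n p X b i + e i)"
  have T: "T \<in> measurable (gauss_noise n \<sigma>) (Rn n)" unfolding T_def by (rule measurable_observation)
  have law: "measure (model_law n p X \<sigma> b) H = prob (T -` H \<inter> space (gauss_noise n \<sigma>))" if "H \<in> sets (Rn n)" for H
    unfolding model_law_def T_def[symmetric] using T that by (rule measure_distr)
  have pre: "T -` H \<inter> space (gauss_noise n \<sigma>) \<in> events" if "H \<in> sets (Rn n)" for H
    using T that by (rule measurable_sets)
  have "1 - (\<alpha> + \<beta>) \<le> prob (A \<inter> (T -` D \<inter> space (gauss_noise n \<sigma>)))"
    using A D law pre by (intro prob_Int_ge) auto
  also have "\<dots> \<le> prob (T -` G \<inter> space (gauss_noise n \<sigma>))"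
  proof (rule finite_measure_mono[OF _ pre[OF G]], safe)
    fix e assume e: "e \<in> A" "T e \<in> D" "e \<in> space (gauss_noise n \<sigma>)"
    have "(\<lambda>i\<in>{..<n}. vsub (T e) (matvec n p X b) i) = e"
      using e(3) by (auto simp: T_def vsub_def Rn_def space_PiM PiE_def extensional_def fun_eq_iff)
    then show "e \<in> T -` G" using impl[OF e(2)] e(1) by simp
  qed
  finally show ?thesis using law[OF G] by simp
qed

theorem corollary4p7:
  fixes C2 :: "real \<Rightarrow> real" and \<gamma> \<kappa>s :: real
  assumes C2: "\<forall>g \<ge> 16 + 4 * sqrt 2. sql_prediction_constant g (C2 g)"
    and \<gamma>: "\<gamma> \<ge> 16 + 4 * sqrt 2"
  shows "\<exists>C0 > 0. \<exists>C5 > 0.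
    \<forall>(n::nat) (p::nat) (X :: nat \<Rightarrow> nat \<Rightarrow> real) (\<sigma>::real) (sm::nat)
      (B :: nat \<Rightarrow> (nat \<Rightarrow> real) \<Rightarrow> nat \<Rightarrow> real) (q::real).
      1 \<le> n \<longrightarrow> 0 < \<sigma> \<longrightarrow>
      2 \<le> sm \<longrightarrow> real sm \<le> real p / exp 1 \<longrightarrow>
      SRE n p X (2 * sm) (5/3) \<longrightarrow>
      \<kappa>s = kappa n p X (2 * sm) (5/3) \<longrightarrow>
      2 * real sm / real n * ln (real p / real sm)
        \<le> min (9 * \<kappa>s\<^sup>2 / (256 * \<gamma>\<^sup>2)) (\<kappa>s ^ 4 / (2 * (C2 \<gamma>)\<^sup>2) * (1 / sqrt 2 - 1 / 2)\<^sup>2) \<longrightarrow>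
      (\<forall>s \<in> {1..sm} \<union> {2 ^ (adapt_M sm + 1)}. sql_estimator n p X s \<gamma> (B s)) \<longrightarrow>
      1 \<le> q \<longrightarrow> q \<le> 2 \<longrightarrow>
      (let M = adapt_M sm;
           d = (\<lambda>b b'. lq_norm p q (vsub b b'));
           w = (\<lambda>b. b powr (1 / q) * sqrt (1 / real n * ln (2 * real p / b)));
           u = (1 + (exp 1)\<^sup>2) * exp (- real n / 24);
           uM = (2 ^ (M + 1) / real p) ^ (2 ^ (M + 1)) + (1 + (exp 1)\<^sup>2) * exp (- real n / 24)
       in \<forall>s \<in> {1..sm}. \<forall>b \<in> B0 p s.
            measure (model_law n p X \<sigma> b)
              {y \<in> space (model_law n p X \<sigma> b).
                 lq_norm p q (vsub (adapt_beta n p X sm d w C0 B y) b)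
                   \<le> C5 * \<sigma> * real s powr (1 / q) * sqrt (1 / real n * ln (real p / real s))}
              \<ge> 1 - 3 * (log 2 (real sm) + 1)\<^sup>2 * ((2 * real s / real p) ^ (2 * s) + u) - uM
          \<and> measure (model_law n p X \<sigma> b)
              {y \<in> space (model_law n p X \<sigma> b). adapt_s n p X sm d w C0 B y \<le> max 2 s}
              \<ge> 1 - 2 * (log 2 (real sm) + 1)\<^sup>2 * ((2 * real s / real p) ^ (2 * s) + u) - uM)"
proof -
  define K where "K = 656 * \<gamma> / \<kappa>s\<^sup>2 + 1"
  have \<gamma>0: "0 < \<gamma>" using \<gamma> by (rule less_le_trans[rotated]) (simp add: add_pos_pos)
  \<comment> \<open>The summand \<open>1\<close> in \<open>K\<close> keeps the constants positive for degenerate values of \<open>\<kappa>s\<close>.\<close>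
  have K: "0 < K" using \<gamma>0 by (simp add: K_def add_nonneg_pos)
  have C2pos: "0 < C2 \<gamma>" using C2 \<gamma> by (auto simp: sql_prediction_constant_def)
  \<comment> \<open>Both claims hold on the same event, so the bound with factor 2 serves both.\<close>
  have main: "1 - 2 * (log 2 (real t) + 1)\<^sup>2 * ((2 * real s / real p) ^ (2 * s) + (1 + (exp 1)\<^sup>2) * exp (- real n / 24))
        - ((2 ^ (adapt_M t + 1) / real p) ^ (2 ^ (adapt_M t + 1)) + (1 + (exp 1)\<^sup>2) * exp (- real n / 24))
      \<le> measure (model_law n p X \<sigma> b) G"
    if n: "1 \<le> n" and \<sigma>: "0 < \<sigma>" and t: "2 \<le> t" "real t \<le> real p / exp 1"
      and SRE: "SRE n p X (2 * t) (5/3)" and \<kappa>: "\<kappa>s = kappa n p X (2 * t) (5/3)"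
      and hyp: "2 * real t / real n * ln (real p / real t)
        \<le> min (9 * \<kappa>s\<^sup>2 / (256 * \<gamma>\<^sup>2)) (\<kappa>s ^ 4 / (2 * (C2 \<gamma>)\<^sup>2) * (1 / sqrt 2 - 1 / 2)\<^sup>2)"
      and B: "\<forall>s \<in> {1..t} \<union> {2 ^ (adapt_M t + 1)}. sql_estimator n p X s \<gamma> (B s)"
      and q: "1 \<le> q" "q \<le> 2" and s: "s \<in> {1..t}" and b: "b \<in> B0 p s"
      and G: "G = {y \<in> space (Rn n). lq_norm p q (vsub (adapt_beta n p X t (\<lambda>u v. lq_norm p q (vsub u v)) (weight n p q) K B y) b)
            \<le> 1000 * K * \<sigma> * real s powr (1 / q) * sqrt (1 / real n * ln (real p / real s))}
        \<or> G = {y \<in> space (Rn n). adapt_s n p X t (\<lambda>u v. lq_norm p q (vsub u v)) (weight n p q) K B y \<le> max 2 s}"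
    for n p t s :: nat and X \<sigma> B q b G
  proof -
    let ?M = "adapt_M t"
    let ?S = "2 ^ (?M + 1) :: nat"
    have te: "real t * exp 1 \<le> real p" using t by (simp add: pos_le_divide_eq)
    have s1: "1 \<le> s" "s \<le> t" using s by auto
    have "real t * 1 \<le> real t * exp 1" by (intro mult_left_mono) auto
    then have tp: "t \<le> p" using te by linarith
    have p: "0 < p" using tp t by simp
    have n0: "0 < n" using n by simp
    have \<kappa>pos: "0 < \<kappa>s" using SRE \<kappa> by (simp add: SRE_def)
    have \<kappa>1: "\<kappa>s \<le> 1" unfolding \<kappa> using SRE p t by (intro kappa_le_1) auto
    have Mt: "2 ^ ?M \<le> t" "real ?M \<le> log 2 (real t)" using adapt_M_bounds[of t] t by auto
    have M1: "1 \<le> ?M" using adapt_M_bounds(2)[of t] t by (cases ?M) auto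
    have kt: "2 ^ k \<le> t" if "k \<le> ?M" for k
      by (rule order_trans[OF power_increasing[OF that] Mt(1)]) simp
    have est: "sql_estimator n p X (2 ^ k) \<gamma> (B (2 ^ k))" if "k \<le> ?M + 1" for k
      using B kt[of k] that by (cases "k = ?M + 1") auto
    have Bm: "B (2 ^ k) \<in> measurable (Rn n) (Rn p)" if "k \<le> ?M + 1" for k
      using est[OF that] by (simp add: sql_estimator_def)
    have bs: "b \<in> space (Rn p)" "l0_norm p b \<le> s" using b by (auto simp: B0_def)
    have G_sets: "G \<in> sets (Rn n)"
      using G adapt_events_measurable[where B = B and t = t and n = n and p = p, OF _ M1 bs(1)] Bm by auto
    have cols: "ip n (\<lambda>i. X i j) (\<lambda>i. X i j) \<le> real n" if "j < p" for j
    proof -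
      have "lincomb p X (basis_vec p j) = (\<lambda>i. X i j)"
        unfolding lincomb_single[OF that, symmetric] lincomb_def
        by (intro ext sum.cong) (auto simp: basis_vec_def)
      moreover have "sqrt (ip n (lincomb p X (basis_vec p j)) (lincomb p X (basis_vec p j)) / real n) \<le> 1"
        using SRE that unfolding SRE_def emp_norm_matvec by blast
      ultimately have "sqrt (ip n (\<lambda>i. X i j) (\<lambda>i. X i j) / real n) \<le> 1" by simp
      then show ?thesis using n0 by simp
    qed
    \<comment> \<open>The truth may be less sparse than the tuning: level \<open>k\<close> uses the noise bound at \<open>max s (2 ^ k)\<close>.\<close>
    define I where "I = (\<lambda>k. max s (2 ^ k)) ` {..?M}"
    have cI: "card I \<le> ?M + 1" unfolding I_def using card_image_le[of "{..?M}"] by simp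
    define F where "F = (2 * real s / real p) ^ (2 * s)"
    obtain A where A: "A \<in> sets (gauss_noise n \<sigma>)"
      "1 - (real (card I) * F + 2 * exp (- real n / 24)) \<le> measure (gauss_noise n \<sigma>) A"
      "\<And>e. e \<in> A \<Longrightarrow> real n * \<sigma>\<^sup>2 / 2 \<le> (\<Sum>i<n. (e i)\<^sup>2) \<and> (\<Sum>i<n. (e i)\<^sup>2) \<le> 4 * (real n * \<sigma>\<^sup>2)"
      "\<And>e t d. e \<in> A \<Longrightarrow> t \<in> I \<Longrightarrow> ip n e (lincomb p X d)
        \<le> sqrt (real n * (16 * \<sigma>\<^sup>2 * ln (2 * real p / real t))) * (\<Sum>j<p. \<bar>d j\<bar>)
        + 2 * sqrt (real t * (16 * \<sigma>\<^sup>2 * ln (2 * real p / real t))) * sqrt (ip n (lincomb p X d) (lincomb p X d))"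
    proof (rule gauss_noise_good_event[where n = n and p = p and X = X and \<sigma> = \<sigma> and s = s and I = I, folded F_def])
      show "real x * exp 1 \<le> real p" if "x \<in> I" for x
      proof -
        have "x \<le> t" using that s1 kt by (auto simp: I_def)
        then have "real x * exp 1 \<le> real t * exp 1" by (intro mult_right_mono) auto
        then show ?thesis using te by linarith
      qed
    qed (use n0 \<sigma> s1 cols in \<open>auto simp: I_def\<close>)
    have S2: "?S \<le> 2 * t" using Mt by simp
    \<comment> \<open>The event that the pilot estimator \<open>B (2 ^ (M + 1))\<close> predicts well has failure probability \<open>uM\<close>.\<close>
    define D where "D = {y \<in> space (Rn n). emp_norm n (matvec n p X (vsub (B ?S y) b))
        \<le> C2 \<gamma> / (kappa n p X ?S (5/3))\<^sup>2 * \<sigma> * sqrt (real ?S / real n * ln (real p / real ?S))}"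
    have D_sets: "D \<in> sets (Rn n)"
      unfolding D_def using measurable_prediction_error[OF Bm[of "?M + 1"], of X b] by measurable
    have \<kappa>S: "\<kappa>s \<le> kappa n p X ?S (5/3)"
      unfolding \<kappa> using S2 p by (intro kappa_antimono) auto
    have lnS: "real ?S / real n * ln (2 * real p / real ?S) \<le> 2 * real t / real n * ln (real p / real t)"
    proof -
      have "real ?S * ln (2 * real p / real ?S) \<le> real (2 * t) * ln (2 * real p / real (2 * t))"
        using S2 te by (intro mult_ln_mono) auto
      then have "real ?S * ln (2 * real p / real ?S) / real n \<le> real (2 * t) * ln (2 * real p / real (2 * t)) / real n"
        by (rule divide_right_mono) simp
      then show ?thesis by simp
    qed
    have Sp: "1 - ((real ?S / real p) ^ ?S + (1 + (exp 1)\<^sup>2) * exp (- real n / 24)) \<le> measure (model_law n p X \<sigma> b) D"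
    proof -
      have ad: "sql_prediction_constant \<gamma> (C2 \<gamma>)" using C2 \<gamma> by auto
      have b': "b \<in> B0 p ?S"
      proof -
        have "s \<le> ?S" using adapt_M_bounds(2)[of t] t s1 by simp
        then show ?thesis using b by (auto simp: B0_def)
      qed
      have le: "real ?S \<le> 2 * real p / exp 1"
      proof -
        have "real ?S \<le> real (2 * t)" using S2 by (rule of_nat_mono)
        also have "\<dots> = 2 * real t" by simp
        also have "\<dots> \<le> 2 * (real p / exp 1)" using t(2) by (rule mult_left_mono) simp
        finally show ?thesis by simp
      qed
      have SRE': "SRE n p X ?S (5/3)" using SRE \<kappa>S \<kappa>pos by (auto simp: SRE_def)
      have "9 * \<kappa>s\<^sup>2 / (256 * \<gamma>\<^sup>2) \<le> 9 * (kappa n p X ?S (5/3))\<^sup>2 / (256 * \<gamma>\<^sup>2)"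
        using \<kappa>S \<kappa>pos by (intro divide_right_mono mult_left_mono power_mono) auto
      then have sm: "real ?S / real n * ln (2 * real p / real ?S) \<le> 9 * (kappa n p X ?S (5/3))\<^sup>2 / (256 * \<gamma>\<^sup>2)"
        using lnS hyp by linarith
      have "1 - (real ?S / real p) ^ ?S - (1 + (exp 1)\<^sup>2) * exp (- real n / 24)
         \<le> measure (model_law n p X \<sigma> b) {y \<in> space (model_law n p X \<sigma> b).
             emp_norm n (matvec n p X (vsub (B ?S y) b))
               \<le> C2 \<gamma> / (kappa n p X ?S (5/3))\<^sup>2 * \<sigma> * sqrt (real ?S / real n * ln (real p / real ?S))}"
        by (rule sql_prediction_constantD[OF ad b' n _ le \<sigma> SRE' sm est]) auto
      then show ?thesis by (simp add: D_def)
    qed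
    have "1 - ((real (card I) * F + 2 * exp (- real n / 24)) + ((real ?S / real p) ^ ?S + (1 + (exp 1)\<^sup>2) * exp (- real n / 24)))
        \<le> measure (model_law n p X \<sigma> b) G"
    proof (rule model_law_prob_ge[OF \<sigma> A(1,2) D_sets Sp G_sets])
      fix y assume y: "y \<in> D" and yA: "(\<lambda>i\<in>{..<n}. vsub y (matvec n p X b) i) \<in> A"
      define e where "e = vsub y (matvec n p X b)"
      have sp: "y \<in> space (Rn n)" using y by (simp add: D_def)
      have N: "real n * \<sigma>\<^sup>2 / 2 \<le> (\<Sum>i<n. (e i)\<^sup>2)" "(\<Sum>i<n. (e i)\<^sup>2) \<le> 4 * (real n * \<sigma>\<^sup>2)"
        using A(3)[OF yA] by (auto simp: e_def)
      have ipe: "ip n (\<lambda>i\<in>{..<n}. vsub y (matvec n p X b) i) v = ip n e v" for v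
        by (simp add: ip_def e_def)
      have noise: "ip n e (lincomb p X d) \<le> sqrt (real n * (16 * \<sigma>\<^sup>2 * ln (2 * real p / real (max s (2 ^ k))))) * (\<Sum>j<p. \<bar>d j\<bar>)
        + 2 * sqrt (real (max s (2 ^ k)) * (16 * \<sigma>\<^sup>2 * ln (2 * real p / real (max s (2 ^ k))))) * sqrt (ip n (lincomb p X d) (lincomb p X d))"
        if "k \<le> ?M" for k d
        using A(4)[OF yA, of "max s (2 ^ k)" d] that unfolding ipe I_def by blast
      have mn: "sql_objective n p X (2 ^ k) \<gamma> y (B (2 ^ k) y) \<le> sql_objective n p X (2 ^ k) \<gamma> y b" if "k \<le> ?M" for k
        using est[of k] that sp bs(1) by (simp add: sql_estimator_def)
      have "emp_norm n (matvec n p X (vsub (B ?S y) b)) \<le> \<sigma> * (1 / sqrt 2 - 1 / 2)"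
      proof -
        have "C2 \<gamma> / (kappa n p X ?S (5/3))\<^sup>2 * \<sigma> * sqrt (real ?S / real n * ln (real p / real ?S)) \<le> \<sigma> * (1 / sqrt 2 - 1 / 2)"
          using hyp by (intro pilot_prediction_radius[OF n0 C2pos \<kappa>pos \<kappa>S \<sigma> _ S2 te]) auto
        then show ?thesis using y by (simp add: D_def)
      qed
      note sig = sigma_hat_bounds[OF n0 \<sigma> e_def N this, folded adapt_sigma_hat_def]
      have hyp1: "2 * real t / real n * ln (real p / real t) \<le> 9 * \<kappa>s\<^sup>2 / (256 * \<gamma>\<^sup>2)" using hyp by simp
      show "y \<in> G"
        using adaptive_estimator_on_good_event[OF n0 \<sigma> \<gamma> q t(1) te \<kappa> \<kappa>pos \<kappa>1 hyp1 s1 bs(2) e_def N noise mn sig]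
          G sp unfolding K_def by auto
    qed
    moreover have "real (card I) * F + 2 * exp (- real n / 24)
      \<le> 2 * (log 2 (real t) + 1)\<^sup>2 * (F + (1 + (exp 1)\<^sup>2) * exp (- real n / 24))"
    proof -
      define L where "L = log 2 (real t) + 1"
      have L: "real ?M + 1 \<le> L" using Mt by (simp add: L_def)
      have L1: "1 \<le> L" using L M1 by simp
      have LL: "L \<le> L\<^sup>2" using L1 self_le_power[of L 2] by simp
      have F: "0 \<le> F" by (simp add: F_def)
      have "real (card I) \<le> 2 * L\<^sup>2" using cI L LL L1 by linarith
      then have "real (card I) * F \<le> 2 * L\<^sup>2 * F" using F by (rule mult_right_mono)
      moreover have "2 * exp (- real n / 24) \<le> 2 * L\<^sup>2 * ((1 + (exp 1)\<^sup>2) * exp (- real n / 24))"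
      proof -
        have "1 \<le> L\<^sup>2" using LL L1 by linarith
        then have "1 * 1 \<le> L\<^sup>2 * (1 + (exp 1)\<^sup>2)" by (intro mult_mono) auto
        then have "1 * exp (- real n / 24) \<le> L\<^sup>2 * (1 + (exp 1)\<^sup>2) * exp (- real n / 24)"
          by (intro mult_right_mono) auto
        then show ?thesis by simp
      qed
      ultimately show ?thesis unfolding L_def[symmetric] distrib_left by linarith
    qed
    ultimately show ?thesis unfolding F_def by simp
  qed
  have weaken: "1 - 3 * L\<^sup>2 * (F + u) - v \<le> 1 - 2 * L\<^sup>2 * (F + u) - v"
    if "0 \<le> F" "0 \<le> u" for L F u v :: real
    using that by (intro diff_right_mono diff_left_mono mult_right_mono) auto
  have w_eq: "(\<lambda>b. b powr (1 / q) * sqrt (1 / real n * ln (2 * real p / b))) = weight n p q" for n p q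
    by (simp add: weight_def fun_eq_iff)
  show ?thesis
    unfolding Let_def w_eq space_model_law
  proof (rule exI[of _ K], rule conjI[OF K], rule exI[of _ "1000 * K"], intro conjI allI impI ballI)
    show "0 < 1000 * K" using K by simp
  next
    fix n p t s :: nat and X B b and \<sigma> q :: real
    assume *: "1 \<le> n" "0 < \<sigma>" "2 \<le> t" "real t \<le> real p / exp 1" "SRE n p X (2 * t) (5/3)"
      "\<kappa>s = kappa n p X (2 * t) (5/3)"
      "2 * real t / real n * ln (real p / real t)
        \<le> min (9 * \<kappa>s\<^sup>2 / (256 * \<gamma>\<^sup>2)) (\<kappa>s ^ 4 / (2 * (C2 \<gamma>)\<^sup>2) * (1 / sqrt 2 - 1 / 2)\<^sup>2)"
      "\<forall>s \<in> {1..t} \<union> {2 ^ (adapt_M t + 1)}. sql_estimator n p X s \<gamma> (B s)"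
      "1 \<le> q" "q \<le> 2" "s \<in> {1..t}" "b \<in> B0 p s"
    note m = main[OF *]
    show "1 - 2 * (log 2 (real t) + 1)\<^sup>2 * ((2 * real s / real p) ^ (2 * s) + (1 + (exp 1)\<^sup>2) * exp (- real n / 24))
        - ((2 ^ (adapt_M t + 1) / real p) ^ (2 ^ (adapt_M t + 1)) + (1 + (exp 1)\<^sup>2) * exp (- real n / 24))
      \<le> measure (model_law n p X \<sigma> b)
          {y \<in> space (Rn n). adapt_s n p X t (\<lambda>b b'. lq_norm p q (vsub b b')) (weight n p q) K B y \<le> max 2 s}"
      by (rule m[OF disjI2]) (rule refl)
    have "1 - 2 * (log 2 (real t) + 1)\<^sup>2 * ((2 * real s / real p) ^ (2 * s) + (1 + (exp 1)\<^sup>2) * exp (- real n / 24))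
        - ((2 ^ (adapt_M t + 1) / real p) ^ (2 ^ (adapt_M t + 1)) + (1 + (exp 1)\<^sup>2) * exp (- real n / 24))
      \<le> measure (model_law n p X \<sigma> b)
          {y \<in> space (Rn n). lq_norm p q (vsub (adapt_beta n p X t (\<lambda>b b'. lq_norm p q (vsub b b')) (weight n p q) K B y) b)
            \<le> 1000 * K * \<sigma> * real s powr (1 / q) * sqrt (1 / real n * ln (real p / real s))}"
      by (rule m[OF disjI1]) (rule refl)
    then show "1 - 3 * (log 2 (real t) + 1)\<^sup>2 * ((2 * real s / real p) ^ (2 * s) + (1 + (exp 1)\<^sup>2) * exp (- real n / 24))
        - ((2 ^ (adapt_M t + 1) / real p) ^ (2 ^ (adapt_M t + 1)) + (1 + (exp 1)\<^sup>2) * exp (- real n / 24))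
      \<le> measure (model_law n p X \<sigma> b)
          {y \<in> space (Rn n). lq_norm p q (vsub (adapt_beta n p X t (\<lambda>b b'. lq_norm p q (vsub b b')) (weight n p q) K B y) b)
            \<le> 1000 * K * \<sigma> * real s powr (1 / q) * sqrt (1 / real n * ln (real p / real s))}"
      by (rule order_trans[OF weaken, rotated 2]) auto
  qed
qed

end
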